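(* Let $n\ge1$ and let $\boldsymbol x=\{x_1,\dots,x_{2n}\}$ be distinct real points. If $R\in\mathrm{CRR}_{n+1}(\boldsymbol x)$ then $\Gamma(R)$ has the geodesic multichord property: writing $\eta_1,\dots,\eta_n$ for the $n$ curves of $\Gamma(R)$ in $\mathbb H$, for each $j$ the curve $\eta_j$ is the hyperbolic geodesic, connecting the two endpoints of $\eta_j$, in the connected component of $\mathbb H\setminus\bigcup_{k\ne j}\eta_k$ that contains $\eta_j$.
   Context: $\mathbb H$ is the upper half-plane, $\widehat{\mathbb C}$ the Riemann sphere, $\widehat{\mathbb R}=\mathbb R\cup\{\infty\}$. $\mathrm{CRR}_{n+1}(\boldsymbol x)$ is the set of rational functions with real coefficients, of degree $n+1$, whose critical points are precisely $\boldsymbol x$. The real locus is $\Gamma(R)=\{z\in\widehat{\mathbb C}:R(z)\in\widehat{\mathbb R}\}$; for $R\in\mathrm{CRR}_{n+1}(\boldsymbol x)$ it consists of the real line, $n$ non-crossing simple curves in $\mathbb H$ which connect the points of $\boldsymbol x$ in pairs according to some non-crossing link pattern, and the complex conjugates of these curves. *)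

theory Defs
  imports "HOL-Complex_Analysis.Complex_Analysis"
begin

section \<open>Rational functions on the Riemann sphere\<close>

text \<open>
  The Riemann sphere is \<^typ>\<open>complex option\<close>, with \<^const>\<open>None\<close> as the point at infinity
  (as in the carrier of \<^const>\<open>Alexandroff_compactification\<close>).
\<close>

type_synonym riemann_sphere = "complex option"

definition extended_reals :: "riemann_sphere set" where
  "extended_reals = insert None (Some ` \<real>)"

text \<open>
  The map of the sphere induced by \<open>p / q\<close>. It is the intended one only if \<open>p\<close> and \<open>q\<close> are
  coprime and \<open>q \<noteq> 0\<close>. At infinity its value is the limit of \<open>p z / q z\<close>; if
  \<open>degree p < degree q\<close> then \<open>coeff p (degree q) = 0\<close>.
\<close>

definition rational_map :: "real poly \<Rightarrow> real poly \<Rightarrow> riemann_sphere \<Rightarrow> riemann_sphere" where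
  "rational_map p q z =
     (case z of
        Some w \<Rightarrow>
          (if poly (map_poly of_real q) w = 0 then None
           else Some (poly (map_poly of_real p) w / poly (map_poly of_real q) w))
      | None \<Rightarrow>
          (if degree p > degree q then None
           else Some (of_real (coeff p (degree q) / lead_coeff q))))"

text \<open>
  A holomorphic chart around \<open>a\<close> and its inverse: the identity if \<open>a\<close> is finite, and \<open>z \<mapsto> 1 / z\<close>
  if \<open>a\<close> is infinity. The value of \<open>sphere_chart a\<close> off the domain of the chart
  (at infinity, respectively at \<open>0\<close>) is irrelevant.
\<close>

definition sphere_chart :: "riemann_sphere \<Rightarrow> riemann_sphere \<Rightarrow> complex" where
  "sphere_chart a z =
     (case a of
        Some _ \<Rightarrow> (case z of Some w \<Rightarrow> w | None \<Rightarrow> 0)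
      | None \<Rightarrow> (case z of Some w \<Rightarrow> 1 / w | None \<Rightarrow> 0))"

definition sphere_chart_inv :: "riemann_sphere \<Rightarrow> complex \<Rightarrow> riemann_sphere" where
  "sphere_chart_inv a w =
     (case a of
        Some _ \<Rightarrow> Some w
      | None \<Rightarrow> (if w = 0 then None else Some (1 / w)))"

definition critical_point :: "(riemann_sphere \<Rightarrow> riemann_sphere) \<Rightarrow> riemann_sphere \<Rightarrow> bool" where
  "critical_point R a \<longleftrightarrow>
     ((\<lambda>w. sphere_chart (R a) (R (sphere_chart_inv a w))) has_field_derivative 0)
       (at (sphere_chart a a))"

definition CRR :: "nat \<Rightarrow> real set \<Rightarrow> (riemann_sphere \<Rightarrow> riemann_sphere) set" where
  "CRR d X =
     {R. (\<exists>p q. q \<noteq> 0 \<and> coprime p q \<and> max (degree p) (degree q) = d \<and> R = rational_map p q)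
         \<and> {a. critical_point R a} = (\<lambda>x. Some (of_real x)) ` X}"

definition real_locus :: "(riemann_sphere \<Rightarrow> riemann_sphere) \<Rightarrow> riemann_sphere set" where
  "real_locus R = {z. R z \<in> extended_reals}"


section \<open>Hyperbolic geodesics\<close>

definition upper_half_plane :: "complex set" where
  "upper_half_plane = {z. Im z > 0}"

definition uhp_dist :: "complex \<Rightarrow> complex \<Rightarrow> real" where
  "uhp_dist z w = arcosh (1 + (cmod (z - w))\<^sup>2 / (2 * Im z * Im w))"

definition conformal_onto :: "(complex \<Rightarrow> complex) \<Rightarrow> complex set \<Rightarrow> complex set \<Rightarrow> bool" where
  "conformal_onto \<phi> D E \<longleftrightarrow> open D \<and> \<phi> holomorphic_on D \<and> bij_betw \<phi> D E"

text \<open>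
  \<open>\<eta>\<close> is the trace of a complete unit-speed geodesic line of the hyperbolic metric of the
  (necessarily simply connected) domain \<open>D\<close> that runs from the boundary point \<open>a\<close> to the boundary
  point \<open>b\<close>. The hyperbolic distance of \<open>D\<close> is the pull-back of \<^const>\<open>uhp_dist\<close> under a conformal
  map onto the upper half-plane; it does not depend on the choice of that map.
\<close>

definition hyperbolic_geodesic ::
    "complex set \<Rightarrow> complex \<Rightarrow> complex \<Rightarrow> complex set \<Rightarrow> bool" where
  "hyperbolic_geodesic D a b \<eta> \<longleftrightarrow>
     a \<in> frontier D \<and> b \<in> frontier D \<and>
     (\<exists>\<phi>. conformal_onto \<phi> D upper_half_plane \<and>
       (\<exists>\<gamma> :: real \<Rightarrow> complex.
          range \<gamma> \<subseteq> D \<and>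
          (\<forall>s t. uhp_dist (\<phi> (\<gamma> s)) (\<phi> (\<gamma> t)) = \<bar>s - t\<bar>) \<and>
          (\<gamma> \<longlongrightarrow> a) at_bot \<and> (\<gamma> \<longlongrightarrow> b) at_top \<and>
          \<eta> = range \<gamma>))"


section \<open>Multichords\<close>

definition noncrossing_link_pattern :: "real set \<Rightarrow> real set set \<Rightarrow> bool" where
  "noncrossing_link_pattern X \<alpha> \<longleftrightarrow>
     partition_on X \<alpha> \<and> (\<forall>P\<in>\<alpha>. card P = 2) \<and>
     \<not> (\<exists>a b c d. {a, b} \<in> \<alpha> \<and> {c, d} \<in> \<alpha> \<and> a < c \<and> c < b \<and> b < d)"

text \<open>The curve in the open half-plane, that is, the path without its two endpoints.\<close>

definition chord :: "(real \<Rightarrow> complex) \<Rightarrow> complex set" where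
  "chord \<gamma> = \<gamma> ` {0<..<1}"

definition multichord :: "nat \<Rightarrow> real set set \<Rightarrow> (nat \<Rightarrow> real \<Rightarrow> complex) \<Rightarrow> bool" where
  "multichord n \<alpha> \<gamma> \<longleftrightarrow>
     (\<forall>j\<in>{1..n}. arc (\<gamma> j) \<and> chord (\<gamma> j) \<subseteq> upper_half_plane) \<and>
     disjoint_family_on (\<lambda>j. chord (\<gamma> j)) {1..n} \<and>
     bij_betw (\<lambda>j. {pathstart (\<gamma> j), pathfinish (\<gamma> j)}) {1..n} ((\<lambda>P. of_real ` P) ` \<alpha>)"

definition geodesic_multichord :: "nat \<Rightarrow> (nat \<Rightarrow> real \<Rightarrow> complex) \<Rightarrow> bool" where
  "geodesic_multichord n \<gamma> \<longleftrightarrow>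
     (\<forall>j\<in>{1..n}.
        \<exists>D\<in>components (upper_half_plane - (\<Union>k\<in>{1..n} - {j}. chord (\<gamma> k))).
          chord (\<gamma> j) \<subseteq> D \<and>
          hyperbolic_geodesic D (pathstart (\<gamma> j)) (pathfinish (\<gamma> j)) (chord (\<gamma> j)))"

text \<open>
  The curves in the decomposition are determined by \<open>\<Gamma>\<close>: the chords are disjoint, connected and
  relatively closed in the half-plane, so they are the connected components of the part of \<open>\<Gamma>\<close> in
  the half-plane. Hence the existential quantifier over \<open>\<gamma>\<close> leaves only the numbering and the
  parametrization of the curves open.
\<close>

definition geodesic_multichord_property :: "nat \<Rightarrow> real set \<Rightarrow> riemann_sphere set \<Rightarrow> bool" where
  "geodesic_multichord_property n X \<Gamma> \<longleftrightarrow>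
     (\<exists>\<alpha> \<gamma>. noncrossing_link_pattern X \<alpha> \<and> multichord n \<alpha> \<gamma> \<and>
        \<Gamma> = extended_reals \<union> Some ` (\<Union>j\<in>{1..n}. chord (\<gamma> j) \<union> cnj ` chord (\<gamma> j)) \<and>
        geodesic_multichord n \<gamma>)"

end

theory Submission
  imports Defs
    "HOL-Computational_Algebra.Field_as_Ring"
    "HOL-Computational_Algebra.Polynomial_Factorial"
    "HOL-Real_Asymp.Real_Asymp"
begin

text \<open>
  Let \<open>R = p / q\<close>. The Wronskian \<open>p' q - p q'\<close> has degree at most \<open>2 n\<close>, so the \<open>2 n\<close> real critical
  points are all of its roots, and they are simple; in particular \<open>R\<close> has no critical point off the
  real line or at infinity. Hence \<open>R\<close> restricts to a covering over each of the two half-planes of the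
  target, and the inverse branches map the closed half-planes homeomorphically onto the closed faces
  of \<open>\<Gamma>(R)\<close>. An edge \<open>\<eta>\<close> in the upper half-plane lies on exactly two faces, one over each
  half-plane, and \<open>R\<close> maps \<open>\<eta>\<close> onto an open arc \<open>I\<close> of the extended real line with two different end
  points. So the union \<open>D\<close> of \<open>\<eta>\<close> and the two faces is mapped conformally onto the sphere slit along
  the complement of \<open>I\<close>. After a Moebius map that takes \<open>I\<close> to the positive reals, \<open>\<i>\<close> times the
  square root maps \<open>D\<close> onto the upper half-plane and \<open>\<eta>\<close> onto the imaginary axis, so that \<open>\<eta>\<close> is a
  hyperbolic geodesic of \<open>D\<close>. For compactness, both half-planes are replaced by discs: with
  \<open>P = p - \<i> q\<close> and \<open>Q = p + \<i> q\<close>, the real locus is \<open>\<bar>P\<bar> = \<bar>Q\<bar>\<close> and the faces are the components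
  of \<open>\<bar>P\<bar> < \<bar>Q\<bar>\<close> and of \<open>\<bar>P\<bar> > \<bar>Q\<bar>\<close>.
\<close>

section \<open>Local homeomorphisms and coverings\<close>

text \<open>Two obstacles shape the construction. The covering argument stops at the boundary of a
  face, because the critical points lie there; injectivity up to the boundary comes from the
  finiteness of fibres instead. And an edge might return to the point of \<open>X\<close> from which
  it started: its image would then be a circle without one point, and the slit would shrink to that
  point. This is excluded because a simple critical point emits exactly one branch of the locus into
  the half-plane. The same single branch yields the number \<open>n\<close> of edges, since it pairs
  off the \<open>2 * n\<close> points. Faces may be unbounded although infinity is not critical, so
  the source is moved into a disc by \<open>1 / (z + \<i>)\<close>, which turns infinity into the
  ordinary boundary point \<open>0\<close>. On the target side, values are handled as homogeneous
  pairs, so that poles and zeros have equal standing and each statement about the faces over one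
  half-plane yields the one about the other by exchanging \<open>P\<close> and
  \<open>Q\<close>.\<close>

text \<open>The image of \<open>K - N\<close> is compact and misses \<open>w\<close>, hence it
  misses a ball around \<open>w\<close>. In this form compactness says that fibres over points near
  \<open>w\<close> stay near the fibre over \<open>w\<close>.\<close>

lemma compact_fibre_neighbourhood:
  fixes f :: "'a::t2_space \<Rightarrow> 'b::metric_space"
  assumes K: "compact K" "continuous_on K f" and N: "open N" "K \<inter> f -` {w} \<subseteq> N"
  obtains \<delta> where "\<delta> > 0" "K \<inter> f -` ball w \<delta> \<subseteq> N"
proof -
  have "compact (f ` (K - N))"
    using K N(1) compact_diff compact_continuous_image continuous_on_subset
    by (metis Diff_subset)
  then have "open (- f ` (K - N))"
    using compact_imp_closed by blast
  moreover have "w \<in> - f ` (K - N)"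
    using N(2) by auto
  ultimately obtain \<delta> where "\<delta> > 0" "ball w \<delta> \<subseteq> - f ` (K - N)"
    using open_contains_ball by blast
  then show ?thesis
    by (intro that[of \<delta>]) auto
qed

lemma holomorphic_local_homeomorphism:
  assumes "f holomorphic_on S" "open S" "z \<in> S" "deriv f z \<noteq> 0" "open U" "z \<in> U"
  obtains N g e where "open N" "z \<in> N" "N \<subseteq> S \<inter> U" "e > 0" "homeomorphism N (ball (f z) e) f g"
proof -
  have "f holomorphic_on (S \<inter> U)" "open (S \<inter> U)" "z \<in> S \<inter> U"
    using assms by (auto intro: holomorphic_on_subset)
  then obtain r where r: "r > 0" "ball z r \<subseteq> S \<inter> U" "open (f ` ball z r)" "inj_on f (ball z r)"
    using has_complex_derivative_locally_invertible[of f "S \<inter> U" z] assms(4) by metis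
  have cont: "continuous_on (ball z r) f"
    using \<open>f holomorphic_on (S \<inter> U)\<close> holomorphic_on_imp_continuous_on holomorphic_on_subset r(2) by blast
  obtain g where g: "homeomorphism (ball z r) (f ` ball z r) f g"
    using invariance_of_domain_homeomorphism[OF _ cont _ r(4)] by auto
  obtain e where e: "e > 0" "ball (f z) e \<subseteq> f ` ball z r"
    using r(1,3) by (metis centre_in_ball imageI open_contains_ball)
  define N where "N = ball z r \<inter> f -` ball (f z) e"
  have "open N"
    unfolding N_def using cont continuous_open_preimage open_ball by blast
  moreover have "homeomorphism N (ball (f z) e) f g"
    by (rule homeomorphism_of_subsets[OF g]) (use e in \<open>auto simp: N_def\<close>)
  ultimately show ?thesis
    using that[of N e g] r e by (auto simp: N_def)
qed

text \<open>The image is open by local invertibility and relatively closed by properness, so it is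
  all of the connected set \<open>T\<close>. A fibre is compact and discrete, hence finite. Disjoint
  local inverses at its points are cut down to a common ball around \<open>w\<close>, and properness
  ensures that they exhaust the preimage of a small enough ball.\<close>

lemma proper_local_homeomorphism_covering_space:
  fixes f :: "complex \<Rightarrow> complex"
  assumes A: "open A" "A \<noteq> {}" and holf: "f holomorphic_on A"
    and deriv: "\<And>z. z \<in> A \<Longrightarrow> deriv f z \<noteq> 0"
    and T: "open T" "connected T" "f ` A \<subseteq> T"
    and proper: "\<And>K. compact K \<Longrightarrow> K \<subseteq> T \<Longrightarrow> compact (A \<inter> f -` K)"
  shows "covering_space A f T"
proof
  have cont: "continuous_on A f"
    using holf holomorphic_on_imp_continuous_on by blast
  show "continuous_on A f" by fact
  have tube: "\<exists>\<delta>>0. ball w \<delta> \<subseteq> T \<and> A \<inter> f -` ball w \<delta> \<subseteq> N"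
    if w: "w \<in> T" and N: "open N" "A \<inter> f -` {w} \<subseteq> N" for w N
  proof -
    obtain r where r: "r > 0" "cball w r \<subseteq> T"
      using T(1) w open_contains_cball by blast
    let ?K = "A \<inter> f -` cball w r"
    have "compact ?K" "continuous_on ?K f"
      using proper[OF compact_cball r(2)] cont by (auto intro: continuous_on_subset)
    then obtain \<delta> where \<delta>: "\<delta> > 0" "?K \<inter> f -` ball w \<delta> \<subseteq> N"
      using compact_fibre_neighbourhood[of ?K f N w] N by blast
    show ?thesis
      by (rule exI[of _ "min \<delta> r"]) (use \<delta> r in auto)
  qed
  show surj: "f ` A = T"
  proof -
    have "open (f ` A)"
    proof (subst open_subopen, clarify)
      fix z assume "z \<in> A"
      then obtain N g e where "z \<in> N" "N \<subseteq> A" "e > 0" "homeomorphism N (ball (f z) e) f g"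
        using holomorphic_local_homeomorphism[OF holf A(1) _ deriv A(1)] by (metis Int_absorb)
      then have "ball (f z) e \<subseteq> f ` A"
        unfolding homeomorphism_def by blast
      then show "\<exists>T. open T \<and> f z \<in> T \<and> T \<subseteq> f ` A"
        using \<open>e > 0\<close> by (intro exI[of _ "ball (f z) e"]) auto
    qed
    moreover have "open (T - f ` A)"
    proof (subst open_subopen, clarify)
      fix w assume "w \<in> T" "w \<notin> f ` A"
      then obtain \<delta> where "\<delta> > 0" "ball w \<delta> \<subseteq> T" "A \<inter> f -` ball w \<delta> \<subseteq> {}"
        using tube[of w "{}"] by auto
      then show "\<exists>U. open U \<and> w \<in> U \<and> U \<subseteq> T - f ` A"
        by (intro exI[of _ "ball w \<delta>"]) auto
    qed
    ultimately show ?thesis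
      using T(2,3) A(2) unfolding connected_def by blast
  qed
  fix w assume w: "w \<in> T"
  define F where "F = A \<inter> f -` {w}"
  have "finite F"
  proof (rule ccontr)
    assume "infinite F"
    moreover have "compact F"
      using proper[of "{w}"] w by (auto simp: F_def)
    ultimately obtain z where z: "z \<in> F" "z islimpt F"
      using compact_eq_Bolzano_Weierstrass by blast
    then obtain N g e where N: "open N" "z \<in> N" "homeomorphism N (ball (f z) e) f g"
      using holomorphic_local_homeomorphism[OF holf A(1) _ deriv A(1)] by (metis IntD1 F_def)
    obtain z' where "z' \<in> F" "z' \<in> N" "z' \<noteq> z"
      using z(2) N(1,2) unfolding islimpt_def by blast
    then show False
      using N(2,3) z(1) unfolding homeomorphism_def by (metis IntD2 vimage_singleton_eq F_def)
  qed
  \<comment> \<open>The least distance between two points of the fibre, so that balls of radius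
    \<open>d/2\<close> around them are disjoint. The inserted 1 keeps the set nonempty if the fibre
    is a single point.\<close>
  define d where "d = Min (insert 1 ((\<lambda>(x, y). dist x y) ` (F \<times> F - Id)))"
  have fin: "finite (insert 1 ((\<lambda>(x, y). dist x y) ` (F \<times> F - Id)))"
    using \<open>finite F\<close> by blast
  have d: "d > 0"
    unfolding d_def using Min_in[OF fin] by fastforce
  have dist: "d \<le> dist x y" if "x \<in> F" "y \<in> F" "x \<noteq> y" for x y
    unfolding d_def by (rule Min_le[OF fin], rule insertI2, rule image_eqI[of _ _ "(x, y)"]) (use that in auto)
  have "\<exists>N g e. open N \<and> z \<in> N \<and> N \<subseteq> A \<inter> ball z (d/2) \<and> e > 0 \<and> homeomorphism N (ball w e) f g"
    if "z \<in> F" for z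
  proof -
    have z: "z \<in> A" "f z = w" "z \<in> ball z (d/2)" using that d unfolding F_def by simp_all
    obtain N g e where "open N" "z \<in> N" "N \<subseteq> A \<inter> ball z (d/2)" "e > 0" "homeomorphism N (ball (f z) e) f g"
      by (rule holomorphic_local_homeomorphism[OF holf A(1) z(1) deriv[OF z(1)] open_ball z(3)])
    then show ?thesis using z(2) by blast
  qed
  then obtain N g e where N: "\<And>z. z \<in> F \<Longrightarrow> open (N z) \<and> z \<in> N z \<and> N z \<subseteq> A \<inter> ball z (d/2) \<and> e z > (0::real)
      \<and> homeomorphism (N z) (ball w (e z)) f (g z)"
    by metis
  have disj: "N x \<inter> N y = {}" if "x \<in> F" "y \<in> F" "x \<noteq> y" for x y
  proof -
    have "ball x (d/2) \<inter> ball y (d/2) = {}"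
      using dist[OF that] by (intro disjoint_ballI) auto
    then show ?thesis using N[OF that(1)] N[OF that(2)] by blast
  qed
  obtain \<delta>0 where \<delta>0: "\<delta>0 > 0" "ball w \<delta>0 \<subseteq> T" "A \<inter> f -` ball w \<delta>0 \<subseteq> (\<Union>z\<in>F. N z)"
    using tube[OF w, of "\<Union>z\<in>F. N z"] N unfolding F_def by blast
  define \<delta> where "\<delta> = Min (insert \<delta>0 (e ` F))"
  have \<delta>: "\<delta> > 0" "\<delta> \<le> \<delta>0" "\<And>z. z \<in> F \<Longrightarrow> \<delta> \<le> e z"
    unfolding \<delta>_def using \<open>finite F\<close> \<delta>0(1) N by (auto simp: Min_gr_iff)
  let ?T = "ball w \<delta>"
  let ?v = "(\<lambda>z. N z \<inter> f -` ?T) ` F"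
  have op: "open (N z \<inter> f -` ?T)" if "z \<in> F" for z
    using N[OF that] cont continuous_on_subset continuous_open_preimage by (metis le_inf_iff open_ball)
  have hom: "homeomorphism (N z \<inter> f -` ?T) ?T f (g z)" if "z \<in> F" for z
  proof -
    have h: "homeomorphism (N z) (ball w (e z)) f (g z)" using N[OF that] by blast
    have "?T \<subseteq> ball w (e z)" using \<delta>(3)[OF that] by auto
    have "f ` (N z \<inter> f -` ?T) = f ` N z \<inter> ?T"
      by auto
    also have "\<dots> = ?T"
      using homeomorphism_image1[OF h] \<open>?T \<subseteq> ball w (e z)\<close> by (simp only: Int_absorb1)
    finally have "f ` (N z \<inter> f -` ?T) = ?T" .
    then show ?thesis
      by (intro homeomorphism_of_subsets[OF h]) (use \<open>?T \<subseteq> ball w (e z)\<close> in auto)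
  qed
  have "\<Union> ?v = A \<inter> f -` ?T"
  proof -
    have "A \<inter> f -` ?T \<subseteq> (\<Union>z\<in>F. N z)"
      using \<delta>0(3) \<delta>(2) by fastforce
    moreover have "(\<Union>z\<in>F. N z) \<subseteq> A"
      using N by (meson UN_least le_inf_iff)
    ultimately show ?thesis by blast
  qed
  moreover have "\<forall>u\<in>?v. openin (top_of_set A) u"
  proof
    fix u assume "u \<in> ?v"
    then obtain z where z: "z \<in> F" "u = N z \<inter> f -` ?T" by blast
    have "N z \<subseteq> A" using N[OF z(1)] by simp
    then show "openin (top_of_set A) u"
      using op[OF z(1)] z(2) A(1) by (auto simp: openin_open_eq)
  qed
  moreover have "pairwise disjnt ?v"
    unfolding pairwise_def disjnt_def using disj by blast
  ultimately show "\<exists>T'. w \<in> T' \<and> openin (top_of_set T) T' \<and>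
          (\<exists>v. \<Union> v = A \<inter> f -` T' \<and> (\<forall>u\<in>v. openin (top_of_set A) u) \<and>
            pairwise disjnt v \<and> (\<forall>u\<in>v. \<exists>q. homeomorphism u T' f q))"
    using \<delta>(1)
  proof (intro exI[of _ ?T] conjI exI[of _ ?v])
    show "openin (top_of_set T) ?T"
      using \<delta>(2) \<delta>0(2) T(1) by (auto simp: openin_open_eq)
    show "\<forall>u\<in>?v. \<exists>q. homeomorphism u ?T f q"
      using hom by blast
  qed auto
qed

section \<open>Closed faces of a unimodular quotient\<close>

text \<open>A pair \<open>P\<close>, \<open>Q\<close> without common zeros stands for a map to the
  sphere that sends the frontier of \<Omega> to the unit circle. The Wronskian condition says
  projectively, hence also at poles, that this map has no critical point in \<Omega>. Exchanging
  \<open>P\<close> and \<open>Q\<close> inverts the quotient and thus exchanges the two sides of the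
  circle.\<close>

locale unimodular_quotient =
  fixes \<Omega> :: "complex set" and P Q :: "complex \<Rightarrow> complex"
  assumes open_\<Omega>: "open \<Omega>" and bounded_\<Omega>: "bounded \<Omega>"
    and holP: "P holomorphic_on UNIV" and holQ: "Q holomorphic_on UNIV"
    and no_common_zero: "z \<in> closure \<Omega> \<Longrightarrow> P z \<noteq> 0 \<or> Q z \<noteq> 0"
    and frontier_norm_eq: "z \<in> frontier \<Omega> \<Longrightarrow> cmod (P z) = cmod (Q z)"
    and wronskian: "z \<in> \<Omega> \<Longrightarrow> deriv P z * Q z - P z * deriv Q z \<noteq> 0"
begin

lemma swap: "unimodular_quotient \<Omega> Q P"
proof
  show "deriv Q z * P z - Q z * deriv P z \<noteq> 0" if "z \<in> \<Omega>" for z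
    using wronskian[OF that] by (auto simp: algebra_simps)
  show "Q z \<noteq> 0 \<or> P z \<noteq> 0" if "z \<in> closure \<Omega>" for z
    using no_common_zero[OF that] by blast
  show "cmod (Q z) = cmod (P z)" if "z \<in> frontier \<Omega>" for z
    using frontier_norm_eq[OF that] by simp
qed (fact open_\<Omega> bounded_\<Omega> holP holQ)+

text \<open>Frontier points of \<Omega> are included to make this set compact; \<open>Q\<close> has
  no zero on it, so the quotient is an honest continuous function there.\<close>

definition half :: "complex set" where
  "half = {z \<in> closure \<Omega>. cmod (P z) \<le> cmod (Q z)}"

abbreviation quot :: "complex \<Rightarrow> complex" where
  "quot z \<equiv> P z / Q z"

lemma contP: "continuous_on S P" and contQ: "continuous_on S Q"
  using holP holQ holomorphic_on_imp_continuous_on continuous_on_subset by blast+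

lemma Q_nonzero: "z \<in> half \<Longrightarrow> Q z \<noteq> 0"
  using no_common_zero by (auto simp: half_def)

lemma compact_half: "compact half"
proof -
  have "closed half"
    unfolding half_def
    by (intro closed_Collect_conj closed_Collect_le continuous_intros contP contQ) auto
  then show ?thesis
    using bounded_\<Omega> bounded_closure by (auto simp: compact_eq_bounded_closed half_def intro: bounded_subset)
qed

lemma quot_le_1: "z \<in> half \<Longrightarrow> cmod (quot z) \<le> 1"
  using Q_nonzero[of z] by (auto simp: half_def norm_divide)

text \<open>Frontier points lie over the unit circle, so the open disc is reached only from inside
  \<Omega>. This is what makes the quotient proper over the open disc.\<close>

lemma quot_less_1_in: "z \<in> half \<Longrightarrow> cmod (quot z) < 1 \<Longrightarrow> z \<in> \<Omega>"
  using frontier_norm_eq[of z] open_\<Omega> Q_nonzero[of z]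
  by (auto simp: half_def frontier_def interior_open norm_divide)

lemma open_Q_nonzero: "open {z. Q z \<noteq> 0}"
  by (intro open_Collect_neq contQ continuous_intros)

lemma hol_quot: "quot holomorphic_on {z. Q z \<noteq> 0}"
  using holP holQ by (intro holomorphic_intros) (auto intro: holomorphic_on_subset)

lemma cont_quot: "S \<subseteq> {z. Q z \<noteq> 0} \<Longrightarrow> continuous_on S quot"
  using hol_quot holomorphic_on_imp_continuous_on continuous_on_subset by blast

lemma deriv_quot:
  assumes "z \<in> \<Omega>" "Q z \<noteq> 0"
  shows "deriv quot z \<noteq> 0"
proof -
  have "deriv quot z = (deriv P z * Q z - P z * deriv Q z) / (Q z)\<^sup>2"
    using assms holP holQ by (intro deriv_divide) (auto simp: holomorphic_on_def field_differentiable_def)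
  then show ?thesis using wronskian[OF assms(1)] assms(2) by simp
qed

lemma local_homeomorphism:
  assumes "z \<in> \<Omega>" "Q z \<noteq> 0"
  obtains N e g where "open N" "z \<in> N" "N \<subseteq> \<Omega>" "\<forall>x\<in>N. Q x \<noteq> 0" "e > 0"
    "homeomorphism N (ball (quot z) e) quot g"
proof -
  have "z \<in> {z. Q z \<noteq> 0}" using assms(2) by simp
  then obtain N e g where N: "open N" "z \<in> N" "N \<subseteq> {z. Q z \<noteq> 0} \<inter> \<Omega>" "e > 0"
      "homeomorphism N (ball (quot z) e) quot g"
    using holomorphic_local_homeomorphism[OF hol_quot open_Q_nonzero _ deriv_quot[OF assms] open_\<Omega> assms(1)]
    by metis
  then have "\<forall>x\<in>N. Q x \<noteq> 0" "N \<subseteq> \<Omega>" by auto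
  with N show ?thesis using that by simp
qed

text \<open>Over the open unit disc, which is simply connected, the covering has a global section
  \<open>g\<close>; the face \<open>M\<close> is the closure of its image. The quotient maps
  \<open>M\<close> onto the closed disc and is injective even over the circle, so compactness makes
  it a homeomorphism. Relative openness in \<open>half \<inter> \<Omega>\<close> will later confine
  connected pieces of the locus to a single face.\<close>

lemma closed_face:
  assumes "z0 \<in> \<Omega>" "z0 \<in> half"
  obtains M g where "z0 \<in> M" "compact M" "M \<subseteq> half" "homeomorphism M (cball 0 1) quot g"
    "openin (top_of_set (half \<inter> \<Omega>)) (M \<inter> \<Omega>)"
proof -
  define w0 where "w0 = quot z0"
  obtain N0 e0 l0 where l0: "open N0" "z0 \<in> N0" "N0 \<subseteq> \<Omega>" "\<forall>x\<in>N0. Q x \<noteq> 0" "e0 > 0"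
    "homeomorphism N0 (ball (quot z0) e0) quot l0"
    by (rule local_homeomorphism[OF assms(1) Q_nonzero[OF assms(2)]])
  note l0 = l0[folded w0_def]
  have "w0 \<in> closure (ball 0 1)"
    using quot_le_1[OF assms(2)] by (simp add: w0_def)
  have meets: "\<exists>u\<in>ball 0 1. u \<in> V" if "open V" "w0 \<in> V" for V
    using \<open>w0 \<in> closure (ball 0 1)\<close> that closure_iff_nhds_not_empty[of w0 "ball 0 1"] by blast
  \<comment> \<open>The point \<open>z0\<close> may lie over the unit circle, outside
    \<open>A\<close>. The lift therefore starts from a nearby point \<open>z1\<close> over a value
    \<open>w1\<close> in the open disc.\<close>
  obtain w1 where w1: "w1 \<in> ball 0 1" "w1 \<in> ball w0 e0"
    using meets[of "ball w0 e0"] l0(5) by auto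
  define z1 where "z1 = l0 w1"
  define A where "A = {z \<in> \<Omega>. cmod (P z) < cmod (Q z)}"
  have A_half: "A \<subseteq> half" and A_Q: "A \<subseteq> {z. Q z \<noteq> 0}"
    using closure_subset by (auto simp: A_def half_def)
  have A_I: "z \<in> A" if "z \<in> \<Omega>" "Q z \<noteq> 0" "cmod (quot z) < 1" for z
    using that by (auto simp: A_def norm_divide)
  have A_iff: "z \<in> A" if "z \<in> half" "cmod (quot z) < 1" for z
    using A_I quot_less_1_in[OF that] that Q_nonzero[OF that(1)] by blast
  have quot_A: "cmod (quot z) < 1" if "z \<in> A" for z
    using that A_Q by (auto simp: A_def norm_divide)
  have l0A: "l0 u \<in> A" "quot (l0 u) = u" if "u \<in> ball w0 e0" "u \<in> ball 0 1" for u
  proof -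
    have "l0 u \<in> N0" and q: "quot (l0 u) = u"
      using l0(6) that(1) unfolding homeomorphism_def by blast+
    then show "quot (l0 u) = u" by simp
    show "l0 u \<in> A"
      using l0(3,4) that(2) \<open>l0 u \<in> N0\<close> by (intro A_I) (auto simp: q)
  qed
  have "z1 \<in> A" "quot z1 = w1"
    using l0A w1 by (auto simp: z1_def)
  have "open A"
    unfolding A_def using open_\<Omega>
    by (intro open_Collect_conj open_Collect_less continuous_intros contP contQ) auto
  have hol: "quot holomorphic_on A"
    using hol_quot A_Q holomorphic_on_subset by blast
  have cov: "covering_space A quot (ball 0 1)"
  proof (rule proper_local_homeomorphism_covering_space)
    show "deriv quot z \<noteq> 0" if "z \<in> A" for z
      using deriv_quot that A_Q by (auto simp: A_def)
    show "compact (A \<inter> quot -` K)" if "compact K" "K \<subseteq> ball 0 1" for K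
    proof -
      have "A \<inter> quot -` K = half \<inter> quot -` K"
        using A_half A_iff that(2) by fastforce
      moreover have "closedin (top_of_set half) (half \<inter> quot -` K)"
        using Q_nonzero by (intro continuous_closedin_preimage cont_quot compact_imp_closed[OF that(1)]) auto
      ultimately show ?thesis
        using closedin_compact[OF compact_half] by simp
    qed
  qed (use \<open>open A\<close> \<open>z1 \<in> A\<close> hol quot_A in auto)
  obtain g where g: "continuous_on (ball 0 1) g" "g \<in> ball 0 1 \<rightarrow> A" "g w1 = z1"
      "\<And>y. y \<in> ball 0 1 \<Longrightarrow> quot (g y) = y"
    using covering_space_lift_strong[OF cov \<open>z1 \<in> A\<close> w1(1), of "\<lambda>x. x"] \<open>quot z1 = w1\<close>
      convex_imp_simply_connected[of "ball 0 1"] convex_imp_locally_path_connected[of "ball 0 1"]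
    by (metis Pi_I continuous_on_id convex_ball)
  define M where "M = closure (g ` ball 0 1)"
  have gM: "g u \<in> M" if "u \<in> ball 0 1" for u
    unfolding M_def using that closure_subset[of "g ` ball 0 1"] by auto
  have "closed half" using compact_half compact_imp_closed by blast
  then have M_half: "M \<subseteq> half"
    unfolding M_def using g(2) A_half by (intro closure_minimal) auto
  then have "compact M"
    using compact_half unfolding M_def
    by (metis bounded_subset closed_closure compact_eq_bounded_closed)
  have contM: "continuous_on M quot"
    using M_half Q_nonzero by (intro cont_quot) auto
  have quot_M: "quot ` M = cball 0 1"
  proof
    show "quot ` M \<subseteq> cball 0 1"
      using quot_le_1 M_half by auto
    have "ball 0 1 \<subseteq> quot ` M"
    proof
      fix u :: complex assume u: "u \<in> ball 0 1"
      then show "u \<in> quot ` M"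
        using gM[OF u] g(4)[OF u] by (intro image_eqI[of _ _ "g u"]) simp_all
    qed
    moreover have "closed (quot ` M)"
      using compact_continuous_image[OF contM \<open>compact M\<close>] compact_imp_closed by blast
    ultimately have "closure (ball 0 1) \<subseteq> quot ` M"
      by (rule closure_minimal)
    then show "cball 0 1 \<subseteq> quot ` M" by simp
  qed
  have near: "\<exists>u\<in>ball 0 1. g u \<in> V \<and> u \<in> ball (quot z) \<delta>"
    if "z \<in> M" "open V" "z \<in> V" "\<delta> > 0" for z V \<delta>
  proof -
    have "open ({z. Q z \<noteq> 0} \<inter> quot -` ball (quot z) \<delta>)"
      by (intro continuous_open_preimage cont_quot open_Q_nonzero) auto
    then have "open (V \<inter> ({z. Q z \<noteq> 0} \<inter> quot -` ball (quot z) \<delta>))"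
      using that by blast
    moreover have "z \<in> V \<inter> ({z. Q z \<noteq> 0} \<inter> quot -` ball (quot z) \<delta>)"
      using that M_half Q_nonzero by auto
    moreover have "z \<in> closure (g ` ball 0 1)" using that M_def by simp
    ultimately have "g ` ball 0 1 \<inter> (V \<inter> ({z. Q z \<noteq> 0} \<inter> quot -` ball (quot z) \<delta>)) \<noteq> {}"
      using closure_iff_nhds_not_empty[of z "g ` ball 0 1"] by (metis subset_refl)
    then obtain u where "u \<in> ball 0 1" "g u \<in> V" "quot (g u) \<in> ball (quot z) \<delta>"
      by blast
    then show ?thesis using g(4) by auto
  qed
  have "inj_on quot M"
  proof (rule inj_onI, rule ccontr)
    fix z z' assume z: "z \<in> M" "z' \<in> M" "quot z = quot z'" "z \<noteq> z'"
    define w where "w = quot z"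
    \<comment> \<open>The fibre over \<open>w\<close> consists of zeros of the entire function
      \<open>P - w Q\<close>, so it is finite on the compact set \<open>half\<close> unless that
      function is constant. A constant would be zero because of \<open>z\<close>, and then the
      Wronskian would vanish at \<open>z0\<close>.\<close>
    have nc: "\<not> (\<lambda>x. P x - w * Q x) constant_on UNIV"
    proof
      assume "(\<lambda>x. P x - w * Q x) constant_on UNIV"
      then obtain c where c: "\<And>x. P x - w * Q x = c" by (auto simp: constant_on_def)
      have "P z - w * Q z = 0"
        using z(1) M_half Q_nonzero by (auto simp: w_def)
      then have P: "P = (\<lambda>x. w * Q x)" using c by (auto simp: fun_eq_iff)
      have "deriv P z0 = w * deriv Q z0"
        using holQ by (subst P, intro deriv_cmult) (auto simp: holomorphic_on_def)
      then show False
        using wronskian[OF assms(1)] P by (simp add: fun_eq_iff)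
    qed
    have fin: "finite {x \<in> half. P x - w * Q x = 0}"
      by (rule holomorphic_compact_finite_zeros[OF _ open_UNIV connected_UNIV compact_half subset_UNIV nc])
         (intro holomorphic_intros holP holQ)
    have fibre: "half \<inter> quot -` {w} \<subseteq> {x \<in> half. P x - w * Q x = 0}"
      using Q_nonzero by (auto simp: field_simps)
    obtain d where d: "d > 0" "\<And>x. x \<in> {x \<in> half. P x - w * Q x = 0} \<Longrightarrow> x \<noteq> z \<Longrightarrow> d \<le> dist z x"
      using finite_set_avoid[OF fin, of z] by blast
    \<comment> \<open>The sphere of radius \<open>d/2\<close> around \<open>z\<close> contains no
      point of the fibre. Hence \<open>g\<close> avoids it over a neighbourhood of \<open>w\<close>,
      where the domain of \<open>g\<close> is convex and its image connected. Both \<open>z\<close>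
      and \<open>z'\<close> are limits of that image, but they lie on different sides of the
      sphere.\<close>
    let ?U = "ball z (d/2)" and ?V = "- cball z (d/2)"
    have "half \<inter> quot -` {w} \<subseteq> ?U \<union> ?V"
    proof
      fix x assume "x \<in> half \<inter> quot -` {w}"
      then have "x = z \<or> d \<le> dist z x" using fibre d(2) by blast
      then show "x \<in> ?U \<union> ?V" using d(1) by auto
    qed
    then obtain \<delta> where \<delta>: "\<delta> > 0" "half \<inter> quot -` ball w \<delta> \<subseteq> ?U \<union> ?V"
      using compact_fibre_neighbourhood[OF compact_half cont_quot, of "?U \<union> ?V" w] Q_nonzero by blast
    let ?S = "g ` (ball 0 1 \<inter> ball w \<delta>)"
    have "connected ?S"
      using g(1) by (intro connected_continuous_image convex_connected convex_Int convex_ball)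
        (auto intro: continuous_on_subset)
    moreover have "?S \<subseteq> ?U \<union> ?V"
    proof
      fix x assume "x \<in> ?S"
      then obtain u where u: "u \<in> ball 0 1" "u \<in> ball w \<delta>" "x = g u" by blast
      then have "x \<in> half \<inter> quot -` ball w \<delta>"
        using gM[OF u(1)] M_half g(4)[OF u(1)] by auto
      then show "x \<in> ?U \<union> ?V" using \<delta>(2) by blast
    qed
    moreover have "?U \<inter> ?S \<noteq> {}"
    proof -
      have "z \<in> ?U" using d(1) by simp
      then show ?thesis
        using near[OF z(1) open_ball _ \<delta>(1)] unfolding w_def by blast
    qed
    moreover have "?V \<inter> ?S \<noteq> {}"
    proof -
      have "z' \<in> {x \<in> half. P x - w * Q x = 0}"
        using fibre z M_half by (auto simp: w_def)
      then have "d \<le> dist z z'" using d(2) z(4) by blast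
      then have "z' \<in> ?V" using d(1) by auto
      moreover have "open ?V" by (simp add: open_Compl)
      ultimately show ?thesis
        using near[OF z(2) _ _ \<delta>(1), of ?V] z(3) unfolding w_def by auto
    qed
    moreover have "?U \<inter> ?V \<inter> ?S = {}" by auto
    ultimately show False
      using connectedD[of ?S ?U ?V] by (metis (no_types, lifting) \<open>?U \<inter> ?V \<inter> ?S = {}\<close> open_Compl open_ball closed_cball)
  qed
  then obtain h where h: "homeomorphism M (cball 0 1) quot h"
    using homeomorphism_compact[OF \<open>compact M\<close> contM quot_M] by blast
  have "z0 \<in> M"
  proof (rule ccontr)
    assume "z0 \<notin> M"
    \<comment> \<open>The local inverse \<open>l0\<close> at \<open>z0\<close> and the global
      section \<open>g\<close> are lifts of the identity that agree at \<open>w1\<close>, hence on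
      the whole convex intersection. If \<open>z0\<close> were outside the closed set
      \<open>M\<close>, then \<open>l0\<close> would take values outside \<open>M\<close> on that
      intersection too.\<close>
    have eq: "l0 u = g u" if "u \<in> ball 0 1 \<inter> ball w0 e0" for u
    proof (rule covering_space_lift_unique[OF cov, of l0 w1 g "ball 0 1 \<inter> ball w0 e0" "\<lambda>x. x"])
      show "continuous_on (ball 0 1 \<inter> ball w0 e0) l0"
        using l0(6) unfolding homeomorphism_def by (auto intro: continuous_on_subset)
      show "continuous_on (ball 0 1 \<inter> ball w0 e0) g"
        using g(1) by (auto intro: continuous_on_subset)
      show "connected (ball 0 1 \<inter> ball w0 e0)"
        by (intro convex_connected convex_Int convex_ball)
      show "l0 w1 = g w1" by (simp add: g(3) z1_def)
    qed (use that w1 g(2,4) l0A in auto)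
    have "open (ball w0 e0 \<inter> l0 -` (- M))"
      using l0(6) \<open>compact M\<close> compact_imp_closed unfolding homeomorphism_def
      by (intro continuous_open_preimage) auto
    moreover have "l0 w0 = z0"
      using l0(2,6) unfolding homeomorphism_def w0_def by blast
    ultimately obtain u where "u \<in> ball 0 1" "u \<in> ball w0 e0" "l0 u \<notin> M"
      using meets[of "ball w0 e0 \<inter> l0 -` (- M)"] l0(5) \<open>z0 \<notin> M\<close> by auto
    then show False
      using eq[of u] gM[of u] by auto
  qed
  \<comment> \<open>A point \<open>x\<close> of \<open>half\<close> close to \<open>z\<close> has
    the same value as the point \<open>h (quot x)\<close> of \<open>M\<close>. Both lie in the
    neighbourhood \<open>N\<close>, on which the quotient is injective, so \<open>x\<close> belongs
    to \<open>M\<close>.\<close>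
  moreover have "openin (top_of_set (half \<inter> \<Omega>)) (M \<inter> \<Omega>)"
  proof (subst openin_subopen, clarify)
    fix z assume z: "z \<in> M" "z \<in> \<Omega>"
    obtain N e l where N: "open N" "z \<in> N" "N \<subseteq> \<Omega>" "\<forall>x\<in>N. Q x \<noteq> 0" "e > 0"
        "homeomorphism N (ball (quot z) e) quot l"
      by (rule local_homeomorphism[OF z(2) Q_nonzero[OF subsetD[OF M_half z(1)]]])
    have hz: "h (quot z) = z" and ch: "continuous_on (cball 0 1) h" and hM: "\<And>u. u \<in> cball 0 1 \<Longrightarrow> h u \<in> M"
      and qh: "\<And>u. u \<in> cball 0 1 \<Longrightarrow> quot (h u) = u"
      using h z(1) unfolding homeomorphism_def by blast+
    have "openin (top_of_set (cball 0 1)) (cball 0 1 \<inter> h -` N)"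
      using ch N(1) continuous_openin_preimage_gen by blast
    then obtain U where U: "open U" "cball 0 1 \<inter> h -` N = cball 0 1 \<inter> U"
      by (auto simp: openin_open)
    have "continuous_on N quot" using N(4) by (intro cont_quot) auto
    then have "open (N \<inter> quot -` U)"
      using N(1) U(1) continuous_open_preimage by blast
    moreover have "quot z \<in> U"
      using U(2) hz N(2) z(1) quot_M by blast
    moreover have "x \<in> M" if "x \<in> half" "x \<in> N" "quot x \<in> U" for x
    proof -
      have u: "quot x \<in> cball 0 1" using quot_le_1[OF that(1)] by simp
      then have "h (quot x) \<in> N" using U(2) that(3) by blast
      then have "h (quot x) = x"
        using N(6) that(2) qh[OF u] unfolding homeomorphism_def by metis
      then show ?thesis using hM[OF u] by simp
    qed
    ultimately show "\<exists>T. openin (top_of_set (half \<inter> \<Omega>)) T \<and> z \<in> T \<and> T \<subseteq> M \<inter> \<Omega>"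
      using N(2,3) z M_half
      by (intro exI[of _ "half \<inter> \<Omega> \<inter> (N \<inter> quot -` U)"] conjI openin_open_Int) auto
  qed
  ultimately show ?thesis
    using that[of M h] \<open>compact M\<close> M_half h by blast
qed

end

section \<open>Chords of the unimodular locus\<close>

lemma cis_eq_imp_eq:
  assumes "cis s = cis t" "\<bar>s - t\<bar> < 2 * pi"
  shows "s = t"
proof -
  have "cis (s - t) = 1"
    using assms(1) by (simp flip: cis_divide)
  then have "cos (s - t) = 1"
    by (metis cis.sel(1) one_complex.sel(1))
  then obtain n :: int where n: "s - t = n * (2 * pi)"
    using cos_one_2pi_int by (metis mult.assoc)
  then have "\<bar>real_of_int n\<bar> < 1"
    using assms(2) by (simp add: abs_mult)
  then have "n = 0" by linarith
  then show ?thesis using n by simp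
qed

text \<open>The Moebius map with zero \<open>e\<close> and pole \<open>e k^2\<close>, both on the
  unit circle, in homogeneous coordinates. The factor \<open>- k\<close>, where \<open>k\<close> is
  a square root of the ratio of pole and zero, makes it real on the circle; if
  \<open>Im k > 0\<close>, it takes the inside of the circle to the upper half-plane.\<close>

lemma Im_mobius:
  fixes P Q e k :: complex
  assumes "cmod e = 1" "cmod k = 1" "P \<noteq> e * k\<^sup>2 * Q"
  shows "Im (- k * (P - e * Q) / (P - e * k\<^sup>2 * Q))
    = Im k * ((cmod Q)\<^sup>2 - (cmod P)\<^sup>2) / (cmod (P - e * k\<^sup>2 * Q))\<^sup>2"
proof -
  define X where "X = k * cnj (e * k\<^sup>2) * P * cnj Q"
  have k: "k * cnj k = 1" and e: "e * cnj e = 1"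
    using assms by (simp_all add: complex_norm_square[symmetric])
  have N: "- k * (P - e * Q) * cnj (P - e * k\<^sup>2 * Q)
      = - k * (P * cnj P) - cnj k * (Q * cnj Q) + (X + cnj X)"
    unfolding X_def complex_cnj_mult complex_cnj_diff complex_cnj_power complex_cnj_cnj using k e by algebra
  have "Im (- k * (P - e * Q) * cnj (P - e * k\<^sup>2 * Q)) = Im k * ((cmod Q)\<^sup>2 - (cmod P)\<^sup>2)"
    unfolding N by (simp add: complex_norm_square[symmetric] right_diff_distrib flip: of_real_power)
  then show ?thesis
    by (simp only: complex_div_cnj[of "- k * (P - e * Q)"] Im_divide_of_real flip: of_real_power)
qed

text \<open>On the circle the map becomes a ratio of half-angle sines. Its sign tells the open arc
  from \<alpha> to \<beta>, where it is positive, from the complementary arc.\<close>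

lemma mobius_cis:
  assumes "w \<noteq> 0" "k = cis ((\<beta> - \<alpha>) / 2)" "sin ((\<beta> - s) / 2) \<noteq> 0"
  shows "- k * (w * cis s - w * cis \<alpha>) / (w * cis s - w * cis \<beta>) = of_real (sin ((s - \<alpha>) / 2) / sin ((\<beta> - s) / 2))"
proof -
  define x y a where "x = cis ((s - \<alpha>) / 2)" "y = cis ((\<beta> - s) / 2)" "a = cis \<alpha>"
  have nz: "x \<noteq> 0" "y \<noteq> 0" "a \<noteq> 0"
    by (auto simp: x_y_a_def)
  have k: "k = x * y" by (simp add: assms(2) x_y_a_def cis_mult algebra_simps add_divide_distrib diff_divide_distrib)
  have s: "cis s = a * x\<^sup>2" and b: "cis \<beta> = a * (x * y)\<^sup>2"
    unfolding x_y_a_def cis_mult Complex.DeMoivre power2_eq_square by (auto simp: field_simps)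
  have sinx: "of_real (sin ((s - \<alpha>) / 2)) = (x - 1 / x) / (2 * \<i>)"
   and siny: "of_real (sin ((\<beta> - s) / 2)) = (y - 1 / y) / (2 * \<i>)"
    unfolding x_y_a_def by (auto simp: complex_eq_iff cis_divide[symmetric] Re_divide Im_divide field_simps simp flip: cis_inverse)
  have y1: "y\<^sup>2 \<noteq> 1"
    using assms(3) siny nz by (auto simp: field_simps power2_eq_square)
  have "- k * (w * cis s - w * cis \<alpha>) / (w * cis s - w * cis \<beta>)
      = (- k * (cis s - a)) / (cis s - cis \<beta>)"
    using assms(1) by (simp add: x_y_a_def flip: right_diff_distrib)
  also have "\<dots> = ((x\<^sup>2 - 1) * y) / ((y\<^sup>2 - 1) * x)"
    using nz y1 unfolding k s b by (simp add: field_simps power2_eq_square)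
  also have "\<dots> = (x - 1 / x) / (y - 1 / y)"
    using nz y1 by (simp add: field_simps power2_eq_square)
  also have "\<dots> = of_real (sin ((s - \<alpha>) / 2)) / of_real (sin ((\<beta> - s) / 2))"
    unfolding sinx siny by simp
  finally show ?thesis by simp
qed

section \<open>The edge through a point and the domain formed by its two faces\<close>

context unimodular_quotient
begin

definition locus :: "complex set" where
  "locus = {z \<in> \<Omega>. cmod (P z) = cmod (Q z)}"

interpretation swap: unimodular_quotient \<Omega> Q P
  by (rule swap)

lemma locus_half: "locus = \<Omega> \<inter> half \<inter> swap.half"
  using closure_subset[of \<Omega>] by (auto simp: locus_def half_def swap.half_def)

lemma half_cases: "z \<in> \<Omega> \<Longrightarrow> z \<in> half \<or> z \<in> swap.half"
  using closure_subset[of \<Omega>] by (auto simp: half_def swap.half_def)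

lemma opposite_faces:
  assumes z0: "z0 \<in> locus"
  obtains M g M' g' V V' where
    "z0 \<in> M" "compact M" "M \<subseteq> half" "homeomorphism M (cball 0 1) quot g"
    "z0 \<in> M'" "compact M'" "M' \<subseteq> swap.half" "homeomorphism M' (cball 0 1) swap.quot g'"
    "open V" "M \<inter> \<Omega> = half \<inter> \<Omega> \<inter> V" "open V'" "M' \<inter> \<Omega> = swap.half \<inter> \<Omega> \<inter> V'"
proof -
  have z: "z0 \<in> \<Omega>" "z0 \<in> half" "z0 \<in> swap.half"
    using z0 locus_half by auto
  obtain M g where M: "z0 \<in> M" "compact M" "M \<subseteq> half" "homeomorphism M (cball 0 1) quot g"
      "openin (top_of_set (half \<inter> \<Omega>)) (M \<inter> \<Omega>)"
    using closed_face[OF z(1,2)] by metis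
  obtain M' g' where M': "z0 \<in> M'" "compact M'" "M' \<subseteq> swap.half" "homeomorphism M' (cball 0 1) swap.quot g'"
      "openin (top_of_set (swap.half \<inter> \<Omega>)) (M' \<inter> \<Omega>)"
    using swap.closed_face[OF z(1,3)] by metis
  obtain V V' where "open V" "M \<inter> \<Omega> = half \<inter> \<Omega> \<inter> V" "open V'" "M' \<inter> \<Omega> = swap.half \<inter> \<Omega> \<inter> V'"
    using M(5) M'(5) by (auto simp: openin_open)
  with M M' show ?thesis using that by simp
qed

text \<open>The set \<open>X\<close> contains the only frontier points at which the locus may end,
  by \<open>regular\<close>; \<open>branch\<close> prevents an edge from having both ends at the
  same one. The edge is found by lifting the unit circle to the closed face through
  \<open>z0\<close>, in both directions, until the lift leaves \<Omega>. The bound on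
  \<open>closure D\<close> later identifies \<open>D\<close> as a component of the complement of the
  other edges.\<close>

theorem locus_chord:
  assumes z0: "z0 \<in> locus"
    and regular: "\<And>x. x \<in> frontier \<Omega> \<Longrightarrow> x \<notin> X \<Longrightarrow> x \<notin> closure locus"
    and branch: "\<And>x e. x \<in> X \<Longrightarrow> e > 0 \<Longrightarrow> \<exists>N. open N \<and> x \<in> N \<and> N \<subseteq> ball x e \<and> connected (N \<inter> locus)"
  obtains \<gamma> D \<phi> where "arc \<gamma>" "pathstart \<gamma> \<in> X" "pathfinish \<gamma> \<in> X" "z0 \<in> chord \<gamma>"
    "open D" "D \<subseteq> \<Omega>" "D \<inter> locus = chord \<gamma>" "closure D \<inter> \<Omega> \<subseteq> D \<union> locus"
    "conformal_onto \<phi> D upper_half_plane"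
    "\<And>t. t \<in> {0<..<1} \<Longrightarrow> \<phi> (\<gamma> t) = \<i> * of_real (sqrt (t / (1 - t)))"
proof -
  obtain M g M' g' V V' where M: "z0 \<in> M" "compact M" "M \<subseteq> half" "homeomorphism M (cball 0 1) quot g"
    and M': "z0 \<in> M'" "compact M'" "M' \<subseteq> swap.half" "homeomorphism M' (cball 0 1) swap.quot g'"
    and V: "open V" "M \<inter> \<Omega> = half \<inter> \<Omega> \<inter> V" and V': "open V'" "M' \<inter> \<Omega> = swap.half \<inter> \<Omega> \<inter> V'"
    by (rule opposite_faces[OF z0])
  have g: "continuous_on (cball 0 1) g" "\<And>u. cmod u \<le> 1 \<Longrightarrow> g u \<in> M" "\<And>u. cmod u \<le> 1 \<Longrightarrow> quot (g u) = u"
      "\<And>z. z \<in> M \<Longrightarrow> g (quot z) = z"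
    using M(4) by (auto simp: homeomorphism_def)
  have g': "continuous_on (cball 0 1) g'" "\<And>u. cmod u \<le> 1 \<Longrightarrow> g' u \<in> M'" "\<And>u. cmod u \<le> 1 \<Longrightarrow> swap.quot (g' u) = u"
      "\<And>z. z \<in> M' \<Longrightarrow> g' (swap.quot z) = z"
    using M'(4) by (auto simp: homeomorphism_def)
  have inj: "z = z'" if "z \<in> M" "z' \<in> M" "quot z = quot z'" for z z'
    using g(4) that by metis
  have inj': "z = z'" if "z \<in> M'" "z' \<in> M'" "swap.quot z = swap.quot z'" for z z'
    using g'(4) that by metis
  have Qg: "Q (g u) \<noteq> 0" and Pg: "P (g u) = u * Q (g u)" if "cmod u \<le> 1" for u
    using g(2,3)[OF that] Q_nonzero M(3) by (auto simp: field_simps)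
  have Pg': "P (g' u) \<noteq> 0" and Qg': "Q (g' u) = u * P (g' u)" if "cmod u \<le> 1" for u
    using g'(2,3)[OF that] swap.Q_nonzero M'(3) by (auto simp: field_simps)
  have g_locus: "g u \<in> locus" if "cmod u = 1" "g u \<in> \<Omega>" for u
    using that Pg[of u] by (simp add: locus_def norm_mult)
  define w where "w = quot z0"
  have w: "cmod w = 1" "g w = z0" "w \<noteq> 0"
    using z0 Q_nonzero[of z0] M(1,3) g(4) by (auto simp: w_def locus_def norm_divide)
  have z0\<Omega>: "z0 \<in> \<Omega>" using z0 by (simp add: locus_def)
  \<comment> \<open>The second face is closed, and within \<Omega> it is relatively open among the
    points of \<open>swap.half\<close>. So it contains every connected piece of the boundary of the
    first face that passes through \<open>z0\<close> inside \<Omega>.\<close>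
  have edge: "g ` S \<subseteq> M'" if "connected S" "S \<subseteq> sphere 0 1" "w \<in> S" "g ` S \<subseteq> \<Omega>" for S
  proof -
    have S: "cmod u = 1" if "u \<in> S" for u using that \<open>S \<subseteq> sphere 0 1\<close> by auto
    have "connected (g ` S)"
      using \<open>connected S\<close> g(1) S by (intro connected_continuous_image continuous_on_subset[OF g(1)]) force+
    moreover have "g ` S \<subseteq> swap.half \<inter> \<Omega>"
      using g_locus S that(4) locus_half by blast
    then have "g ` S \<inter> M' = g ` S \<inter> V'"
      using V'(2) by blast
    then have "openin (top_of_set (g ` S)) (g ` S \<inter> M')"
      using V'(1) by auto
    moreover have "closedin (top_of_set (g ` S)) (g ` S \<inter> M')"
      using M'(2) compact_imp_closed by (metis closedin_closed_Int)
    moreover have "z0 \<in> g ` S \<inter> M'"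
      using that(3) w(2) M'(1) by auto
    ultimately have "g ` S \<inter> M' = g ` S"
      unfolding connected_clopen by blast
    then show ?thesis by blast
  qed
  \<comment> \<open>Otherwise the two closed faces form a nonempty, compact and open subset of the plane.\<close>
  have "\<not> g ` sphere 0 1 \<subseteq> \<Omega>"
  proof
    assume sub: "g ` sphere 0 1 \<subseteq> \<Omega>"
    have in_M': "g u \<in> M'" if "cmod u = 1" for u
      using edge[OF connected_sphere _ _ sub] w(1) that by auto
    have M'_M: "z \<in> M \<and> z \<in> \<Omega>" if z: "z \<in> M'" "cmod (P z) = cmod (Q z)" for z
    proof -
      have nz: "P z \<noteq> 0" "Q z \<noteq> 0" using swap.Q_nonzero M'(3) z by auto
      have u: "cmod (quot z) = 1" using z(2) nz by (simp add: norm_divide)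
      have "swap.quot (g (quot z)) = swap.quot z"
        using Pg[of "quot z"] Qg[of "quot z"] u nz by simp
      then have "g (quot z) = z"
        using inj' in_M'[OF u] z(1) by blast
      moreover have "g (quot z) \<in> M \<inter> \<Omega>" using g(2)[of "quot z"] u sub by (simp add: image_subset_iff)
      ultimately show ?thesis by simp
    qed
    have M_M': "z \<in> M' \<and> z \<in> \<Omega>" if z: "z \<in> M" "cmod (P z) = cmod (Q z)" for z
    proof -
      have u: "cmod (quot z) = 1" using z(2) Q_nonzero[of z] M(3) z(1) by (auto simp: norm_divide)
      then have "g (quot z) \<in> M' \<and> g (quot z) \<in> \<Omega>" using in_M'[OF u] sub by auto
      then show ?thesis using g(4)[OF z(1)] by simp
    qed
    have "M \<union> M' \<subseteq> \<Omega>"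
    proof
      fix z assume z: "z \<in> M \<union> M'"
      show "z \<in> \<Omega>"
      proof (cases "cmod (P z) = cmod (Q z)")
        case True then show ?thesis using z M_M' M'_M by blast
      next
        case False
        then have "z \<in> frontier \<Omega> \<Longrightarrow> False" using frontier_norm_eq by blast
        moreover have "z \<in> closure \<Omega>" using z M(3) M'(3) by (auto simp: half_def swap.half_def)
        ultimately show ?thesis using open_\<Omega> by (auto simp: frontier_def interior_open)
      qed
    qed
    have "open (M \<union> M')"
    proof (subst open_subopen, rule ballI)
      fix z assume z: "z \<in> M \<union> M'"
      then have z\<Omega>: "z \<in> \<Omega>" using \<open>M \<union> M' \<subseteq> \<Omega>\<close> by blast
      consider "cmod (P z) = cmod (Q z)" | "cmod (P z) < cmod (Q z)" | "cmod (Q z) < cmod (P z)" by linarith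
      then show "\<exists>T. open T \<and> z \<in> T \<and> T \<subseteq> M \<union> M'"
      proof cases
        case 1
        then have "z \<in> M" "z \<in> M'" using z M_M' M'_M by blast+
        then have "z \<in> V \<inter> V' \<inter> \<Omega>" using V V' z\<Omega> by blast
        moreover have "V \<inter> V' \<inter> \<Omega> \<subseteq> M \<union> M'" using V V' half_cases by blast
        ultimately show ?thesis using V(1) V'(1) open_\<Omega> by (metis open_Int)
      next
        case 2
        then have "z \<in> M" using z M'(3) by (auto simp: swap.half_def)
        then have "z \<in> V \<inter> (\<Omega> \<inter> {x. cmod (P x) < cmod (Q x)})" using V z\<Omega> 2 by blast
        moreover have "V \<inter> (\<Omega> \<inter> {x. cmod (P x) < cmod (Q x)}) \<subseteq> M \<union> M'"
          using V closure_subset[of \<Omega>] by (auto simp: half_def)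
        moreover have "open {x. cmod (P x) < cmod (Q x)}"
          by (intro open_Collect_less continuous_intros contP contQ)
        ultimately show ?thesis using V(1) open_\<Omega> by (metis open_Int)
      next
        case 3
        then have "z \<in> M'" using z M(3) by (auto simp: half_def)
        then have "z \<in> V' \<inter> (\<Omega> \<inter> {x. cmod (Q x) < cmod (P x)})" using V' z\<Omega> 3 by blast
        moreover have "V' \<inter> (\<Omega> \<inter> {x. cmod (Q x) < cmod (P x)}) \<subseteq> M \<union> M'"
          using V' closure_subset[of \<Omega>] by (auto simp: swap.half_def)
        moreover have "open {x. cmod (Q x) < cmod (P x)}"
          by (intro open_Collect_less continuous_intros contP contQ)
        ultimately show ?thesis using V'(1) open_\<Omega> by (metis open_Int)
      qed
    qed
    moreover have "compact (M \<union> M')" using M(2) M'(2) by blast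
    ultimately have "M \<union> M' = UNIV"
      using M(1) compact_imp_closed clopen[of "M \<union> M'"] by fast
    then show False
      using \<open>compact (M \<union> M')\<close> not_compact_UNIV by metis
  qed
  then obtain u0 where u0: "cmod u0 = 1" "g u0 \<notin> \<Omega>"
    by (metis image_subsetI mem_sphere_0)
  define h where "h t = g (w * cis t)" for t
  have norm_w: "cmod (w * cis t) = 1" for t
    by (simp add: norm_mult w(1))
  have conth: "continuous_on S h" for S
    unfolding h_def using w(1)
    by (intro continuous_on_compose2[OF g(1)] continuous_intros) (auto simp: norm_mult)
  have h_M: "h t \<in> M" and quot_h: "quot (h t) = w * cis t" for t
    using g(2,3)[of "w * cis t"] norm_w[of t] by (auto simp: h_def)
  have h_locus: "h t \<in> locus" if "h t \<in> \<Omega>" for t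
    using g_locus norm_w that by (simp add: h_def)
  have h_periodic: "h (t + 2 * pi) = h t" for t
    by (simp add: h_def flip: cis_mult)
  have h0: "h 0 = z0" by (simp add: h_def w(2))
  define T where "T = {0..2*pi} \<inter> h -` (- \<Omega>)"
  have "closed T"
    unfolding T_def using open_\<Omega> by (intro continuous_closed_preimage conth) auto
  have T_bdd: "bdd_below T" "bdd_above T"
    by (auto simp: T_def)
  have polar: "\<exists>t. 0 \<le> t \<and> t < 2 * pi \<and> u = w * cis t" if "cmod u = 1" for u
  proof -
    have "cmod (u / w) = 1" using that w(1) by (simp add: norm_divide)
    then obtain t where "0 \<le> t" "t < 2 * pi" "u / w = cis t"
      using complex_unimodular_polar by (metis cis.code)
    then show ?thesis using w(3) by (auto simp: field_simps)
  qed
  have "T \<noteq> {}"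
  proof -
    obtain t where "0 \<le> t" "t < 2 * pi" "u0 = w * cis t" using polar[OF u0(1)] by blast
    then have "t \<in> T" using u0(2) by (simp add: T_def h_def)
    then show ?thesis by blast
  qed
  \<comment> \<open>The lift \<open>h\<close> has period \<open>2 * pi\<close> and starts inside
    \<Omega> at parameter 0. Hence \<open>Inf T\<close> is its first exit going forward, and
    \<open>Sup T\<close>, moved back by one period, is the first exit going backward.\<close>
  define \<alpha> \<beta> where "\<alpha> = Sup T - 2 * pi" and "\<beta> = Inf T"
  have "\<beta> \<in> T"
    unfolding \<beta>_def using \<open>T \<noteq> {}\<close> T_bdd(1) \<open>closed T\<close> by (rule closed_contains_Inf)
  have "\<alpha> + 2 * pi \<in> T"
    unfolding \<alpha>_def using closed_contains_Sup[OF \<open>T \<noteq> {}\<close> T_bdd(2) \<open>closed T\<close>] by simp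
  have le: "\<beta> \<le> \<alpha> + 2 * pi"
    using cInf_lower[OF \<open>\<alpha> + 2 * pi \<in> T\<close> T_bdd(1)] by (simp add: \<beta>_def)
  have "- (2 * pi) \<le> \<alpha>"
    using \<open>\<alpha> + 2 * pi \<in> T\<close> by (auto simp: T_def)
  have "0 \<notin> T" "2 * pi \<notin> T"
    using h0 h_periodic[of 0] z0\<Omega> by (auto simp: T_def)
  then have \<alpha>\<beta>: "\<alpha> < 0" "0 < \<beta>" "\<beta> < 2 * pi"
    using \<open>\<beta> \<in> T\<close> \<open>\<alpha> + 2 * pi \<in> T\<close> by (auto simp: T_def le_less)
  have ends: "h \<alpha> \<notin> \<Omega>" "h \<beta> \<notin> \<Omega>"
    using \<open>\<beta> \<in> T\<close> \<open>\<alpha> + 2 * pi \<in> T\<close> h_periodic[of \<alpha>] by (auto simp: T_def)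
  have inside: "h t \<in> \<Omega>" if "\<alpha> < t" "t < \<beta>" for t
  proof (cases "t \<ge> 0")
    case True
    have "t \<notin> T"
      using cInf_lower[OF _ T_bdd(1), of t] that(2) by (auto simp: \<beta>_def)
    then show ?thesis using True that(2) \<alpha>\<beta>(3) by (auto simp: T_def)
  next
    case False
    have "t + 2 * pi \<notin> T"
      using cSup_upper[OF _ T_bdd(2), of "t + 2 * pi"] that(1) by (auto simp: \<alpha>_def)
    moreover have "0 \<le> t + 2 * pi"
      using that(1) \<open>\<alpha> + 2 * pi \<in> T\<close> by (auto simp: T_def)
    ultimately show ?thesis using False h_periodic[of t] by (auto simp: T_def)
  qed
  define C where "C = h ` {\<alpha><..<\<beta>}"
  have C_locus: "C \<subseteq> locus" using inside h_locus by (auto simp: C_def)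
  have C_M: "C \<subseteq> M" using h_M by (auto simp: C_def)
  have C_M': "C \<subseteq> M'"
  proof -
    have "g ` ((\<lambda>t. w * cis t) ` {\<alpha><..<\<beta>}) \<subseteq> M'"
    proof (rule edge)
      show "connected ((\<lambda>t. w * cis t) ` {\<alpha><..<\<beta>})"
        by (intro connected_continuous_image continuous_intros) auto
      show "w \<in> (\<lambda>t. w * cis t) ` {\<alpha><..<\<beta>}"
        using \<alpha>\<beta> by (intro image_eqI[of _ _ 0]) auto
    qed (use inside norm_w in \<open>auto simp: h_def\<close>)
    then show ?thesis by (auto simp: C_def h_def image_image)
  qed
  have arcs: "\<exists>s. \<alpha> \<le> s \<and> s < \<alpha> + 2 * pi \<and> u = w * cis s" if u: "cmod u = 1" for u
  proof -
    obtain t where t: "0 \<le> t" "t < 2 * pi" "u = w * cis t" using polar[OF u] by blast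
    show ?thesis
    proof (cases "t < \<alpha> + 2 * pi")
      case True
      then show ?thesis using t \<alpha>\<beta> by (intro exI[of _ t]) auto
    next
      case False
      have "cis (t - 2 * pi) = cis t" by (simp flip: cis_divide)
      then show ?thesis using t False \<alpha>\<beta> \<open>- (2 * pi) \<le> \<alpha>\<close> by (intro exI[of _ "t - 2 * pi"]) auto
    qed
  qed
  \<comment> \<open>The edge is relatively open in the locus: inside \<open>V\<close> all of the
    locus belongs to \<open>M\<close>, where a point is determined by its value, and excluding the
    closed complementary arc \<open>R\<close> of values leaves exactly \<open>C\<close>.\<close>
  obtain W where W: "open W" "C = locus \<inter> W"
  proof -
    define R where "R = (\<lambda>t. w * cis t) ` {\<beta>..\<alpha> + 2 * pi}"
    have "closed R"
      unfolding R_def by (intro compact_imp_closed compact_continuous_image continuous_intros) auto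
    define W where "W = V \<inter> ({z. Q z \<noteq> 0} \<inter> quot -` (- R))"
    have "open W"
      unfolding W_def using V(1) \<open>closed R\<close> by (intro open_Int continuous_open_preimage cont_quot open_Q_nonzero) auto
    moreover have "C = locus \<inter> W"
    proof (intro equalityI subsetI)
      fix z assume z: "z \<in> C"
      then obtain t where t: "\<alpha> < t" "t < \<beta>" "z = h t" by (auto simp: C_def)
      have "w * cis t \<notin> R"
      proof
        assume "w * cis t \<in> R"
        then obtain s where "\<beta> \<le> s" "s \<le> \<alpha> + 2 * pi" "cis t = cis s" using w(3) by (auto simp: R_def)
        then show False using cis_eq_imp_eq[of t s] t by auto
      qed
      moreover have "z \<in> locus" "z \<in> V" "Q z \<noteq> 0"
        using z C_locus C_M V(2) Q_nonzero M(3) by (auto simp: locus_def)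
      ultimately show "z \<in> locus \<inter> W" using quot_h t(3) by (auto simp: W_def)
    next
      fix z assume z: "z \<in> locus \<inter> W"
      then have "z \<in> M" using V(2) locus_half by (auto simp: W_def)
      have "cmod (quot z) = 1" using z by (auto simp: locus_def W_def norm_divide)
      then obtain s where s: "\<alpha> \<le> s" "s < \<alpha> + 2 * pi" "quot z = w * cis s" using arcs by blast
      then have "s < \<beta>" using z by (auto simp: W_def R_def)
      moreover have "s \<noteq> \<alpha>"
      proof
        assume "s = \<alpha>"
        have "cis (\<alpha> + 2 * pi) = cis \<alpha>" by (simp flip: cis_mult)
        then have "quot z \<in> R"
          unfolding R_def using s(3) \<open>s = \<alpha>\<close> le by (intro image_eqI[of _ _ "\<alpha> + 2 * pi"]) auto
        then show False using z by (simp add: W_def)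
      qed
      ultimately show "z \<in> C"
        unfolding C_def using s g(4)[OF \<open>z \<in> M\<close>] by (intro image_eqI[of _ _ s]) (auto simp: h_def)
    qed
    ultimately show thesis using that by blast
  qed
  have closure_C: "h t \<in> closure locus" if "\<alpha> \<le> t" "t \<le> \<beta>" for t
  proof -
    have "h ` closure {\<alpha><..<\<beta>} \<subseteq> closure locus"
      using inside h_locus closure_subset[of locus] by (intro image_closure_subset conth) auto
    then show ?thesis using that \<alpha>\<beta> by (auto simp: closure_greaterThanLessThan)
  qed
  have in_X: "h t \<in> X" if "h t \<notin> \<Omega>" "\<alpha> \<le> t" "t \<le> \<beta>" for t
  proof -
    have "h t \<in> frontier \<Omega>"
      using h_M[of t] M(3) that(1) open_\<Omega> by (auto simp: frontier_def half_def interior_open)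
    then show ?thesis using regular closure_C that by blast
  qed
  \<comment> \<open>Otherwise both ends of the edge are the same point of \<open>X\<close>, near which the locus is connected and
    would have to run through \<open>z0\<close>.\<close>
  have lt: "\<beta> < \<alpha> + 2 * pi"
  proof (rule ccontr)
    assume "\<not> \<beta> < \<alpha> + 2 * pi"
    then have eq: "\<beta> = \<alpha> + 2 * pi" using le by simp
    define x where "x = h \<alpha>"
    have x: "x \<in> X" "h \<alpha> = x" "h \<beta> = x"
      using in_X[OF ends(1)] \<alpha>\<beta> h_periodic[of \<alpha>] by (auto simp: x_def eq)
    have "dist x z0 > 0" using ends(1) x(2) z0\<Omega> by auto
    then obtain N where N: "open N" "x \<in> N" "N \<subseteq> ball x (dist x z0)" "connected (N \<inter> locus)"
      using branch x(1) by blast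
    have "open (h -` N)" using conth[of UNIV] N(1) by (simp add: continuous_on_open_vimage)
    then obtain d1 d2 where d: "d1 > 0" "ball \<alpha> d1 \<subseteq> h -` N" "d2 > 0" "ball \<beta> d2 \<subseteq> h -` N"
      using N(2) x by (metis open_contains_ball vimage_eq)
    define s1 s2 where "s1 = \<alpha> + min d1 (- \<alpha>) / 2" "s2 = \<beta> - min d2 \<beta> / 2"
    have s: "\<alpha> < s1" "s1 < 0" "s1 \<in> ball \<alpha> d1" "0 < s2" "s2 < \<beta>" "s2 \<in> ball \<beta> d2"
      using d \<alpha>\<beta> by (auto simp: s1_s2_def dist_real_def min_def)
    then have hs: "h s1 \<in> N \<inter> locus" "h s2 \<in> N \<inter> locus"
      using d inside \<alpha>\<beta> by (auto intro!: h_locus)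
    \<comment> \<open>Since \<open>C\<close> is relatively clopen in the locus near
      \<open>x\<close>, the connected set \<open>?K\<close> lies in \<open>C\<close>. The two closed
      arcs of the edge from \<open>z0\<close> to its ends both meet \<open>?K\<close>, but they
      share only \<open>z0\<close> and \<open>x\<close>: the former is outside \<open>N\<close> by
      the choice of radius, the latter outside the locus.\<close>
    let ?K = "N \<inter> locus"
    have "closed (h ` S)" if "compact S" for S
      using that conth compact_continuous_image compact_imp_closed by metis
    note cl = this[OF compact_Icc]
    have C_alt: "C = locus \<inter> h ` {\<alpha>..\<beta>}"
      using C_locus ends by (force simp: C_def locus_def le_less)
    have "openin (top_of_set ?K) (?K \<inter> C)"
      using W by (auto simp: openin_open)
    moreover have "closedin (top_of_set ?K) (?K \<inter> C)"
      using cl C_alt unfolding closedin_closed by blast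
    moreover have "h s1 \<in> ?K \<inter> C" using hs s \<alpha>\<beta> by (auto simp: C_def)
    ultimately have "?K \<inter> C = ?K"
      using N(4) unfolding connected_clopen by blast
    moreover have "C \<subseteq> h ` {\<alpha>..0} \<union> h ` {0..\<beta>}" by (force simp: C_def)
    ultimately have "?K \<subseteq> h ` {\<alpha>..0} \<union> h ` {0..\<beta>}" by blast
    moreover have "h ` {\<alpha>..0} \<inter> h ` {0..\<beta>} \<inter> ?K = {}"
    proof (rule ccontr)
      assume "h ` {\<alpha>..0} \<inter> h ` {0..\<beta>} \<inter> ?K \<noteq> {}"
      then obtain s t where st: "\<alpha> \<le> s" "s \<le> 0" "0 \<le> t" "t \<le> \<beta>" "h s = h t" "h s \<in> N" "h s \<in> locus"
        by auto
      then have "s \<noteq> \<alpha>" using ends by (auto simp: locus_def)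
      have "cis s = cis t" using quot_h[of s] quot_h[of t] st(5) w(3) by simp
      then have "s = t" using st \<open>s \<noteq> \<alpha>\<close> eq by (intro cis_eq_imp_eq) auto
      then have "h s = z0" using st h0 by auto
      then show False using st(6) N(3) by auto
    qed
    ultimately show False
      using N(4) cl[of \<alpha> 0] cl[of 0 \<beta>] hs s unfolding connected_closed
      by (smt (verit) Int_iff atLeastAtMost_iff empty_iff imageI)
  qed
  \<comment> \<open>The values at the two ends of the edge are \<open>e\<close> and
    \<open>e' = e k^2\<close>. Since \<beta> - \<alpha> is strictly between 0 and
    \<open>2 * pi\<close>, this square root \<open>k\<close> of their ratio has positive imaginary
    part.\<close>
  define e k where "e = w * cis \<alpha>" and "k = cis ((\<beta> - \<alpha>) / 2)"
  define e' where "e' = e * k\<^sup>2"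
  have e': "e' = w * cis \<beta>"
  proof -
    have "\<alpha> + real 2 * ((\<beta> - \<alpha>) / 2) = \<beta>" by (simp add: field_simps)
    then show ?thesis
      unfolding e'_def e_def k_def Complex.DeMoivre mult.assoc cis_mult by metis
  qed
  have norm: "cmod e = 1" "cmod k = 1" "cmod e' = 1" using norm_w by (simp_all add: e_def k_def e')
  have nz: "e \<noteq> 0" "k \<noteq> 0" "e' \<noteq> 0" using norm by auto
  have "Im k > 0"
    using lt \<alpha>\<beta> by (auto simp: k_def intro!: sin_gt_zero)
  have "e \<noteq> e'"
  proof
    assume "e = e'"
    then have "cis \<alpha> = cis \<beta>" using w(3) by (simp add: e_def e')
    then show False using cis_eq_imp_eq[of \<alpha> \<beta>] lt \<alpha>\<beta> by auto
  qed
  \<comment> \<open>Two arguments instead of a quotient, because on the face over the outside of the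
    circle \<open>Q\<close> may vanish.\<close>
  define m where "m u v = - k * (u - e * v) / (u - e' * v)" for u v
  have Im_m: "Im (m u v) = Im k * ((cmod v)\<^sup>2 - (cmod u)\<^sup>2) / (cmod (u - e' * v))\<^sup>2" if "u \<noteq> e' * v" for u v
    using Im_mobius[OF norm(1,2), of u v] that by (simp add: m_def e'_def)
  have m_cis: "m (w * cis s) 1 = of_real (sin ((s - \<alpha>) / 2) / sin ((\<beta> - s) / 2))"
    if "sin ((\<beta> - s) / 2) \<noteq> 0" for s
    using mobius_cis[OF w(3) k_def that] by (simp add: m_def e_def e')
  \<comment> \<open>Solving \<open>m u 1 = v\<close> for \<open>u\<close> gives
    \<open>(e' v + k e) / (v + k)\<close>. Kept as a pair, the solution makes sense also for
    \<open>v = - k\<close>.\<close>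
  have m_inv: "m (e' * v + k * e) (v + k) = v" and m_inv': "e' * v + k * e \<noteq> e' * (v + k)" for v
  proof -
    have d: "e' * v + k * e - e' * (v + k) = k * (e - e')" by (simp add: algebra_simps)
    show "m (e' * v + k * e) (v + k) = v"
      unfolding m_def d using nz \<open>e \<noteq> e'\<close> by (simp add: field_simps)
    show "e' * v + k * e \<noteq> e' * (v + k)"
      using d nz \<open>e \<noteq> e'\<close> by (metis eq_iff_diff_eq_0 mult_eq_0_iff)
  qed
  have m_scale: "m (u / v) 1 = m u v" if "v \<noteq> 0" for u v
  proof -
    have "u / v - x = (u - x * v) / v" for x using that by (simp add: field_simps)
    then show ?thesis using that by (simp add: m_def)
  qed
  have m_inj: "u * v' = u' * v" if "m u v = m u' v'" "u \<noteq> e' * v" "u' \<noteq> e' * v'" for u v u' v'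
  proof -
    have "(- k * (u - e * v)) * (u' - e' * v') = (- k * (u' - e * v')) * (u - e' * v)"
      using that by (simp add: m_def frac_eq_eq)
    then have "k * (e - e') * (u * v' - u' * v) = 0" by algebra
    then show ?thesis using \<open>e \<noteq> e'\<close> nz by simp
  qed
  have C_iff: "z \<in> C \<longleftrightarrow> P z \<noteq> e' * Q z \<and> Re (m (P z) (Q z)) > 0"
    if z: "z \<in> M" "cmod (P z) = cmod (Q z)" for z
  proof -
    define q where "q = quot z"
    have Qz: "Q z \<noteq> 0" using Q_nonzero M(3) z(1) by blast
    have q: "cmod q = 1" "m (P z) (Q z) = m q 1" "P z = e' * Q z \<longleftrightarrow> q = e'" "g q = z"
      using Qz z g(4) m_scale[OF Qz, of "P z"] by (auto simp: q_def norm_divide field_simps)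
    have sin_pos: "sin (x / 2) > 0" if "0 < x" "x < 2 * pi" for x
      using that by (intro sin_gt_zero) auto
    show ?thesis
    proof
      assume "z \<in> C"
      then obtain s where s: "\<alpha> < s" "s < \<beta>" "z = h s" by (auto simp: C_def)
      then have "q = w * cis s" using quot_h q_def by simp
      moreover have "sin ((s - \<alpha>) / 2) > 0" "sin ((\<beta> - s) / 2) > 0"
        using s lt by (auto intro!: sin_pos)
      moreover have "q \<noteq> e'"
        using cis_eq_imp_eq[of s \<beta>] s lt \<open>q = w * cis s\<close> w(3) by (auto simp: e')
      ultimately show "P z \<noteq> e' * Q z \<and> Re (m (P z) (Q z)) > 0"
        using q m_cis[of s] by simp
    next
      assume *: "P z \<noteq> e' * Q z \<and> Re (m (P z) (Q z)) > 0"
      obtain s where s: "\<alpha> \<le> s" "s < \<alpha> + 2 * pi" "q = w * cis s" using arcs[OF q(1)] by blast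
      have "s \<noteq> \<beta>" using * q(3) s(3) e' by auto
      have "s < \<beta>"
      proof (rule ccontr)
        assume "\<not> s < \<beta>"
        then have "sin ((\<beta> - s) / 2) < 0" "sin ((s - \<alpha>) / 2) \<ge> 0"
          using sin_pos[of "s - \<beta>"] sin_pos[of "s - \<alpha>"] s \<open>s \<noteq> \<beta>\<close> \<alpha>\<beta>
            sin_minus[of "(s - \<beta>) / 2"] by (auto simp: minus_divide_left)
        then show False using m_cis[of s] * q(2) s(3) by (auto simp: divide_less_0_iff zero_less_divide_iff)
      qed
      moreover have "s \<noteq> \<alpha>"
      proof
        assume "s = \<alpha>"
        then show False
          using m_cis[of s] sin_pos[of "\<beta> - \<alpha>"] * q(2) s(3) lt \<alpha>\<beta> by auto
      qed
      ultimately show "z \<in> C"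
        using s q(4) by (auto simp: C_def h_def intro!: image_eqI[of _ _ s])
    qed
  qed
  \<comment> \<open>The union of both closed faces, without their frontier points and without all
    edges except \<open>C\<close>.\<close>
  define D where "D = (M \<union> M') \<inter> \<Omega> - (locus - C)"
  define F where "F z = m (P z) (Q z)" for z
  have D_M: "z \<in> M" if "z \<in> D" "cmod (P z) \<le> cmod (Q z)" for z
    using that C_M M'(3) by (fastforce simp: D_def locus_def swap.half_def)
  have D_M': "z \<in> M'" if "z \<in> D" "cmod (Q z) \<le> cmod (P z)" for z
    using that C_M' M(3) by (fastforce simp: D_def locus_def half_def)
  have D_locus: "D \<inter> locus = C"
    using C_M C_locus by (auto simp: D_def locus_def)
  have D_C: "z \<in> C" if "z \<in> D" "cmod (P z) = cmod (Q z)" for z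
    using that by (auto simp: D_def locus_def)
  have "open D"
  proof (subst open_subopen, rule ballI)
    fix z assume z: "z \<in> D"
    then have z\<Omega>: "z \<in> \<Omega>" by (simp add: D_def)
    consider "cmod (P z) = cmod (Q z)" | "cmod (P z) < cmod (Q z)" | "cmod (Q z) < cmod (P z)" by linarith
    then show "\<exists>T. open T \<and> z \<in> T \<and> T \<subseteq> D"
    proof cases
      case 1
      then have "z \<in> C" using D_C z by blast
      then have "z \<in> V \<inter> (V' \<inter> (\<Omega> \<inter> W))" using C_M C_M' W V V' z\<Omega> by blast
      moreover have "V \<inter> (V' \<inter> (\<Omega> \<inter> W)) \<subseteq> D" unfolding D_def using V V' W half_cases by blast
      ultimately show ?thesis using V(1) V'(1) W(1) open_\<Omega> by (metis open_Int)
    next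
      case 2
      then have "z \<in> M" using D_M z by simp
      then have "z \<in> V \<inter> (\<Omega> \<inter> {x. cmod (P x) < cmod (Q x)})" using V z\<Omega> 2 by blast
      moreover have "V \<inter> (\<Omega> \<inter> {x. cmod (P x) < cmod (Q x)}) \<subseteq> D"
        using V closure_subset[of \<Omega>] by (auto simp: half_def D_def locus_def)
      moreover have "open {x. cmod (P x) < cmod (Q x)}"
        by (intro open_Collect_less continuous_intros contP contQ)
      ultimately show ?thesis using V(1) open_\<Omega> by (metis open_Int)
    next
      case 3
      then have "z \<in> M'" using D_M' z by simp
      then have "z \<in> V' \<inter> (\<Omega> \<inter> {x. cmod (Q x) < cmod (P x)})" using V' z\<Omega> 3 by blast
      moreover have "V' \<inter> (\<Omega> \<inter> {x. cmod (Q x) < cmod (P x)}) \<subseteq> D"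
        using V' closure_subset[of \<Omega>] by (auto simp: swap.half_def D_def locus_def)
      moreover have "open {x. cmod (Q x) < cmod (P x)}"
        by (intro open_Collect_less continuous_intros contP contQ)
      ultimately show ?thesis using V'(1) open_\<Omega> by (metis open_Int)
    qed
  qed
  have "closure D \<inter> \<Omega> \<subseteq> D \<union> locus"
  proof -
    have "closure D \<subseteq> M \<union> M'"
      using M(2) M'(2) by (intro closure_minimal) (auto simp: D_def compact_imp_closed closed_Un)
    then show ?thesis by (auto simp: D_def)
  qed
  have D_den: "P z \<noteq> e' * Q z" if "z \<in> D" for z
  proof
    assume eq: "P z = e' * Q z"
    then have "cmod (P z) = cmod (Q z)" using norm by (simp add: norm_mult)
    then show False using C_iff[of z] D_C[OF that] C_M eq by blast
  qed
  have sign_F: "Im (F z) > 0 \<longleftrightarrow> cmod (P z) < cmod (Q z)" "Im (F z) = 0 \<longleftrightarrow> cmod (P z) = cmod (Q z)" if "z \<in> D" for z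
  proof -
    define d where "d = (cmod (P z - e' * Q z))\<^sup>2"
    have "d > 0" using D_den[OF that] by (simp add: d_def)
    have F: "Im (F z) = Im k * ((cmod (Q z))\<^sup>2 - (cmod (P z))\<^sup>2) / d"
      unfolding F_def d_def by (rule Im_m[OF D_den[OF that]])
    show "Im (F z) > 0 \<longleftrightarrow> cmod (P z) < cmod (Q z)"
      unfolding F using \<open>Im k > 0\<close> \<open>d > 0\<close>
      by (simp add: zero_less_divide_iff zero_less_mult_iff)
        (meson norm_ge_zero power_less_imp_less_base power_strict_mono pos2)
    show "Im (F z) = 0 \<longleftrightarrow> cmod (P z) = cmod (Q z)"
      unfolding F using \<open>Im k > 0\<close> \<open>d > 0\<close> by (auto simp: power2_eq_iff_nonneg)
  qed
  have F_slit: "F z \<notin> \<real>\<^sub>\<le>\<^sub>0" if "z \<in> D" for z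
    using sign_F(2)[OF that] D_C[OF that] C_iff[of z] C_M by (force simp: complex_nonpos_Reals_iff F_def)
  have inj_F: "inj_on F D"
  proof (rule inj_onI)
    fix z z' assume z: "z \<in> D" "z' \<in> D" "F z = F z'"
    then have cross: "P z * Q z' = P z' * Q z"
      using m_inj D_den by (simp add: F_def)
    show "z = z'"
    proof (cases "cmod (P z) \<le> cmod (Q z)")
      case True
      then have "cmod (P z') \<le> cmod (Q z')" using sign_F z by (metis le_less)
      then have zM: "z \<in> M" "z' \<in> M" using D_M z True by auto
      then have "quot z = quot z'" using cross Q_nonzero M(3) by (simp add: subset_iff frac_eq_eq)
      then show ?thesis using inj zM by blast
    next
      case False
      then have "\<not> cmod (P z') \<le> cmod (Q z')" using sign_F z by (metis le_less)
      then have zM: "z \<in> M'" "z' \<in> M'" using D_M' z False by auto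
      then have "swap.quot z = swap.quot z'" using cross swap.Q_nonzero M'(3) by (simp add: subset_iff frac_eq_eq mult.commute)
      then show ?thesis using inj' zM by blast
    qed
  qed
  have F_g: "F (g u) = m u 1" if "cmod u \<le> 1" for u
    using m_scale[OF Qg[OF that], of "P (g u)"] Pg[OF that] Qg[OF that] by (simp add: F_def)
  have surj_F: "\<exists>z\<in>D. F z = v" if v: "v \<notin> \<real>\<^sub>\<le>\<^sub>0" for v
  proof -
    \<comment> \<open>Homogeneous coordinates of the preimage of \<open>v\<close> on the sphere. The
      comparison of their moduli decides which face supplies the point; in the case of equality
      \<open>v\<close> is real, hence positive, and the point lies on \<open>C\<close>.\<close>
    define a b where "a = e' * v + k * e" and "b = v + k"
    have m: "m a b = v" "a \<noteq> e' * b" using m_inv[of v] m_inv'[of v] by (auto simp: a_def b_def)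
    define d where "d = (cmod (a - e' * b))\<^sup>2"
    have "d > 0" using m(2) by (simp add: d_def)
    have Im_v: "Im v = Im k * ((cmod b)\<^sup>2 - (cmod a)\<^sup>2) / d"
      unfolding d_def using Im_m[OF m(2)] m(1) by simp
    show ?thesis
    proof (cases "cmod a \<le> cmod b")
      case True
      then have "b \<noteq> 0" using m(2) by auto
      define u where "u = a / b"
      have u: "cmod u \<le> 1" using True \<open>b \<noteq> 0\<close> by (simp add: u_def norm_divide)
      have Fv: "F (g u) = v" using F_g[OF u] m_scale[OF \<open>b \<noteq> 0\<close>] m(1) by (simp add: u_def)
      have "g u \<in> D"
      proof (cases "cmod u = 1")
        case True
        then have "cmod a = cmod b" using \<open>b \<noteq> 0\<close> by (simp add: u_def norm_divide)
        then have "Re v > 0" using v Im_v by (auto simp: complex_nonpos_Reals_iff)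
        moreover have "cmod (P (g u)) = cmod (Q (g u))" using Pg[OF u] True by (simp add: norm_mult)
        moreover have "P (g u) \<noteq> e' * Q (g u)"
        proof
          assume "P (g u) = e' * Q (g u)"
          then have "u = e'" using Pg[OF u] Qg[OF u] by simp
          then show False using m(2) \<open>b \<noteq> 0\<close> by (simp add: u_def divide_eq_eq)
        qed
        ultimately have "g u \<in> C" using C_iff[OF g(2)[OF u]] Fv by (simp add: F_def)
        then show ?thesis using D_locus by blast
      next
        case False
        then have "cmod (quot (g u)) < 1" using g(3)[OF u] u by simp
        then have "g u \<in> \<Omega>" using quot_less_1_in g(2)[OF u] M(3) by blast
        moreover have "g u \<notin> locus"
          using Pg[OF u] Qg[OF u] False by (auto simp: locus_def norm_mult)
        ultimately show ?thesis using g(2)[OF u] by (simp add: D_def)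
      qed
      then show ?thesis using Fv by blast
    next
      case False
      then have "a \<noteq> 0" by auto
      define u where "u = b / a"
      have u: "cmod u < 1" using False \<open>a \<noteq> 0\<close> by (simp add: u_def norm_divide)
      then have u1: "cmod u \<le> 1" by simp
      have "F (g' u) = v"
      proof -
        have "F (g' u) = m (P (g' u)) (u * P (g' u))" using Qg'[OF u1] by (simp add: F_def)
        also have "\<dots> = m a b"
          using Pg'[OF u1] \<open>a \<noteq> 0\<close> m(2) by (simp add: m_def u_def field_simps)
        finally show ?thesis using m(1) by simp
      qed
      moreover have "g' u \<in> \<Omega>"
        using swap.quot_less_1_in[of "g' u"] g'(2,3)[OF u1] M'(3) u by auto
      moreover have "g' u \<notin> locus"
        using Pg'[OF u1] Qg'[OF u1] u by (auto simp: locus_def norm_mult)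
      ultimately show ?thesis using g'(2)[OF u1] by (intro bexI[of _ "g' u"]) (auto simp: D_def)
    qed
  qed
  define \<phi> where "\<phi> z = \<i> * csqrt (F z)" for z
  have "conformal_onto \<phi> D upper_half_plane"
    unfolding conformal_onto_def
  proof (intro conjI)
    have "F holomorphic_on D"
      unfolding F_def m_def using holP holQ D_den
      by (intro holomorphic_intros) (auto intro: holomorphic_on_subset)
    then show "\<phi> holomorphic_on D"
      unfolding \<phi>_def using F_slit by (intro holomorphic_intros) auto
    have "inj_on \<phi> D"
      unfolding \<phi>_def using inj_F by (auto simp: inj_on_def) (metis power2_csqrt)
    moreover have "\<phi> ` D = upper_half_plane"
    proof (intro equalityI subsetI)
      fix y assume "y \<in> \<phi> ` D"
      then obtain z where z: "z \<in> D" "y = \<i> * csqrt (F z)" by (auto simp: \<phi>_def)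
      have "Re (csqrt (F z)) \<noteq> 0"
      proof
        assume "Re (csqrt (F z)) = 0"
        then have "(csqrt (F z))\<^sup>2 \<in> \<real>\<^sub>\<le>\<^sub>0"
          by (simp add: complex_nonpos_Reals_iff power2_eq_square)
        then show False using F_slit[OF z(1)] by simp
      qed
      then show "y \<in> upper_half_plane"
        using Re_csqrt[of "F z"] z(2) by (simp add: upper_half_plane_def)
    next
      fix y assume "y \<in> upper_half_plane"
      then have y: "Re (- \<i> * y) > 0" by (simp add: upper_half_plane_def)
      then have c: "csqrt ((- \<i> * y)\<^sup>2) = - \<i> * y" by (intro csqrt_square) auto
      have "(- \<i> * y)\<^sup>2 \<notin> \<real>\<^sub>\<le>\<^sub>0"
        using y by (auto simp: complex_nonpos_Reals_iff power2_eq_square complex_eq_iff mult_le_0_iff)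
      then obtain z where "z \<in> D" "F z = (- \<i> * y)\<^sup>2" using surj_F by blast
      then have "\<phi> z = \<i> * (- \<i> * y)" using c by (simp add: \<phi>_def)
      then show "y \<in> \<phi> ` D" using \<open>z \<in> D\<close> by (intro image_eqI[of _ _ z]) auto
    qed
    ultimately show "bij_betw \<phi> D upper_half_plane" by (simp add: bij_betw_def)
  qed fact
  \<comment> \<open>The point of the arc with Moebius image \<open>t / (1 - t)\<close>. Numerator
    and denominator are multiplied by \<open>1 - t\<close>, so that the formula also covers the end
    \<open>t = 1\<close>, where the image is infinite.\<close>
  define den \<omega> where "den t = of_real t + k * of_real (1 - t)"
    and "\<omega> t = (e' * of_real t + k * e * of_real (1 - t)) / den t" for t
  have den: "den t \<noteq> 0" if "0 \<le> t" "t \<le> 1" for t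
  proof (cases "t = 1")
    case False
    then have "Im (den t) \<noteq> 0" using that \<open>Im k > 0\<close> by (simp add: den_def)
    then show ?thesis by auto
  qed (simp add: den_def)
  have \<omega>1: "\<omega> 1 = e'" and \<omega>0: "\<omega> 0 = e" using nz by (simp_all add: \<omega>_def den_def)
  have m_\<omega>: "m (\<omega> t) 1 = of_real (t / (1 - t))" "\<omega> t \<noteq> e'" if t: "0 \<le> t" "t < 1" for t
  proof -
    define v where "v = complex_of_real (t / (1 - t))"
    have "of_real (1 - t) \<noteq> (0::complex)" using t by (metis of_real_eq_0_iff less_irrefl diff_eq_eq add_0)
    then have v: "v * of_real (1 - t) = of_real t" unfolding v_def of_real_divide
      using \<open>of_real (1 - t) \<noteq> (0::complex)\<close> by (metis nonzero_eq_divide_eq)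
    have d: "den t = (v + k) * of_real (1 - t)" unfolding den_def v[symmetric] by (simp only: distrib_right)
    then have "v + k \<noteq> 0" using den[of t] t by auto
    have "\<omega> t = ((e' * v + k * e) * of_real (1 - t)) / ((v + k) * of_real (1 - t))"
      unfolding \<omega>_def d v[symmetric] by (simp only: distrib_right mult.assoc)
    also have "\<dots> = (e' * v + k * e) / (v + k)"
      by (rule nonzero_mult_divide_mult_cancel_right) fact
    finally have \<omega>: "\<omega> t = (e' * v + k * e) / (v + k)" .
    have "m (\<omega> t) 1 = v"
      unfolding \<omega> using m_scale[OF \<open>v + k \<noteq> 0\<close>, of "e' * v + k * e"] m_inv[of v] by simp
    then show "m (\<omega> t) 1 = of_real (t / (1 - t))" unfolding v_def .
    show "\<omega> t \<noteq> e'"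
      unfolding \<omega> using m_inv'[of v] \<open>v + k \<noteq> 0\<close> by (simp add: divide_eq_eq)
  qed
  have norm_\<omega>: "cmod (\<omega> t) = 1" if t: "0 \<le> t" "t \<le> 1" for t
  proof (cases "t = 1")
    case False
    then have "t < 1" using t by simp
    then have "Im (m (\<omega> t) 1) = 0" using m_\<omega>(1)[OF t(1)] by simp
    then have "(cmod (\<omega> t))\<^sup>2 = 1"
      using Im_m[of "\<omega> t" 1] m_\<omega>(2)[OF t(1) \<open>t < 1\<close>] \<open>Im k > 0\<close> by auto
    then show ?thesis by (simp add: power2_eq_1_iff) (metis norm_ge_zero not_one_le_zero neg_0_le_iff_le)
  qed (use \<omega>1 norm in simp)
  have inj_\<omega>: "inj_on \<omega> {0..1}"
  proof (rule linorder_inj_onI)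
    fix s t :: real assume st: "s < t" "s \<in> {0..1}" "t \<in> {0..1}"
    show "\<omega> s \<noteq> \<omega> t"
    proof (cases "t = 1")
      case True then show ?thesis using m_\<omega>(2)[of s] st \<omega>1 by auto
    next
      case False
      have "s / (1 - s) \<noteq> t / (1 - t)" using st False by (simp add: field_simps)
      then have "m (\<omega> s) 1 \<noteq> m (\<omega> t) 1"
        using m_\<omega>(1)[of s] m_\<omega>(1)[of t] st False by (metis atLeastAtMost_iff le_less of_real_eq_iff less_trans)
      then show ?thesis by auto
    qed
  qed (rule linear)
  define \<gamma> where "\<gamma> t = g (\<omega> t)" for t
  have \<gamma>_M: "\<gamma> t \<in> M" "quot (\<gamma> t) = \<omega> t" "cmod (P (\<gamma> t)) = cmod (Q (\<gamma> t))" "F (\<gamma> t) = m (\<omega> t) 1" if "0 \<le> t" "t \<le> 1" for t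
    using norm_\<omega>[OF that] g(2,3)[of "\<omega> t"] Pg[of "\<omega> t"] F_g[of "\<omega> t"] by (simp_all add: \<gamma>_def norm_mult)
  have "arc \<gamma>"
    unfolding arc_def path_def
  proof
    show "continuous_on {0..1} \<gamma>"
      unfolding \<gamma>_def
    proof (rule continuous_on_compose2[OF g(1)])
      show "continuous_on {0..1} \<omega>"
        unfolding \<omega>_def using den by (intro continuous_intros) (auto simp: den_def intro!: continuous_intros)
    qed (use norm_\<omega> in auto)
    show "inj_on \<gamma> {0..1}"
      using inj_\<omega> \<gamma>_M(2) unfolding inj_on_def by (metis atLeastAtMost_iff)
  qed
  have chord: "chord \<gamma> = C"
  proof (intro equalityI subsetI)
    fix z assume "z \<in> chord \<gamma>"
    then obtain t where t: "0 < t" "t < 1" "z = \<gamma> t" by (auto simp: chord_def)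
    have "P z \<noteq> e' * Q z"
      using \<gamma>_M(2)[of t] m_\<omega>(2)[of t] Q_nonzero[of z] \<gamma>_M(1)[of t] M(3) t by (auto simp: field_simps)
    then show "z \<in> C"
      using C_iff[of z] \<gamma>_M[of t] m_\<omega>(1)[of t] t by (simp add: F_def)
  next
    fix z assume z: "z \<in> C"
    then have zM: "z \<in> M" "cmod (P z) = cmod (Q z)" "z \<in> D"
      using C_M C_locus D_locus by (auto simp: locus_def)
    define r where "r = Re (F z)"
    have r: "r > 0" "F z = of_real r"
      using C_iff[OF zM(1,2)] z sign_F(2)[OF zM(3)] zM(2) by (auto simp: r_def F_def complex_eq_iff)
    define t where "t = r / (1 + r)"
    have t: "0 < t" "t < 1" "t / (1 - t) = r" using r(1) by (auto simp: t_def field_simps)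
    have Qz: "Q z \<noteq> 0" using Q_nonzero M(3) zM(1) by blast
    have "m (\<omega> t) 1 = m (P z) (Q z)" using m_\<omega>(1)[of t] t r(2) by (simp add: F_def)
    then have "\<omega> t * Q z = P z * 1"
      using m_\<omega>(2)[of t] t D_den[OF zM(3)] by (intro m_inj) auto
    then have "quot z = \<omega> t" using Qz by (simp add: field_simps)
    then have "z = \<gamma> t" using g(4)[OF zM(1)] by (simp add: \<gamma>_def)
    then show "z \<in> chord \<gamma>" using t by (auto simp: chord_def)
  qed
  show ?thesis
  proof (rule that[of \<gamma> D \<phi>])
    show "pathstart \<gamma> \<in> X" "pathfinish \<gamma> \<in> X"
      using in_X[OF ends(1)] in_X[OF ends(2)] \<alpha>\<beta> \<omega>0 \<omega>1
      by (auto simp: pathstart_def pathfinish_def \<gamma>_def h_def e_def e')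
    show "z0 \<in> chord \<gamma>"
      unfolding chord C_def using h0 \<alpha>\<beta> by (intro image_eqI[of _ _ 0]) auto
    show "D \<inter> locus = chord \<gamma>" using D_locus chord by simp
    show "D \<subseteq> \<Omega>" by (auto simp: D_def)
    show "\<phi> (\<gamma> t) = \<i> * of_real (sqrt (t / (1 - t)))" if "t \<in> {0<..<1}" for t
      using that \<gamma>_M(4)[of t] m_\<omega>(1)[of t] by (simp add: \<phi>_def csqrt_of_real_nonneg del: of_real_divide)
  qed fact+
qed

end

section \<open>Real polynomials, Wronskians and simple critical points\<close>

abbreviation cpoly :: "real poly \<Rightarrow> complex poly" where
  "cpoly \<equiv> map_poly of_real"

lemma poly_cpoly_of_real: "poly (cpoly p) (of_real x) = of_real (poly p x)"
  by (induction p) (simp_all add: map_poly_pCons)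

lemma poly_cpoly_cnj: "poly (cpoly p) (cnj z) = cnj (poly (cpoly p) z)"
  by (induction p) (simp_all add: map_poly_pCons)

lemma cpoly_add: "cpoly (p + q) = cpoly p + cpoly q"
  and cpoly_diff: "cpoly (p - q) = cpoly p - cpoly q"
  and cpoly_mult: "cpoly (p * q) = cpoly p * cpoly q"
  by (auto simp: poly_eq_iff coeff_map_poly coeff_mult)

lemma cpoly_pderiv: "cpoly (pderiv p) = pderiv (cpoly p)"
  by (auto simp: poly_eq_iff coeff_map_poly coeff_pderiv)

text \<open>A Bezout identity over the reals persists over the complex numbers.\<close>

lemma coprime_cpoly_no_common_root:
  assumes "coprime p q"
  shows "poly (cpoly p) z \<noteq> 0 \<or> poly (cpoly q) z \<noteq> 0"
proof -
  have "fst (bezout_coefficients p q) * p + snd (bezout_coefficients p q) * q = 1"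
    using assms by (simp add: bezout_coefficients_fst_snd coprime_iff_gcd_eq_1)
  then have "poly (cpoly (fst (bezout_coefficients p q) * p + snd (bezout_coefficients p q) * q)) z = 1"
    by simp
  then show ?thesis by (auto simp: cpoly_add cpoly_mult)
qed

definition wronskian :: "'a::idom poly \<Rightarrow> 'a poly \<Rightarrow> 'a poly" where
  "wronskian p q = pderiv p * q - p * pderiv q"

lemma cpoly_wronskian: "cpoly (wronskian p q) = wronskian (cpoly p) (cpoly q)"
  by (simp add: wronskian_def cpoly_diff cpoly_mult cpoly_pderiv)

lemma wronskian_swap: "wronskian q p = - wronskian p q"
  by (simp add: wronskian_def algebra_simps)

text \<open>Coprimality turns \<open>p' q = p q'\<close> into divisibility of each derivative by its
  own polynomial, which degrees permit only for constants.\<close>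

lemma wronskian_eq_0_imp_const:
  fixes p q :: "real poly"
  assumes "coprime p q" "wronskian p q = 0"
  shows "degree p = 0 \<and> degree q = 0"
proof -
  have eq: "pderiv p * q = p * pderiv q" using assms(2) by (simp add: wronskian_def)
  have *: "degree f = 0" if "f dvd pderiv f" for f :: "real poly"
  proof (rule ccontr)
    assume f: "degree f \<noteq> 0"
    then have "pderiv f \<noteq> 0" by (simp add: pderiv_eq_0_iff)
    then have "degree f \<le> degree (pderiv f)" using that dvd_imp_degree_le by blast
    then show False using f by (simp add: degree_pderiv)
  qed
  have "p dvd pderiv p * q" "q dvd p * pderiv q"
    using eq by (metis dvd_triv_left, metis dvd_triv_right)
  then have "p dvd pderiv p" "q dvd pderiv q"
    using coprime_dvd_mult_left_iff[of p q] coprime_dvd_mult_right_iff[of q p] assms(1)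
    by (auto simp: coprime_commute)
  then show ?thesis using * by blast
qed

text \<open>\<open>\<zeta> ^ d * f (1 / \<zeta>)\<close> as a polynomial in \<open>\<zeta>\<close>, where \<open>degree f \<le> d\<close>.\<close>

definition reverse_poly :: "nat \<Rightarrow> 'a::field poly \<Rightarrow> 'a poly" where
  "reverse_poly d f = monom 1 (d - degree f) * reflect_poly f"

lemma poly_reverse_poly:
  assumes "degree f \<le> d" "z \<noteq> 0"
  shows "poly (reverse_poly d f) z = z ^ d * poly f (1 / z)"
  using assms by (simp add: reverse_poly_def poly_monom poly_reflect_poly_nz inverse_eq_divide mult.assoc flip: power_add)

lemma poly_reverse_poly_0:
  assumes "degree f \<le> d"
  shows "poly (reverse_poly d f) 0 = coeff f d"
  using assms by (cases "degree f = d") (auto simp: reverse_poly_def poly_monom coeff_eq_0)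

text \<open>A nonzero Wronskian makes the quotient locally injective. The cross-multiplied equation
  is symmetric in \<open>P\<close> and \<open>Q\<close>, so whichever of them does not vanish at
  \<open>a\<close> can serve as the denominator.\<close>

lemma projectively_injective_near:
  fixes P Q :: "complex poly"
  assumes "poly (wronskian P Q) a \<noteq> 0"
  shows "\<exists>e>0. \<forall>z\<in>ball a e. \<forall>z'\<in>ball a e. poly P z * poly Q z' = poly P z' * poly Q z \<longrightarrow> z = z'"
proof -
  have *: "\<exists>e>0. \<forall>z\<in>ball a e. \<forall>z'\<in>ball a e. poly P z * poly Q z' = poly P z' * poly Q z \<longrightarrow> z = z'"
    if W: "poly (wronskian P Q) a \<noteq> 0" and Q: "poly Q a \<noteq> 0" for P Q :: "complex poly"
  proof -
    let ?S = "{z. poly Q z \<noteq> 0}" and ?f = "\<lambda>z. poly P z / poly Q z"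
    have "open ?S" by (intro open_Collect_neq continuous_intros)
    have "?f holomorphic_on ?S" by (intro holomorphic_intros) auto
    moreover have "(?f has_field_derivative poly (wronskian P Q) a / (poly Q a)\<^sup>2) (at a)"
      using Q by (auto intro!: derivative_eq_intros poly_DERIV simp: wronskian_def power2_eq_square)
    then have "deriv ?f a \<noteq> 0"
      using W Q by (metis DERIV_imp_deriv divide_eq_0_iff power_eq_0_iff)
    ultimately obtain e where "e > 0" "ball a e \<subseteq> ?S" "inj_on ?f (ball a e)"
      using has_complex_derivative_locally_injective[of ?f ?S a] Q \<open>open ?S\<close> by auto
    then show ?thesis
      by (intro exI[of _ e]) (auto simp: inj_on_def subset_iff frac_eq_eq)
  qed
  show ?thesis
  proof (cases "poly Q a = 0")
    case True
    then have "poly P a \<noteq> 0" using assms by (auto simp: wronskian_def)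
    moreover have "poly (wronskian Q P) a \<noteq> 0" using assms by (subst wronskian_swap) simp
    ultimately show ?thesis using *[of Q P] by (metis mult.commute)
  qed (use * assms in blast)
qed

text \<open>Realness of \<open>p / q\<close> is expressed without division, so that poles belong to
  the locus.\<close>

definition half_locus :: "real poly \<Rightarrow> real poly \<Rightarrow> complex set" where
  "half_locus p q = {z. Im z > 0 \<and> Im (poly (cpoly p) z * cnj (poly (cpoly q) z)) = 0}"

lemma half_locus_swap: "half_locus q p = half_locus p q"
  by (auto simp: half_locus_def algebra_simps)

text \<open>If \<open>q\<close> does not vanish at \<open>x\<close>, then near \<open>x\<close> one
  has \<open>p / q = v + \<sigma> h^2\<close>, where \<open>v\<close> is real,
  \<open>\<sigma>\<close> is a sign and \<open>h\<close> is a local biholomorphism that commutes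
  with conjugation. The locus is therefore the preimage of the two axes. The real axis corresponds
  to the real line, and exactly one half of the imaginary axis comes from the upper half-plane. A
  pole is treated by exchanging \<open>p\<close> and \<open>q\<close>.\<close>

lemma branch_at_simple_critical_point:
  fixes p q :: "real poly" and x e :: real
  assumes cop: "coprime p q" and W: "poly (wronskian p q) x = 0" "\<not> [:- x, 1:] ^ 2 dvd wronskian p q" and "e > 0"
  shows "\<exists>N. open N \<and> of_real x \<in> N \<and> N \<subseteq> ball (of_real x) e \<and> connected (N \<inter> half_locus p q) \<and> N \<inter> half_locus p q \<noteq> {}"
proof -
  have main: "\<exists>N. open N \<and> of_real x \<in> N \<and> N \<subseteq> ball (of_real x) e \<and> connected (N \<inter> half_locus p q) \<and> N \<inter> half_locus p q \<noteq> {}"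
    if qx: "poly q x \<noteq> 0" and W: "poly (wronskian p q) x = 0" "\<not> [:- x, 1:] ^ 2 dvd wronskian p q" for p q :: "real poly"
  proof -
    define v where "v = poly p x / poly q x"
    define r where "r = p - smult v q"
    have Wr: "wronskian p q = wronskian r q"
      by (simp add: r_def wronskian_def pderiv_diff pderiv_smult algebra_simps)
    define L where "L = [:- x, 1:]"
    have L: "poly L x = 0" "pderiv L = 1" "\<not> L ^ 2 dvd wronskian p q"
      using W(2) by (simp_all add: L_def pderiv_pCons)
    have dvdL: "\<exists>b. a = L * b" if "poly a x = 0" for a
      using that by (metis L_def dvdE poly_eq_0_iff_dvd)
    have "poly r x = 0" using qx by (simp add: r_def v_def)
    then obtain r1 where r1: "r = L * r1" using dvdL by blast
    have "poly (pderiv r) x = 0"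
      using W(1) qx \<open>poly r x = 0\<close> unfolding Wr by (simp add: wronskian_def)
    then have "poly r1 x = 0" unfolding r1 by (simp add: pderiv_mult L)
    then obtain s where s: "r1 = L * s" using dvdL by blast
    \<comment> \<open>A triple zero of \<open>r\<close> at \<open>x\<close> would give a double zero
      of the Wronskian.\<close>
    have sx: "poly s x \<noteq> 0"
    proof
      assume "poly s x = 0"
      then obtain s' where "s = L * s'" using dvdL by blast
      then have r: "r = L ^ 3 * s'" using r1 s by (simp only: power3_eq_cube mult.assoc)
      have "pderiv (L ^ 3) = smult 3 (L ^ 2)"
        by (simp add: pderiv_power L)
      then have "pderiv r = L ^ 2 * (L * pderiv s' + smult 3 s')"
        unfolding r pderiv_mult by (simp add: algebra_simps power3_eq_cube power2_eq_square)
      then have "wronskian r q = L ^ 2 * ((L * pderiv s' + smult 3 s') * q - L * s' * pderiv q)"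
        unfolding wronskian_def by (subst (2) r) (simp add: algebra_simps power3_eq_cube power2_eq_square)
      then show False using L(3) Wr by (metis dvd_triv_left)
    qed
    \<comment> \<open>The sign makes \<open>l\<close> positive at \<open>x\<close>. Near
      \<open>x\<close> the values of \<open>l\<close> then avoid the branch cut of
      \<open>csqrt\<close>, whose principal value commutes with conjugation.\<close>
    define \<sigma> where "\<sigma> = sgn (poly s x / poly q x)"
    have \<sigma>: "\<sigma> * \<sigma> = 1" "\<sigma> * (poly s x / poly q x) > 0"
      using sx qx by (auto simp: \<sigma>_def sgn_real_def zero_less_divide_iff)
    define l where "l z = of_real \<sigma> * (poly (cpoly s) z / poly (cpoly q) z)" for z
    define S where "S = {z. poly (cpoly q) z \<noteq> 0} \<inter> l -` {w. Re w > 0}"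
    have holl: "l holomorphic_on {z. poly (cpoly q) z \<noteq> 0}"
      unfolding l_def by (intro holomorphic_intros) auto
    have "open {z. poly (cpoly q) z \<noteq> 0}" by (intro open_Collect_neq continuous_intros)
    then have "open S"
      unfolding S_def using holl open_halfspace_Re_gt[of 0]
      by (intro continuous_open_preimage holomorphic_on_imp_continuous_on) auto
    have lx: "l (of_real x) = of_real (\<sigma> * (poly s x / poly q x))"
      by (simp add: l_def poly_cpoly_of_real)
    have xS: "of_real x \<in> S"
      using qx \<sigma>(2) by (auto simp: S_def lx poly_cpoly_of_real simp del: of_real_mult of_real_divide)
    have S_cnj: "cnj z \<in> S" "l (cnj z) = cnj (l z)" if "z \<in> S" for z
    proof -
      show l: "l (cnj z) = cnj (l z)" by (simp add: l_def poly_cpoly_cnj)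
      show "cnj z \<in> S" using that l by (simp add: S_def poly_cpoly_cnj)
    qed
    define h where "h z = (z - of_real x) * csqrt (l z)" for z
    have slit: "l z \<notin> \<real>\<^sub>\<le>\<^sub>0" if "z \<in> S" for z
      using that by (auto simp: S_def complex_nonpos_Reals_iff)
    have hol_sqrt: "(\<lambda>z. csqrt (l z)) holomorphic_on S"
      using holl slit by (intro holomorphic_intros) (auto simp: S_def intro: holomorphic_on_subset)
    then have holh: "h holomorphic_on S"
      unfolding h_def by (intro holomorphic_on_mult[OF _ hol_sqrt] holomorphic_intros)
    have "deriv h (of_real x) \<noteq> 0"
    proof -
      have "((\<lambda>z. csqrt (l z)) has_field_derivative deriv (\<lambda>z. csqrt (l z)) (of_real x)) (at (of_real x))"
        using hol_sqrt \<open>open S\<close> xS holomorphic_derivI by blast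
      then have "(h has_field_derivative 1 * csqrt (l (of_real x)) + deriv (\<lambda>z. csqrt (l z)) (of_real x) * (of_real x - of_real x)) (at (of_real x))"
        unfolding h_def by (intro DERIV_mult) (auto intro!: derivative_eq_intros)
      then have "deriv h (of_real x) = csqrt (l (of_real x))" by (simp add: DERIV_imp_deriv)
      then show ?thesis using \<sigma> sx qx by (auto simp: lx)
    qed
    then obtain \<rho> where \<rho>: "\<rho> > 0" "ball (of_real x) \<rho> \<subseteq> S \<inter> ball (of_real x) e"
        "open (h ` ball (of_real x) \<rho>)" "inj_on h (ball (of_real x) \<rho>)"
      using has_complex_derivative_locally_invertible[of h "S \<inter> ball (of_real x) e" "of_real x"]
        holh \<open>open S\<close> xS \<open>e > 0\<close> holomorphic_on_subset[OF holh, of "S \<inter> ball (of_real x) e"] by auto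
    let ?B = "ball (complex_of_real x) \<rho>"
    have conth: "continuous_on ?B h"
      using holh holomorphic_on_imp_continuous_on \<rho>(2) by (meson continuous_on_subset le_inf_iff)
    obtain g where g: "homeomorphism ?B (h ` ?B) h g"
      using invariance_of_domain_homeomorphism[OF _ conth _ \<rho>(4)] by auto
    have h0: "h (of_real x) = 0" by (simp add: h_def)
    then obtain \<delta> where \<delta>: "\<delta> > 0" "ball 0 \<delta> \<subseteq> h ` ?B"
      using \<rho>(1,3) by (metis centre_in_ball imageI open_contains_ball)
    have gB: "g u \<in> ?B" "h (g u) = u" if "cmod u < \<delta>" for u
    proof -
      have "u \<in> h ` ?B" using \<delta>(2) that by auto
      then show "g u \<in> ?B" "h (g u) = u"
        using g unfolding homeomorphism_def by blast+
    qed
    have gh: "g (h z) = z" if "z \<in> ?B" for z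
      using g that unfolding homeomorphism_def by blast
    have csqrt_cnj: "csqrt (cnj w) = cnj (csqrt w)" if "w \<notin> \<real>\<^sub>\<le>\<^sub>0" for w
      using cnj_csqrt that by (auto simp: complex_nonpos_Reals_iff)
    have h_cnj: "cnj z \<in> ?B \<and> h (cnj z) = cnj (h z)" if "z \<in> ?B" for z
    proof -
      have z: "z \<in> S" using that \<rho>(2) by blast
      have "cnj (z - of_real x) = cnj z - of_real x" by simp
      then have "dist (of_real x) (cnj z) = dist (of_real x) z"
        by (metis complex_mod_cnj dist_commute dist_norm)
      then show ?thesis
        using that S_cnj[OF z] csqrt_cnj[OF slit[OF z]] by (simp add: h_def)
    qed
    have real_iff: "Im (h z) = 0 \<longleftrightarrow> Im z = 0" if "z \<in> ?B" for z
    proof -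
      have "Im (h z) = 0 \<longleftrightarrow> h (cnj z) = h z" using h_cnj[OF that] by (auto simp: complex_eq_iff)
      also have "\<dots> \<longleftrightarrow> cnj z = z" using \<rho>(4) h_cnj[OF that] that by (auto simp: inj_on_def)
      finally show ?thesis by (auto simp: complex_eq_iff)
    qed
    have g_cnj: "g (cnj u) = cnj (g u)" if "cmod u < \<delta>" for u
      using h_cnj[OF gB(1)[OF that]] gB[OF that] gh by metis
    have locus_iff: "Im (poly (cpoly p) z * cnj (poly (cpoly q) z)) = 0 \<longleftrightarrow> Re (h z) = 0 \<or> Im (h z) = 0"
      if "z \<in> ?B" for z
    proof -
      have z: "poly (cpoly q) z \<noteq> 0" using that \<rho>(2) by (auto simp: S_def)
      have p: "p = smult v q + L * (L * s)"
        using r1 s by (simp add: r_def algebra_simps)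
      have "poly (cpoly L) z = z - of_real x" by (simp add: L_def map_poly_pCons)
      moreover have "cpoly (smult v q) = smult (of_real v) (cpoly q)"
        by (auto simp: poly_eq_iff coeff_map_poly)
      ultimately have "poly (cpoly p) z = of_real v * poly (cpoly q) z + (z - of_real x)\<^sup>2 * poly (cpoly s) z"
        by (subst p) (simp add: cpoly_add cpoly_mult power2_eq_square mult.assoc)
      moreover have "(z - of_real x)\<^sup>2 * poly (cpoly s) z = of_real \<sigma> * (h z)\<^sup>2 * poly (cpoly q) z"
      proof -
        have "(of_real \<sigma> :: complex) * of_real \<sigma> = 1" using \<sigma>(1) by (metis of_real_1 of_real_mult)
        then show ?thesis using z
          by (simp add: h_def power_mult_distrib l_def)
      qed
      ultimately have "poly (cpoly p) z * cnj (poly (cpoly q) z)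
          = (of_real v + of_real \<sigma> * (h z)\<^sup>2) * (poly (cpoly q) z * cnj (poly (cpoly q) z))"
        by (simp add: algebra_simps)
      also have "\<dots> = (of_real v + of_real \<sigma> * (h z)\<^sup>2) * of_real ((cmod (poly (cpoly q) z))\<^sup>2)"
        by (simp only: complex_norm_square)
      finally have "Im (poly (cpoly p) z * cnj (poly (cpoly q) z)) = \<sigma> * (2 * Re (h z) * Im (h z)) * (cmod (poly (cpoly q) z))\<^sup>2"
        by (simp add: power2_eq_square flip: of_real_power of_real_mult)
      moreover have "\<sigma> \<noteq> 0" using \<sigma>(1) by auto
      ultimately show ?thesis using z by auto
    qed
    define N where "N = ?B \<inter> h -` ball 0 \<delta>"
    define a where "a t = Im (g (\<i> * of_real t))" for t
    have small: "cmod (\<i> * of_real t) < \<delta>" if "\<bar>t\<bar> < \<delta>" for t :: real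
      using that by (simp add: norm_mult)
    have contg: "continuous_on {t. \<bar>t\<bar> < \<delta>} (\<lambda>t. g (\<i> * of_real t))"
    proof (rule continuous_on_compose2[of "h ` ?B" g])
      show "continuous_on (h ` ?B) g" using g unfolding homeomorphism_def by blast
    qed (use \<delta>(2) small in \<open>auto intro!: continuous_intros\<close>)
    have a0: "t = 0" if "\<bar>t\<bar> < \<delta>" "a t = 0" for t
      using real_iff[OF gB(1)[OF small[OF that(1)]]] gB(2)[OF small[OF that(1)]] that(2) by (simp add: a_def)
    have a_odd: "a (- t) = - a t" if "\<bar>t\<bar> < \<delta>" for t
      using g_cnj[OF small[OF that]] by (simp add: a_def)
    have a_zero: "a 0 = 0" using a_odd[of 0] \<delta>(1) by simp
    define T where "T = {t. \<bar>t\<bar> < \<delta> \<and> a t > 0}"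
    have N_locus: "N \<inter> half_locus p q = (\<lambda>t. g (\<i> * of_real t)) ` T"
    proof (intro equalityI subsetI)
      fix z assume z: "z \<in> N \<inter> half_locus p q"
      then have zB: "z \<in> ?B" "cmod (h z) < \<delta>" "Im z > 0" by (auto simp: N_def half_locus_def)
      then have "Re (h z) = 0" using locus_iff[OF zB(1)] real_iff[OF zB(1)] z by (auto simp: half_locus_def)
      then have hz: "h z = \<i> * of_real (Im (h z))" by (simp add: complex_eq_iff)
      have "z = g (\<i> * of_real (Im (h z)))" using gh[OF zB(1)] hz by simp
      moreover have "\<bar>Im (h z)\<bar> < \<delta>" using zB(2) abs_Im_le_cmod[of "h z"] by linarith
      ultimately show "z \<in> (\<lambda>t. g (\<i> * of_real t)) ` T"
        using zB(3) by (intro image_eqI[of _ _ "Im (h z)"]) (auto simp: T_def a_def)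
    next
      fix z assume "z \<in> (\<lambda>t. g (\<i> * of_real t)) ` T"
      then obtain t where t: "\<bar>t\<bar> < \<delta>" "Im z > 0" "z = g (\<i> * of_real t)" by (auto simp: T_def a_def)
      note gt = gB[OF small[OF t(1)]]
      show "z \<in> N \<inter> half_locus p q"
        using t gt small[OF t(1)] locus_iff[OF gt(1)] by (auto simp: N_def half_locus_def)
    qed
    \<comment> \<open>The function \<open>a\<close>, the height of the local inverse along the
      imaginary axis, is odd and vanishes only at 0. So it is positive on exactly one side.\<close>
    have "T = {0<..<\<delta>} \<or> T = {-\<delta><..<0}"
    proof -
      have "connected (a ` {0<..<\<delta>})"
        unfolding a_def by (intro connected_continuous_image continuous_on_Im continuous_on_subset[OF contg]) auto
      moreover have "0 \<notin> a ` {0<..<\<delta>}" using a0 by force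
      ultimately have "(\<forall>t\<in>{0<..<\<delta>}. a t > 0) \<or> (\<forall>t\<in>{0<..<\<delta>}. a t < 0)"
        unfolding connected_iff_interval by (smt (verit) imageI image_iff linorder_less_linear less_eq_real_def)
      then show ?thesis
      proof
        assume *: "\<forall>t\<in>{0<..<\<delta>}. a t > 0"
        have "t \<in> T \<longleftrightarrow> t \<in> {0<..<\<delta>}" for t
          using * a_zero a_odd[of t] bspec[OF *, of "- t"] bspec[OF *, of t] by (cases t "0::real" rule: linorder_cases) (auto simp: T_def)
        then show ?thesis by blast
      next
        assume *: "\<forall>t\<in>{0<..<\<delta>}. a t < 0"
        have "t \<in> T \<longleftrightarrow> t \<in> {-\<delta><..<0}" for t
        proof -
          have "a t < 0" if "0 < t" "t < \<delta>" using * that by auto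
          moreover have "a t > 0" if "- \<delta> < t" "t < 0"
            using bspec[OF *, of "- t"] a_odd[of t] that by auto
          ultimately show ?thesis
            using a_zero by (cases t "0::real" rule: linorder_cases) (auto simp: T_def)
        qed
        then show ?thesis by blast
      qed
    qed
    then have T: "connected T" "T \<noteq> {}" using \<delta>(1) by (auto simp: connected_Ioo)
    have "open N" unfolding N_def using conth by (intro continuous_open_preimage) auto
    moreover have "of_real x \<in> N" using \<rho>(1) \<delta>(1) h0 by (simp add: N_def)
    moreover have "N \<subseteq> ball (of_real x) e" using \<rho>(2) by (auto simp: N_def)
    moreover have "connected (N \<inter> half_locus p q)"
      unfolding N_locus by (intro connected_continuous_image T continuous_on_subset[OF contg]) (auto simp: T_def)
    moreover have "N \<inter> half_locus p q \<noteq> {}"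
      unfolding N_locus using T(2) by blast
    ultimately show ?thesis by blast
  qed
  show ?thesis
  proof (cases "poly q x = 0")
    case True
    then have "poly p x \<noteq> 0" using cop coprime_poly_0 by blast
    moreover have "poly (wronskian q p) x = 0" "\<not> [:- x, 1:] ^ 2 dvd wronskian q p"
      using W by (subst wronskian_swap, simp)+
    ultimately show ?thesis using main[of p q] main[of q p] by (metis half_locus_swap)
  qed (use main W in blast)
qed

section \<open>From the half-plane to a disc\<close>

text \<open>Reversal is the substitution of \<open>1 / z\<close> in forms of degree
  \<open>d\<close>. The terms that come from differentiating \<open>z ^ d\<close> cancel by
  antisymmetry, and the derivative of \<open>1 / z\<close> contributes the sign and the factor
  \<open>z^2\<close>.\<close>

lemma wronskian_reverse_poly_eval:
  fixes A B :: "complex poly"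
  assumes "degree A \<le> d" "degree B \<le> d" "z \<noteq> 0"
  shows "z\<^sup>2 * poly (wronskian (reverse_poly d A) (reverse_poly d B)) z
    = - (z ^ (2 * d) * poly (wronskian A B) (1 / z))"
proof -
  have D: "poly (pderiv (reverse_poly d F)) z
      = of_nat d * z ^ (d - 1) * poly F (1 / z) - z ^ d * poly (pderiv F) (1 / z) / z\<^sup>2" if "degree F \<le> d" for F
  proof -
    have "((\<lambda>z. z ^ d * poly F (1 / z)) has_field_derivative
        of_nat d * z ^ (d - 1) * poly F (1 / z) - z ^ d * poly (pderiv F) (1 / z) / z\<^sup>2) (at z)"
      using \<open>z \<noteq> 0\<close> by (auto intro!: derivative_eq_intros DERIV_chain2[OF poly_DERIV] simp: power2_eq_square)
    then have "(poly (reverse_poly d F) has_field_derivative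
        of_nat d * z ^ (d - 1) * poly F (1 / z) - z ^ d * poly (pderiv F) (1 / z) / z\<^sup>2) (at z)"
      by (rule has_field_derivative_transform_within_open[of _ _ _ "- {0}"]) (use poly_reverse_poly[OF that] \<open>z \<noteq> 0\<close> in auto)
    then show ?thesis using poly_DERIV DERIV_unique by blast
  qed
  define s where "s = z ^ d"
  have "z ^ (2 * d) = s\<^sup>2" by (simp add: s_def power_mult mult.commute flip: power_mult)
  then show ?thesis
    using \<open>z \<noteq> 0\<close>
    by (simp add: wronskian_def D assms poly_reverse_poly flip: s_def)
      (use \<open>z \<noteq> 0\<close> in \<open>simp add: field_simps power2_eq_square\<close>)
qed

text \<open>Comparison at 0 improves the evident degree bound \<open>2 d - 1\<close> by one:
  otherwise the leading coefficient of the Wronskian would equal the value at 0 of a multiple of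
  \<open>z\<close>. If the bound is attained, the reversed Wronskian does not vanish at 0, so
  infinity is not critical.\<close>

lemma wronskian_reverse_poly:
  fixes A B :: "complex poly"
  assumes "degree A \<le> d" "degree B \<le> d" "d \<ge> 1" "wronskian A B \<noteq> 0"
  shows "degree (wronskian A B) + 2 \<le> 2 * d"
    and "degree (wronskian A B) + 2 = 2 * d \<Longrightarrow>
      wronskian (reverse_poly d A) (reverse_poly d B) = - reflect_poly (wronskian A B)"
proof -
  define S R e where "S = wronskian A B" and "R = wronskian (reverse_poly d A) (reverse_poly d B)" and "e = degree S"
  have "poly (monom 1 (e + 2) * R) z = poly (monom 1 (2 * d) * (- reflect_poly S)) z" for z
  proof (cases "z = 0")
    case True
    then show ?thesis using \<open>d \<ge> 1\<close> by (simp add: poly_monom)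
  next
    case False
    have "poly (monom 1 (e + 2) * R) z = z ^ e * (z\<^sup>2 * poly R z)"
      by (simp add: poly_monom power_add power2_eq_square)
    also have "\<dots> = - (z ^ e * (z ^ (2 * d) * poly S (1 / z)))"
      using wronskian_reverse_poly_eval[OF assms(1,2) False] by (simp add: R_def S_def)
    finally show ?thesis
      using False by (simp add: poly_monom poly_reflect_poly_nz e_def inverse_eq_divide)
  qed
  then have eq: "monom 1 (e + 2) * R = monom 1 (2 * d) * (- reflect_poly S)"
    using poly_eq_poly_eq_iff by blast
  show "degree (wronskian A B) + 2 \<le> 2 * d"
  proof (rule ccontr)
    assume "\<not> ?thesis"
    then obtain k where k: "e + 2 = 2 * d + k" "k > 0"
      by (metis e_def S_def less_imp_add_positive not_le)
    have "monom 1 (2 * d) * (monom 1 k * R) = monom 1 (2 * d) * (- reflect_poly S)"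
      using eq unfolding k(1) by (simp add: mult_monom flip: mult.assoc)
    moreover have "monom (1::complex) (2 * d) \<noteq> 0" by (simp add: monom_eq_0_iff)
    ultimately have "monom 1 k * R = - reflect_poly S" using mult_left_cancel by blast
    then have "poly (monom 1 k * R) 0 = poly (- reflect_poly S) 0" by simp
    then show False using k(2) assms(4) by (simp add: poly_monom S_def zero_power)
  qed
  show "wronskian (reverse_poly d A) (reverse_poly d B) = - reflect_poly (wronskian A B)"
    if "degree (wronskian A B) + 2 = 2 * d"
  proof -
    have "monom 1 (2 * d) * R = monom 1 (2 * d) * (- reflect_poly S)"
      using eq that by (simp only: e_def S_def)
    moreover have "monom (1::complex) (2 * d) \<noteq> 0" by (simp add: monom_eq_0_iff)
    ultimately show ?thesis unfolding S_def R_def using mult_left_cancel by blast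
  qed
qed

lemma wronskian_pcompose_shift:
  "wronskian (pcompose A [:c, 1:]) (pcompose B [:c, 1:]) = pcompose (wronskian A B) [:c, 1:]"
  by (simp add: wronskian_def pcompose_diff pcompose_mult pderiv_pcompose pderiv_pCons)

lemma norm_diff_eq_norm_add_iff: "cmod (a - \<i> * b) = cmod (a + \<i> * b) \<longleftrightarrow> Im (a * cnj b) = 0"
proof -
  have "cmod (a - \<i> * b) = cmod (a + \<i> * b) \<longleftrightarrow> (cmod (a - \<i> * b))\<^sup>2 = (cmod (a + \<i> * b))\<^sup>2"
    by (simp add: power2_eq_iff_nonneg)
  also have "\<dots> \<longleftrightarrow> Im (a * cnj b) = 0"
    unfolding cmod_power2 by (auto simp: power2_eq_square algebra_simps)
  finally show ?thesis .
qed

text \<open>The half-plane is mapped onto a disc by \<open>z \<mapsto> 1 / (z + \<i>)\<close>; infinity becomes the boundary point \<open>0\<close>.\<close>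

definition disc :: "complex set" where
  "disc = ball (- \<i> / 2) (1 / 2)"

definition to_disc :: "complex \<Rightarrow> complex" where
  "to_disc z = 1 / (z + \<i>)"

definition from_disc :: "complex \<Rightarrow> complex" where
  "from_disc w = 1 / w - \<i>"

lemma from_to_disc [simp]: "from_disc (to_disc z) = z"
  by (simp add: from_disc_def to_disc_def)

lemma to_from_disc [simp]: "to_disc (from_disc w) = w"
  by (simp add: from_disc_def to_disc_def)

lemma to_disc_nonzero: "Im z \<ge> 0 \<Longrightarrow> to_disc z \<noteq> 0"
proof -
  assume "Im z \<ge> 0"
  then have "z + \<i> \<noteq> 0" by (auto simp: complex_eq_iff)
  then show ?thesis by (simp add: to_disc_def)
qed

lemma disc_iff: "w \<in> disc \<longleftrightarrow> (Re w)\<^sup>2 + (Im w)\<^sup>2 + Im w < 0"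
  and circle_iff: "w \<in> frontier disc \<longleftrightarrow> (Re w)\<^sup>2 + (Im w)\<^sup>2 + Im w = 0"
proof -
  have d: "(dist (- \<i> / 2) w)\<^sup>2 = (Re w)\<^sup>2 + (Im w)\<^sup>2 + Im w + (1/2)\<^sup>2"
    unfolding dist_norm cmod_power2 by (simp add: power2_eq_square algebra_simps)
  have "w \<in> disc \<longleftrightarrow> (dist (- \<i> / 2) w)\<^sup>2 < (1/2)\<^sup>2"
    unfolding disc_def mem_ball by (meson abs_le_square_iff abs_of_nonneg not_le power_mono zero_le_dist zero_le_divide_1_iff zero_le_numeral power_less_imp_less_base power_strict_mono pos2)
  then show "w \<in> disc \<longleftrightarrow> (Re w)\<^sup>2 + (Im w)\<^sup>2 + Im w < 0" unfolding d by simp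
  have "w \<in> frontier disc \<longleftrightarrow> (dist (- \<i> / 2) w)\<^sup>2 = (1/2)\<^sup>2"
    by (simp add: disc_def frontier_ball power2_eq_iff_nonneg)
  then show "w \<in> frontier disc \<longleftrightarrow> (Re w)\<^sup>2 + (Im w)\<^sup>2 + Im w = 0" unfolding d by simp
qed

lemma Im_from_disc: "Im (from_disc w) = - ((Re w)\<^sup>2 + (Im w)\<^sup>2 + Im w) / (cmod w)\<^sup>2" if "w \<noteq> 0"
proof -
  have "(Re w)\<^sup>2 + (Im w)\<^sup>2 \<noteq> 0" using that by (simp add: complex_neq_0 sum_power2_gt_zero_iff complex_eq_iff)
  then show ?thesis
    by (simp add: from_disc_def Im_divide cmod_power2 field_simps)
qed

lemma disc_iff_Im: "w \<in> disc \<longleftrightarrow> w \<noteq> 0 \<and> Im (from_disc w) > 0"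
  by (cases "w = 0") (auto simp: Im_from_disc disc_iff divide_less_0_iff zero_less_divide_iff)

lemma circle_iff_Im: "w \<in> frontier disc \<longleftrightarrow> w = 0 \<or> Im (from_disc w) = 0"
  by (cases "w = 0") (auto simp: Im_from_disc circle_iff)

lemma to_disc_in_disc: "to_disc z \<in> disc" if "Im z > 0"
  using that to_disc_nonzero[of z] by (simp add: disc_iff_Im)

text \<open>Reflection in the boundary circle, that is, complex conjugation in the half-plane.\<close>

definition disc_reflection :: "complex \<Rightarrow> complex" where
  "disc_reflection w = cnj w / (1 + 2 * \<i> * cnj w)"

lemma disc_reflection_fixes:
  assumes "w \<in> frontier disc"
  shows "disc_reflection w = w" "1 + 2 * \<i> * cnj w \<noteq> 0"
proof -
  have w: "(Re w)\<^sup>2 + (Im w)\<^sup>2 + Im w = 0" using assms by (simp add: circle_iff)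
  show nz: "1 + 2 * \<i> * cnj w \<noteq> 0"
  proof
    assume "1 + 2 * \<i> * cnj w = 0"
    then have "Re w = 0" "Im w = - 1 / 2" by (auto simp: complex_eq_iff)
    then show False using w by (simp add: power2_eq_square)
  qed
  \<comment> \<open>The equation of the circle in complex form: both say that the squared modulus of
    \<open>w\<close> plus its imaginary part is 0.\<close>
  have "cnj w = w * (1 + 2 * \<i> * cnj w)"
    using w by (simp add: complex_eq_iff power2_eq_square algebra_simps)
  then show "disc_reflection w = w" using nz by (simp add: disc_reflection_def divide_eq_eq)
qed

lemma disc_reflection_to_disc: "disc_reflection (to_disc z) = to_disc (cnj z)" if "Im z > 0"
proof -
  have "cnj z - \<i> \<noteq> 0" "z + \<i> \<noteq> 0" using that by (auto simp: complex_eq_iff)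
  then show ?thesis
    by (simp add: disc_reflection_def to_disc_def divide_simps) (auto simp: add.commute)
qed

section \<open>Rational functions with real critical points, read in the disc\<close>

locale simple_critical_points =
  fixes p q :: "real poly" and n :: nat and X :: "real set"
  assumes n_pos: "n \<ge> 1" and coprime: "coprime p q" and degree: "max (degree p) (degree q) = Suc n"
    and finite_X: "finite X" and card_X: "card X = 2 * n"
    and critical: "x \<in> X \<Longrightarrow> poly (wronskian p q) x = 0"
begin

abbreviation W :: "real poly" where "W \<equiv> wronskian p q"

definition U :: "complex poly" where "U = cpoly p - smult \<i> (cpoly q)"
definition V :: "complex poly" where "V = cpoly p + smult \<i> (cpoly q)"

text \<open>Shifting and then reversing amounts to substituting
  \<open>from_disc w = 1 / w - \<i>\<close> and multiplying by \<open>w ^ Suc n\<close>; the value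
  at \<open>w = 0\<close> represents infinity.\<close>

definition shift :: "complex poly \<Rightarrow> complex poly" where "shift f = pcompose f [:- \<i>, 1:]"

definition PD :: "complex poly" where "PD = reverse_poly (Suc n) (shift U)"
definition QD :: "complex poly" where "QD = reverse_poly (Suc n) (shift V)"

lemma W_nonzero: "W \<noteq> 0"
  using wronskian_eq_0_imp_const[OF coprime] degree n_pos by auto

lemma degree_shift: "degree (shift f) = degree f"
  by (simp add: shift_def degree_pcompose)

lemma poly_shift: "poly (shift f) z = poly f (z - \<i>)"
  by (simp add: shift_def poly_pcompose)

lemma degree_UV: "degree U \<le> Suc n" "degree V \<le> Suc n"
proof -
  have "degree (cpoly p) \<le> Suc n" "degree (smult \<i> (cpoly q)) \<le> Suc n"
    using degree by (auto simp: degree_map_poly)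
  then show "degree U \<le> Suc n" "degree V \<le> Suc n"
    by (auto simp: U_def V_def intro: degree_diff_le degree_add_le)
qed

lemma poly_U: "poly U z = poly (cpoly p) z - \<i> * poly (cpoly q) z"
  and poly_V: "poly V z = poly (cpoly p) z + \<i> * poly (cpoly q) z"
  by (simp_all add: U_def V_def)

lemma poly_U_cnj: "poly U (cnj z) = cnj (poly V z)" and poly_V_cnj: "poly V (cnj z) = cnj (poly U z)"
  by (simp_all add: poly_U poly_V poly_cpoly_cnj)

lemma poly_PD: "w \<noteq> 0 \<Longrightarrow> poly PD w = w ^ Suc n * poly U (from_disc w)"
  and poly_QD: "w \<noteq> 0 \<Longrightarrow> poly QD w = w ^ Suc n * poly V (from_disc w)"
  unfolding PD_def QD_def using degree_UV
  by (simp_all add: poly_reverse_poly degree_shift poly_shift from_disc_def del: power_Suc)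

lemma wronskian_UV: "wronskian U V = smult (2 * \<i>) (cpoly W)"
proof -
  have "wronskian U V = smult \<i> (wronskian (cpoly p) (cpoly q)) + smult \<i> (wronskian (cpoly p) (cpoly q))"
    by (simp add: wronskian_def U_def V_def pderiv_diff pderiv_add pderiv_smult algebra_simps smult_add_right smult_diff_right)
  then show ?thesis by (simp add: cpoly_wronskian flip: smult_add_left)
qed

lemma wronskian_shift: "wronskian (shift U) (shift V) = shift (smult (2 * \<i>) (cpoly W))"
  unfolding shift_def wronskian_pcompose_shift wronskian_UV ..

lemma degree_wronskian_shift: "degree (wronskian (shift U) (shift V)) = degree W"
  unfolding wronskian_shift degree_shift by (simp add: degree_map_poly)

lemma wronskian_shift_nonzero: "wronskian (shift U) (shift V) \<noteq> 0"
proof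
  assume "wronskian (shift U) (shift V) = 0"
  then have "poly (shift (smult (2 * \<i>) (cpoly W))) (of_real x + \<i>) = 0" for x
    by (simp add: wronskian_shift)
  then have "poly W x = 0" for x by (simp add: poly_shift poly_cpoly_of_real)
  then show False using W_nonzero poly_all_0_iff_0[of W] by blast
qed

lemma degree_W: "degree W = 2 * n"
proof (rule antisym)
  have "degree W + 2 \<le> 2 * Suc n"
    using wronskian_reverse_poly(1)[of "shift U" "Suc n" "shift V"] degree_UV wronskian_shift_nonzero
    by (simp add: degree_shift degree_wronskian_shift)
  then show "degree W \<le> 2 * n" by simp
  have "X \<subseteq> {x. poly W x = 0}" using critical by auto
  then have "card X \<le> degree W"
    using poly_roots_finite[OF W_nonzero] card_poly_roots_bound[OF W_nonzero] by (meson card_mono le_trans)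
  then show "2 * n \<le> degree W" using card_X by simp
qed

lemma wronskian_D: "wronskian PD QD = - reflect_poly (shift (smult (2 * \<i>) (cpoly W)))"
proof -
  have "degree (wronskian (shift U) (shift V)) + 2 = 2 * Suc n"
    using degree_wronskian_shift degree_W by simp
  then show ?thesis
    using wronskian_reverse_poly(2)[OF _ _ _ wronskian_shift_nonzero, of "Suc n"] degree_UV
    unfolding PD_def QD_def wronskian_shift degree_shift by simp
qed

lemma root_W_iff: "poly (cpoly W) z = 0 \<longleftrightarrow> z \<in> of_real ` X"
proof
  show "z \<in> of_real ` X \<Longrightarrow> poly (cpoly W) z = 0"
    using critical by (auto simp: poly_cpoly_of_real)
  assume z: "poly (cpoly W) z = 0"
  show "z \<in> of_real ` X"
  proof (rule ccontr)
    assume "z \<notin> of_real ` X"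
    have nz: "cpoly W \<noteq> 0" using W_nonzero by (simp add: map_poly_eq_0_iff)
    have "insert z (of_real ` X) \<subseteq> {z. poly (cpoly W) z = 0}"
      using z critical by (auto simp: poly_cpoly_of_real)
    then have "card (insert z (of_real ` X)) \<le> degree (cpoly W)"
      using poly_roots_finite[OF nz] card_poly_roots_bound[OF nz] by (meson card_mono le_trans)
    then show False
      using \<open>z \<notin> of_real ` X\<close> finite_X card_X degree_W
      by (simp add: degree_map_poly card_image inj_on_def)
  qed
qed

lemma simple_root: "\<not> [:- x, 1:] ^ 2 dvd W"
proof
  assume "[:- x, 1:] ^ 2 dvd W"
  then obtain c where c: "W = [:- x, 1:] * ([:- x, 1:] * c)" by (metis dvdE power2_eq_square mult.assoc)
  let ?V = "[:- x, 1:] * c"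
  have nz: "?V \<noteq> 0" using W_nonzero c by auto
  have "X \<subseteq> {y. poly ?V y = 0}" using critical c by auto
  then have "card X \<le> degree ?V"
    using poly_roots_finite[OF nz] card_poly_roots_bound[OF nz] by (meson card_mono le_trans)
  moreover have "degree W = Suc (degree ?V)"
    using nz by (subst c, subst degree_mult_eq) auto
  ultimately show False using card_X degree_W by simp
qed

text \<open>Away from 0 the roots correspond to those of \<open>W\<close>. At 0 the value is, up to
  sign, the leading coefficient of the shifted Wronskian, which is nonzero.\<close>

lemma wronskian_D_nonzero: "poly (wronskian PD QD) w \<noteq> 0" if "w \<notin> to_disc ` of_real ` X"
proof (cases "w = 0")
  case True
  have "shift (smult (2 * \<i>) (cpoly W)) \<noteq> 0" using wronskian_shift_nonzero wronskian_shift by simp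
  then show ?thesis using True by (simp add: wronskian_D)
next
  case False
  have "from_disc w \<notin> of_real ` X" using that to_from_disc by (metis image_eqI)
  then show ?thesis
    using False by (simp add: wronskian_D poly_reflect_poly_nz poly_shift root_W_iff[symmetric] from_disc_def inverse_eq_divide)
qed

lemma norm_UV_iff: "cmod (poly U z) = cmod (poly V z) \<longleftrightarrow> Im (poly (cpoly p) z * cnj (poly (cpoly q) z)) = 0"
  by (simp add: poly_U poly_V norm_diff_eq_norm_add_iff)

text \<open>The values at 0 are \<open>a - \<i> b\<close> and \<open>a + \<i> b\<close> with the
  coefficients \<open>a\<close>, \<open>b\<close> of \<open>p\<close>, \<open>q\<close> in degree
  \<open>n + 1\<close>, which do not both vanish.\<close>

lemma coeff_top: "poly PD 0 \<noteq> 0" "cmod (poly PD 0) = cmod (poly QD 0)"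
proof -
  have top: "coeff (shift f) (Suc n) = coeff f (Suc n)" if "degree f \<le> Suc n" for f
  proof (cases "degree f = Suc n")
    case True
    have "lead_coeff (shift f) = lead_coeff f" unfolding shift_def by (subst lead_coeff_comp) auto
    then show ?thesis by (simp add: degree_shift True)
  next
    case False
    then show ?thesis using that by (simp add: coeff_eq_0 degree_shift)
  qed
  define a b where "a = coeff p (Suc n)" and "b = coeff q (Suc n)"
  have P: "poly PD 0 = of_real a - \<i> * of_real b" and Q: "poly QD 0 = of_real a + \<i> * of_real b"
    using degree_UV by (simp_all add: PD_def QD_def poly_reverse_poly_0 degree_shift top)
      (simp_all add: U_def V_def a_def b_def coeff_map_poly)
  have "a \<noteq> 0 \<or> b \<noteq> 0"
    using degree unfolding a_def b_def
    by (metis degree_0 leading_coeff_0_iff max_def nat.distinct(1))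
  then show "poly PD 0 \<noteq> 0" unfolding P by (auto simp: complex_eq_iff)
  show "cmod (poly PD 0) = cmod (poly QD 0)" unfolding P Q norm_diff_eq_norm_add_iff by simp
qed

sublocale unimodular_quotient disc "poly PD" "poly QD"
proof
  show "open disc" "bounded disc" by (simp_all add: disc_def)
  show "poly PD holomorphic_on UNIV" "poly QD holomorphic_on UNIV" by (intro holomorphic_intros)+
  show "poly PD w \<noteq> 0 \<or> poly QD w \<noteq> 0" for w
  proof (cases "w = 0")
    case False
    have "poly (cpoly p) (from_disc w) \<noteq> 0 \<or> poly (cpoly q) (from_disc w) \<noteq> 0"
      by (rule coprime_cpoly_no_common_root[OF coprime])
    then have "poly U (from_disc w) \<noteq> 0 \<or> poly V (from_disc w) \<noteq> 0"
      by (auto simp: poly_U poly_V)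
    then show ?thesis using False by (simp add: poly_PD poly_QD)
  qed (use coeff_top in simp)
  show "cmod (poly PD w) = cmod (poly QD w)" if "w \<in> frontier disc" for w
  proof (cases "w = 0")
    case False
    then have "Im (from_disc w) = 0" using that circle_iff_Im by blast
    then have "cnj (from_disc w) = from_disc w" by (simp add: complex_eq_iff)
    then have "cmod (poly U (from_disc w)) = cmod (poly V (from_disc w))"
      using poly_U_cnj[of "from_disc w"] by (metis complex_mod_cnj)
    then show ?thesis using False by (simp add: poly_PD poly_QD norm_mult)
  qed (use coeff_top in simp)
  show "deriv (poly PD) w * poly QD w - poly PD w * deriv (poly QD) w \<noteq> 0" if "w \<in> disc" for w
  proof -
    have "w \<notin> to_disc ` of_real ` X"
      using that by (auto simp: disc_iff_Im)
    then show ?thesis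
      using wronskian_D_nonzero[of w] by (simp add: wronskian_def DERIV_imp_deriv[OF poly_DERIV])
  qed
qed

lemma locus_iff: "w \<in> locus \<longleftrightarrow> w \<noteq> 0 \<and> from_disc w \<in> half_locus p q"
  by (cases "w = 0") (auto simp: locus_def half_locus_def disc_iff_Im poly_PD poly_QD norm_mult norm_UV_iff)

lemma locus_image: "locus = to_disc ` half_locus p q"
proof (intro equalityI subsetI)
  fix w assume "w \<in> locus"
  then show "w \<in> to_disc ` half_locus p q" using locus_iff to_from_disc by (metis image_eqI)
next
  fix w assume "w \<in> to_disc ` half_locus p q"
  then show "w \<in> locus" using to_disc_nonzero by (auto simp: locus_iff half_locus_def)
qed

text \<open>A point of the locus and its reflection have the same value under the quotient. If the
  locus accumulated at \<open>w\<close>, both would be arbitrarily close to \<open>w\<close>,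
  against local injectivity at a point that is not critical.\<close>

lemma closure_locus_frontier:
  assumes w: "w \<in> frontier disc" "w \<notin> to_disc ` of_real ` X"
  shows "w \<notin> closure locus"
proof -
  obtain e where e: "e > 0"
    "\<And>z z'. z \<in> ball w e \<Longrightarrow> z' \<in> ball w e \<Longrightarrow> poly PD z * poly QD z' = poly PD z' * poly QD z \<Longrightarrow> z = z'"
    using projectively_injective_near[OF wronskian_D_nonzero[OF w(2)]] by blast
  define O' where "O' = {z. 1 + 2 * \<i> * cnj z \<noteq> 0}"
  have "open O'" unfolding O'_def by (intro open_Collect_neq continuous_intros)
  moreover have "continuous_on O' disc_reflection"
    unfolding disc_reflection_def O'_def by (intro continuous_intros) auto
  ultimately have "open (O' \<inter> disc_reflection -` ball w e)"
    using continuous_open_preimage open_ball by blast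
  then have op: "open (ball w e \<inter> (O' \<inter> disc_reflection -` ball w e))" by blast
  have "w \<in> ball w e \<inter> (O' \<inter> disc_reflection -` ball w e)"
    using disc_reflection_fixes[OF w(1)] e(1) by (auto simp: O'_def)
  moreover have "ball w e \<inter> (O' \<inter> disc_reflection -` ball w e) \<inter> locus = {}"
  proof (rule ccontr)
    assume "ball w e \<inter> (O' \<inter> disc_reflection -` ball w e) \<inter> locus \<noteq> {}"
    then obtain u where u: "u \<in> ball w e" "disc_reflection u \<in> ball w e" "u \<in> locus" "u \<in> O'" by blast
    then obtain z where z: "z \<in> half_locus p q" "u = to_disc z" using locus_image by blast
    have Im: "Im z > 0" using z(1) by (simp add: half_locus_def)
    define u' where "u' = to_disc (cnj z)"
    have r: "disc_reflection u = u'" using disc_reflection_to_disc[OF Im] z(2) by (simp add: u'_def)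
    have "u \<noteq> 0" using u(3) locus_iff by blast
    show False
    proof (cases "u' = 0")
      \<comment> \<open>This happens only for \<open>z = \<i>\<close>, the centre of the disc, whose
        reflection is at infinity; division by zero then returns 0. The set \<open>O'\<close>
        excludes this point.\<close>
      case True
      then have "cnj u / (1 + 2 * \<i> * cnj u) = 0" using r by (simp add: disc_reflection_def)
      then have "1 + 2 * \<i> * cnj u = 0" using \<open>u \<noteq> 0\<close> by simp
      then show False using u(4) by (simp add: O'_def)
    next
      case False
      have UV: "poly U z * cnj (poly U z) = cnj (poly V z) * poly V z"
        using z(1) norm_UV_iff[of z] by (simp add: half_locus_def complex_norm_square[symmetric] mult.commute)
      have "poly PD u * poly QD u' = poly PD u' * poly QD u"
        using \<open>u \<noteq> 0\<close> False UV by (simp add: poly_PD poly_QD z(2) u'_def poly_U_cnj poly_V_cnj)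
      then have "u = u'" using e(2)[OF u(1)] u(2) r by simp
      then have "z = cnj z" using z(2) u'_def from_to_disc by metis
      then show False using Im by (simp add: complex_eq_iff)
    qed
  qed
  ultimately show ?thesis
    using op closure_iff_nhds_not_empty[of w locus] by (metis Int_commute subset_refl)
qed

lemma branch:
  assumes "w \<in> to_disc ` of_real ` X" "e > 0"
  shows "\<exists>N. open N \<and> w \<in> N \<and> N \<subseteq> ball w e \<and> connected (N \<inter> locus)"
proof -
  obtain x where x: "x \<in> X" "w = to_disc (of_real x)" using assms(1) by blast
  have op: "open (- {- \<i>})" by blast
  have cont: "continuous_on (- {- \<i>}) to_disc"
    unfolding to_disc_def by (intro continuous_intros) (auto simp: eq_neg_iff_add_eq_0)
  have "open (- {- \<i>} \<inter> to_disc -` ball w e)"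
    using continuous_open_preimage[OF cont op] by blast
  moreover have "of_real x \<in> - {- \<i>} \<inter> to_disc -` ball w e"
  proof -
    have "complex_of_real x \<noteq> - \<i>" by (simp add: complex_eq_iff)
    then show ?thesis using x(2) assms(2) by simp
  qed
  ultimately obtain d where d: "d > 0" "ball (of_real x) d \<subseteq> - {- \<i>} \<inter> to_disc -` ball w e"
    using open_contains_ball by blast
  obtain N where N: "open N" "of_real x \<in> N" "N \<subseteq> ball (of_real x) d" "connected (N \<inter> half_locus p q)"
    using branch_at_simple_critical_point[OF coprime critical[OF x(1)] simple_root d(1)] by blast
  have "open (- {0} \<inter> from_disc -` N)"
    using N(1) unfolding from_disc_def by (intro continuous_open_preimage continuous_intros) auto
  moreover have "w \<in> - {0} \<inter> from_disc -` N" using x N(2) to_disc_nonzero[of "of_real x"] by auto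
  moreover have "- {0} \<inter> from_disc -` N \<subseteq> ball w e"
  proof
    fix u assume "u \<in> - {0} \<inter> from_disc -` N"
    then have "to_disc (from_disc u) \<in> ball w e" using N(3) d(2) by blast
    then show "u \<in> ball w e" by simp
  qed
  moreover have "connected ((- {0} \<inter> from_disc -` N) \<inter> locus)"
  proof -
    have "(- {0} \<inter> from_disc -` N) \<inter> locus = to_disc ` (N \<inter> half_locus p q)"
      using to_disc_nonzero unfolding locus_image by (auto simp: half_locus_def)
    moreover have "connected (to_disc ` (N \<inter> half_locus p q))"
      using N(3,4) d(2) by (intro connected_continuous_image continuous_on_subset[OF cont]) auto
    ultimately show ?thesis by simp
  qed
  ultimately show ?thesis by blast
qed


theorem half_plane_chord:
  assumes z0: "z0 \<in> half_locus p q"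
  obtains \<gamma> D \<phi> where "arc \<gamma>" "pathstart \<gamma> \<in> of_real ` X" "pathfinish \<gamma> \<in> of_real ` X" "z0 \<in> chord \<gamma>"
    "open D" "D \<subseteq> upper_half_plane" "D \<inter> half_locus p q = chord \<gamma>"
    "closure D \<inter> upper_half_plane \<subseteq> D \<union> half_locus p q"
    "conformal_onto \<phi> D upper_half_plane"
    "\<And>t. t \<in> {0<..<1} \<Longrightarrow> \<phi> (\<gamma> t) = \<i> * of_real (sqrt (t / (1 - t)))"
proof -
  have "\<exists>\<gamma> D \<phi>. arc \<gamma> \<and> pathstart \<gamma> \<in> to_disc ` of_real ` X \<and> pathfinish \<gamma> \<in> to_disc ` of_real ` X
      \<and> to_disc z0 \<in> chord \<gamma> \<and> open D \<and> D \<subseteq> disc \<and> D \<inter> locus = chord \<gamma> \<and> closure D \<inter> disc \<subseteq> D \<union> locus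
      \<and> conformal_onto \<phi> D upper_half_plane \<and> (\<forall>t\<in>{0<..<1}. \<phi> (\<gamma> t) = \<i> * of_real (sqrt (t / (1 - t))))"
  proof (rule locus_chord[of "to_disc z0" "to_disc ` of_real ` X"])
    show "to_disc z0 \<in> locus" using z0 locus_image by blast
  qed (use closure_locus_frontier branch in blast)+
  then obtain \<gamma> D \<phi> where \<gamma>: "arc \<gamma>" "pathstart \<gamma> \<in> to_disc ` of_real ` X" "pathfinish \<gamma> \<in> to_disc ` of_real ` X"
      "to_disc z0 \<in> chord \<gamma>"
    and D: "open D" "D \<subseteq> disc" "D \<inter> locus = chord \<gamma>" "closure D \<inter> disc \<subseteq> D \<union> locus"
    and \<phi>: "conformal_onto \<phi> D upper_half_plane"
      "\<forall>t\<in>{0<..<1}. \<phi> (\<gamma> t) = \<i> * of_real (sqrt (t / (1 - t)))"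
    by blast
  define \<gamma>' where "\<gamma>' = from_disc \<circ> \<gamma>"
  define D' where "D' = upper_half_plane \<inter> to_disc -` D"
  define \<phi>' where "\<phi>' = \<phi> \<circ> to_disc"
  have op: "open upper_half_plane"
    unfolding upper_half_plane_def by (rule open_halfspace_Im_gt)
  have holt: "to_disc holomorphic_on upper_half_plane"
    unfolding to_disc_def upper_half_plane_def by (intro holomorphic_intros) (auto simp: complex_eq_iff)
  then have cont: "continuous_on upper_half_plane to_disc"
    by (rule holomorphic_on_imp_continuous_on)
  have preim: "open (upper_half_plane \<inter> to_disc -` S)" if "open S" for S
    using continuous_open_preimage[OF cont op that] .
  have chord_D: "\<gamma> t \<in> D" "\<gamma> t \<in> locus" if "0 < t" "t < 1" for t
    using D(3) that by (auto simp: chord_def)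
  \<comment> \<open>The point 0 stands for infinity. It is neither in the disc nor the image of a
    point of \<open>X\<close>, so the curve stays finite after the return to the half-plane,
    including its ends.\<close>
  have nz: "\<gamma> t \<noteq> 0" if "t \<in> {0..1}" for t
  proof -
    have X: "x \<noteq> 0" if "x \<in> to_disc ` of_real ` X" for x using that to_disc_nonzero by auto
    consider "t = 0" | "t = 1" | "0 < t" "t < 1" using \<open>t \<in> {0..1}\<close> by fastforce
    then show ?thesis
    proof cases
      case 3
      then show ?thesis using chord_D(1)[OF 3] D(2) disc_iff_Im by blast
    qed (use X \<gamma>(2,3) in \<open>auto simp: pathstart_def pathfinish_def\<close>)
  qed
  have "arc \<gamma>'"
    unfolding arc_def path_def
  proof
    show "continuous_on {0..1} \<gamma>'"
      unfolding \<gamma>'_def o_def from_disc_def using \<gamma>(1) nz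
      by (intro continuous_intros) (auto simp: arc_def path_def)
    show "inj_on \<gamma>' {0..1}"
      using \<gamma>(1) unfolding arc_def inj_on_def \<gamma>'_def o_def by (metis to_from_disc)
  qed
  moreover have "pathstart \<gamma>' \<in> of_real ` X" "pathfinish \<gamma>' \<in> of_real ` X"
    using \<gamma>(2,3) by (auto simp: \<gamma>'_def pathstart_def pathfinish_def)
  moreover have "z0 \<in> chord \<gamma>'"
    using \<gamma>(4) unfolding chord_def \<gamma>'_def by (metis (no_types, lifting) comp_apply from_to_disc image_iff)
  moreover have "open D'" unfolding D'_def by (rule preim) fact
  moreover have "D' \<subseteq> upper_half_plane" by (auto simp: D'_def)
  moreover have "D' \<inter> half_locus p q = chord \<gamma>'"
  proof (intro equalityI subsetI)
    fix z assume z: "z \<in> D' \<inter> half_locus p q"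
    then have "to_disc z \<in> D \<inter> locus" using locus_image by (auto simp: D'_def)
    then obtain t where "t \<in> {0<..<1}" "to_disc z = \<gamma> t" using D(3) by (auto simp: chord_def)
    then show "z \<in> chord \<gamma>'"
      unfolding chord_def \<gamma>'_def by (metis comp_apply from_to_disc imageI)
  next
    fix z assume "z \<in> chord \<gamma>'"
    then obtain t where t: "0 < t" "t < 1" "z = from_disc (\<gamma> t)" by (auto simp: chord_def \<gamma>'_def)
    then show "z \<in> D' \<inter> half_locus p q"
      using chord_D[OF t(1,2)] locus_iff[of "\<gamma> t"] D(2)
      by (auto simp: D'_def upper_half_plane_def half_locus_def)
  qed
  moreover have "closure D' \<inter> upper_half_plane \<subseteq> D' \<union> half_locus p q"
  proof
    fix z assume z: "z \<in> closure D' \<inter> upper_half_plane"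
    have "to_disc z \<in> closure D"
    proof (rule ccontr)
      assume "to_disc z \<notin> closure D"
      then have "z \<in> upper_half_plane \<inter> to_disc -` (- closure D)" using z by simp
      then have "D' \<inter> (upper_half_plane \<inter> to_disc -` (- closure D)) \<noteq> {}"
        using z preim[of "- closure D"] closure_iff_nhds_not_empty[of z D'] by auto
      then show False using closure_subset by (auto simp: D'_def)
    qed
    moreover have "to_disc z \<in> disc"
      using z to_disc_in_disc by (simp add: upper_half_plane_def)
    ultimately have "to_disc z \<in> D \<or> to_disc z \<in> locus" using D(4) by blast
    then show "z \<in> D' \<union> half_locus p q" using z locus_iff by (auto simp: D'_def)
  qed
  moreover have "conformal_onto \<phi>' D' upper_half_plane"
    unfolding conformal_onto_def
  proof (intro conjI)
    have "to_disc holomorphic_on D'" using holt by (rule holomorphic_on_subset) (auto simp: D'_def)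
    then show "\<phi>' holomorphic_on D'"
      unfolding \<phi>'_def using \<phi>(1)
      by (intro holomorphic_on_compose_gen[of _ _ _ D]) (auto simp: conformal_onto_def D'_def)
    have "bij_betw to_disc D' D"
    proof (rule bij_betw_byWitness[of _ from_disc])
      show "from_disc ` D \<subseteq> D'" using D(2) disc_iff_Im by (auto simp: D'_def upper_half_plane_def)
    qed (auto simp: D'_def)
    then show "bij_betw \<phi>' D' upper_half_plane"
      unfolding \<phi>'_def using \<phi>(1) by (auto simp: conformal_onto_def intro: bij_betw_trans)
  qed fact
  moreover have "\<phi>' (\<gamma>' t) = \<i> * of_real (sqrt (t / (1 - t)))" if "t \<in> {0<..<1}" for t
    using \<phi>(2) that by (simp add: \<phi>'_def \<gamma>'_def)
  ultimately show ?thesis by (rule that)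
qed

lemma half_plane_branch:
  assumes "x \<in> X" "e > 0"
  shows "\<exists>N. open N \<and> of_real x \<in> N \<and> N \<subseteq> ball (of_real x) e \<and> connected (N \<inter> half_locus p q) \<and> N \<inter> half_locus p q \<noteq> {}"
  using branch_at_simple_critical_point[OF coprime critical[OF assms(1)] simple_root assms(2)] .

end

section \<open>Chords in the half-plane and the link pattern\<close>

lemma clopen_connected_in_components:
  assumes "connected C" "C \<noteq> {}" "openin (top_of_set S) C" "closedin (top_of_set S) C"
  shows "C \<in> components S"
proof -
  obtain z where z: "z \<in> C" using assms(2) by blast
  have "C \<subseteq> S" using assms(3) openin_imp_subset by blast
  have "connected_component_set S z \<subseteq> C"
  proof -
    let ?K = "connected_component_set S z"
    have "?K \<subseteq> S" by (rule connected_component_subset)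
    then have "openin (top_of_set ?K) (?K \<inter> C)" "closedin (top_of_set ?K) (?K \<inter> C)"
      using assms(3,4) by (auto simp: openin_open closedin_closed)
    moreover have "z \<in> ?K \<inter> C" using z \<open>C \<subseteq> S\<close> by (auto intro: connected_component_refl)
    ultimately have "?K \<inter> C = ?K"
      using connected_connected_component[of S z] unfolding connected_clopen by blast
    then show ?thesis by blast
  qed
  moreover have "C \<subseteq> connected_component_set S z"
    using connected_component_maximal[OF z assms(1) \<open>C \<subseteq> S\<close>] .
  ultimately show ?thesis
    using z \<open>C \<subseteq> S\<close> unfolding components_def by blast
qed

lemma path_image_chord: "path_image \<gamma> = insert (pathstart \<gamma>) (insert (pathfinish \<gamma>) (chord \<gamma>))"
proof -
  have "{0..1::real} = insert 0 (insert 1 {0<..<1})" by auto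
  then show ?thesis by (simp add: path_image_def chord_def pathstart_def pathfinish_def)
qed

lemma path_image_subset_closure_chord:
  assumes "path \<gamma>"
  shows "path_image \<gamma> \<subseteq> closure (chord \<gamma>)"
proof -
  have "\<gamma> ` closure {0<..<1} \<subseteq> closure (\<gamma> ` {0<..<1})"
    using assms closure_subset[of "\<gamma> ` {0<..<1}"] by (intro image_closure_subset) (auto simp: path_def)
  then show ?thesis by (simp add: path_image_def chord_def)
qed

lemma connected_chord: "path \<gamma> \<Longrightarrow> connected (chord \<gamma>)"
  unfolding chord_def path_def
  by (intro connected_continuous_image) (auto intro: continuous_on_subset connected_Ioo)

lemma chord_nonempty: "chord \<gamma> \<noteq> {}"
  by (simp add: chord_def)

text \<open>On the imaginary axis the argument of \<open>arcosh\<close> simplifies to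
  \<open>cosh (s - t)\<close>, so the logarithm of the height is a unit-speed parameter.\<close>

lemma uhp_dist_vertical:
  "uhp_dist (\<i> * of_real (exp s)) (\<i> * of_real (exp t)) = \<bar>s - t\<bar>"
proof -
  have "(cmod (\<i> * of_real (exp s) - \<i> * of_real (exp t)))\<^sup>2 = (exp s - exp t)\<^sup>2"
    by (simp add: cmod_power2)
  then have "1 + (cmod (\<i> * of_real (exp s) - \<i> * of_real (exp t)))\<^sup>2
      / (2 * Im (\<i> * of_real (exp s)) * Im (\<i> * of_real (exp t)))
      = 1 + (exp s - exp t)\<^sup>2 / (2 * exp s * exp t)"
    by simp
  also have "\<dots> = (exp s / exp t + exp t / exp s) / 2"
  proof -
    have "1 + (x - y)\<^sup>2 / (2 * x * y) = (x / y + y / x) / 2" if "x > 0" "y > 0" for x y :: real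
    proof -
      have "x / y + y / x = (x\<^sup>2 + y\<^sup>2) / (x * y)"
        using that by (simp add: add_frac_eq power2_eq_square mult.commute)
      moreover have "(x - y)\<^sup>2 / (2 * x * y) = (x\<^sup>2 + y\<^sup>2) / (x * y) / 2 - 1"
        using that by (simp add: power2_diff diff_divide_distrib mult.assoc)
      ultimately show ?thesis by (metis add.commute diff_add_cancel)
    qed
    then show ?thesis by simp
  qed
  also have "\<dots> = cosh (s - t)"
    unfolding cosh_field_def by (simp add: exp_diff)
  finally have "1 + (cmod (\<i> * of_real (exp s) - \<i> * of_real (exp t)))\<^sup>2
      / (2 * Im (\<i> * of_real (exp s)) * Im (\<i> * of_real (exp t))) = cosh (s - t)" .
  then show ?thesis
    unfolding uhp_dist_def by (metis abs_ge_zero arcosh_cosh_real cosh_real_abs)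
qed

lemma hyperbolic_geodesic_chordI:
  assumes "arc \<gamma>" and D: "open D" "chord \<gamma> \<subseteq> D" "pathstart \<gamma> \<notin> D" "pathfinish \<gamma> \<notin> D"
    and \<phi>: "conformal_onto \<phi> D upper_half_plane"
      "\<And>t. t \<in> {0<..<1} \<Longrightarrow> \<phi> (\<gamma> t) = \<i> * of_real (sqrt (t / (1 - t)))"
  shows "hyperbolic_geodesic D (pathstart \<gamma>) (pathfinish \<gamma>) (chord \<gamma>)"
proof -
  have "path_image \<gamma> \<subseteq> closure D"
    using path_image_subset_closure_chord[OF arc_imp_path[OF assms(1)]] closure_mono[OF D(2)] by blast
  then have front: "pathstart \<gamma> \<in> frontier D" "pathfinish \<gamma> \<in> frontier D"
    using D by (auto simp: frontier_def interior_open)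
  have cont: "continuous_on {0..1} \<gamma>" using assms(1) by (simp add: arc_def path_def)
  \<comment> \<open>The logistic function, obtained by solving
    \<open>sqrt (t / (1 - t)) = exp s\<close> for \<open>t\<close>. It turns the given
    parametrization into the unit-speed one.\<close>
  define \<tau> :: "real \<Rightarrow> real" where "\<tau> s = exp (2 * s) / (1 + exp (2 * s))" for s
  have \<tau>: "0 < \<tau> s" "\<tau> s < 1" "\<tau> s / (1 - \<tau> s) = (exp s)\<^sup>2" for s
  proof -
    have pos: "1 + exp (2 * s) > 0" by (simp add: add_pos_pos)
    then show "0 < \<tau> s" "\<tau> s < 1" by (simp_all add: \<tau>_def divide_simps)
    have "1 - \<tau> s = 1 / (1 + exp (2 * s))" using pos by (simp add: \<tau>_def divide_simps)
    then have "\<tau> s / (1 - \<tau> s) = exp (2 * s)" using pos by (simp add: \<tau>_def)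
    then show "\<tau> s / (1 - \<tau> s) = (exp s)\<^sup>2" by (simp add: exp_double)
  qed
  have \<tau>_ev: "eventually (\<lambda>s. \<tau> s \<in> {0..1}) F" for F
    using \<tau> by (intro always_eventually) (auto intro: less_imp_le)
  have "(\<tau> \<longlongrightarrow> 0) at_bot" "(\<tau> \<longlongrightarrow> 1) at_top"
    unfolding \<tau>_def by real_asymp+
  then have lim: "((\<lambda>s. \<gamma> (\<tau> s)) \<longlongrightarrow> pathstart \<gamma>) at_bot" "((\<lambda>s. \<gamma> (\<tau> s)) \<longlongrightarrow> pathfinish \<gamma>) at_top"
    unfolding pathstart_def pathfinish_def
    using continuous_on_tendsto_compose[OF cont _ _ \<tau>_ev] by auto
  have "t \<in> range \<tau>" if "0 < t" "t < 1" for t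
  proof -
    define s where "s = ln (t / (1 - t)) / 2"
    have "exp (2 * s) = t / (1 - t)" using that by (simp add: s_def)
    then have "exp (2 * s) = t * (1 + exp (2 * s))" using that by (simp add: field_simps)
    moreover have "1 + exp (2 * s) > 0" by (simp add: add_pos_pos)
    ultimately have "\<tau> s = t" by (simp add: \<tau>_def divide_eq_eq)
    then show ?thesis by blast
  qed
  then have "range \<tau> = {0<..<1}" using \<tau> by auto
  then have range: "range (\<lambda>s. \<gamma> (\<tau> s)) = chord \<gamma>"
    by (metis chord_def image_image)
  have "\<phi> (\<gamma> (\<tau> s)) = \<i> * of_real (exp s)" for s
    using \<phi>(2)[of "\<tau> s"] \<tau>[of s] by (simp add: real_sqrt_unique)
  then have "\<forall>s t. uhp_dist (\<phi> (\<gamma> (\<tau> s))) (\<phi> (\<gamma> (\<tau> t))) = \<bar>s - t\<bar>"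
    using uhp_dist_vertical by simp
  then show ?thesis
    unfolding hyperbolic_geodesic_def using front \<phi>(1) lim range D(2) by metis
qed

text \<open>Both paths lie in a rectangle whose bottom side contains their four interlaced ends, so
  the planar crossing theorem applies after identifying the complex numbers with
  \<open>real^2\<close>.\<close>

lemma half_plane_paths_cross:
  fixes f g :: "real \<Rightarrow> complex"
  assumes "path f" "path g"
    and upper: "\<And>z. z \<in> path_image f \<union> path_image g \<Longrightarrow> Im z \<ge> 0"
    and ends: "pathstart f = of_real a" "pathfinish f = of_real b" "pathstart g = of_real c" "pathfinish g = of_real d"
    and less: "a < c" "c < b" "b < d"
  shows "path_image f \<inter> path_image g \<noteq> {}"
proof -
  define \<iota> :: "complex \<Rightarrow> real^2" where "\<iota> z = vector [Re z, Im z]" for z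
  have \<iota>: "\<iota> z $ 1 = Re z" "\<iota> z $ 2 = Im z" for z by (simp_all add: \<iota>_def)
  have "linear \<iota>"
    by (intro linearI) (simp_all add: vec_eq_iff forall_2 \<iota>)
  then have cont: "continuous_on S \<iota>" for S by (rule linear_continuous_on[OF linear_conv_bounded_linear[THEN iffD1]])
  have inj: "z = z'" if "\<iota> z = \<iota> z'" for z z'
    using that \<iota> by (metis complex_eqI)
  have "bounded (path_image f \<union> path_image g)"
    using assms(1,2) by (simp add: bounded_path_image)
  then obtain B where B: "\<And>z. z \<in> path_image f \<union> path_image g \<Longrightarrow> cmod z \<le> B"
    by (auto simp: bounded_iff)
  define l u :: "real^2" where "l = vector [- B, 0]" and "u = vector [B, B]"
  have box: "\<iota> z \<in> cbox l u" if "z \<in> path_image f \<union> path_image g" for z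
    using B[OF that] upper[OF that] abs_Re_le_cmod[of z] abs_Im_le_cmod[of z]
    by (auto simp: mem_box_cart forall_2 l_def u_def \<iota>)
  have img: "path_image (\<iota> \<circ> h) = \<iota> ` path_image h" for h by (rule path_image_compose)
  obtain y where "y \<in> path_image (\<iota> \<circ> f)" "y \<in> path_image (\<iota> \<circ> g)"
  proof (rule fashoda_interlace[of "\<iota> \<circ> f" "\<iota> \<circ> g" l u])
    show "path (\<iota> \<circ> f)" "path (\<iota> \<circ> g)"
      using assms(1,2) cont by (simp_all add: path_continuous_image)
    show "path_image (\<iota> \<circ> f) \<subseteq> cbox l u" "path_image (\<iota> \<circ> g) \<subseteq> cbox l u"
      unfolding img using box by auto
  qed (use ends less in \<open>auto simp: pathstart_compose pathfinish_compose \<iota> l_def\<close>)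
  then obtain z z' where "z \<in> path_image f" "z' \<in> path_image g" "\<iota> z = \<iota> z'"
    unfolding img by blast
  then show ?thesis using inj by blast
qed

text \<open>In the chart at the value, the map is \<open>p / q\<close>, or \<open>q / p\<close> at a
  pole. In both cases the numerator of the derivative is the Wronskian up to sign.\<close>

lemma critical_point_imp_wronskian_root:
  assumes "coprime p q" and crit: "critical_point (rational_map p q) (Some (of_real x))"
  shows "poly (wronskian p q) x = 0"
proof -
  let ?z = "complex_of_real x" and ?p = "poly (cpoly p)" and ?q = "poly (cpoly q)"
  let ?f = "\<lambda>w. sphere_chart (rational_map p q (Some ?z)) (rational_map p q (sphere_chart_inv (Some ?z) w))"
  have f0: "(?f has_field_derivative 0) (at ?z)"
    using crit by (simp add: critical_point_def sphere_chart_def)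
  have W: "poly (cpoly (wronskian p q)) ?z = poly (pderiv (cpoly p)) ?z * ?q ?z - ?p ?z * poly (pderiv (cpoly q)) ?z"
    unfolding cpoly_wronskian by (simp add: wronskian_def)
  have "poly (cpoly (wronskian p q)) ?z = 0"
  proof (cases "?q ?z = 0")
    case True
    then have nz: "?p ?z \<noteq> 0" using coprime_cpoly_no_common_root[OF assms(1)] by blast
    \<comment> \<open>This holds for every \<open>w\<close>: at zeros of \<open>q\<close> the chart
      sends infinity to 0, and at zeros of \<open>p\<close> both sides divide by zero.\<close>
    have "?f = (\<lambda>w. ?q w / ?p w)"
      using True by (auto simp: fun_eq_iff rational_map_def sphere_chart_def sphere_chart_inv_def)
    then have "((\<lambda>w. ?q w / ?p w) has_field_derivative 0) (at ?z)" using f0 by simp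
    moreover have "((\<lambda>w. ?q w / ?p w) has_field_derivative
        (poly (pderiv (cpoly q)) ?z * ?p ?z - ?q ?z * poly (pderiv (cpoly p)) ?z) / (?p ?z * ?p ?z)) (at ?z)"
      using nz by (intro DERIV_divide poly_DERIV)
    ultimately have "(poly (pderiv (cpoly q)) ?z * ?p ?z - ?q ?z * poly (pderiv (cpoly p)) ?z) / (?p ?z * ?p ?z) = 0"
      using DERIV_unique by blast
    then show ?thesis using nz unfolding W by (simp add: algebra_simps)
  next
    case False
    have "open {w. ?q w \<noteq> 0}" by (intro open_Collect_neq continuous_intros)
    then have "((\<lambda>w. ?p w / ?q w) has_field_derivative 0) (at ?z)"
      by (rule has_field_derivative_transform_within_open[OF f0])
        (use False in \<open>auto simp: rational_map_def sphere_chart_def sphere_chart_inv_def\<close>)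
    moreover have "((\<lambda>w. ?p w / ?q w) has_field_derivative
        (poly (pderiv (cpoly p)) ?z * ?q ?z - ?p ?z * poly (pderiv (cpoly q)) ?z) / (?q ?z * ?q ?z)) (at ?z)"
      using False by (intro DERIV_divide poly_DERIV)
    ultimately have "(poly (pderiv (cpoly p)) ?z * ?q ?z - ?p ?z * poly (pderiv (cpoly q)) ?z) / (?q ?z * ?q ?z) = 0"
      using DERIV_unique by blast
    then show ?thesis using False unfolding W by simp
  qed
  then show ?thesis by (simp add: poly_cpoly_of_real)
qed

lemma real_locus_rational_map:
  "real_locus (rational_map p q) = extended_reals \<union> Some ` (half_locus p q \<union> cnj ` half_locus p q)"
proof -
  have ext: "Some u \<in> extended_reals \<longleftrightarrow> Im u = 0" for u
    by (auto simp: extended_reals_def complex_is_Real_iff)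
  have div: "Im (a / b) = 0 \<longleftrightarrow> Im (a * cnj b) = 0" if "b \<noteq> 0" for a b :: complex
    using that by (simp add: complex_div_cnj[of a b] del: complex_cnj_mult flip: of_real_power)
  have fin: "Some w \<in> real_locus (rational_map p q) \<longleftrightarrow> Im (poly (cpoly p) w * cnj (poly (cpoly q) w)) = 0" for w
  proof (cases "poly (cpoly q) w = 0")
    case True
    then show ?thesis by (simp add: real_locus_def rational_map_def extended_reals_def)
  next
    case False
    then show ?thesis
      using div[OF False, of "poly (cpoly p) w"] by (simp only: real_locus_def rational_map_def ext mem_Collect_eq option.case if_False)
  qed
  have inf: "None \<in> real_locus (rational_map p q)"
    by (auto simp: real_locus_def rational_map_def extended_reals_def)
  have real: "Im (poly (cpoly p) w * cnj (poly (cpoly q) w)) = 0" if "Im w = 0" for w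
  proof -
    have "w = of_real (Re w)" using that by (simp add: complex_eq_iff)
    then show ?thesis by (metis poly_cpoly_of_real complex_cnj_complex_of_real of_real_mult Im_complex_of_real)
  qed
  have conj: "Im (poly (cpoly p) (cnj w) * cnj (poly (cpoly q) (cnj w))) = - Im (poly (cpoly p) w * cnj (poly (cpoly q) w))" for w
    by (simp add: poly_cpoly_cnj algebra_simps)
  have "Some w \<in> real_locus (rational_map p q) \<longleftrightarrow> Im w = 0 \<or> w \<in> half_locus p q \<or> cnj w \<in> half_locus p q" for w
    unfolding fin using real[of w] conj[of w] by (cases "Im w" "0::real" rule: linorder_cases) (auto simp: half_locus_def)
  moreover have "cnj w \<in> half_locus p q \<longleftrightarrow> w \<in> cnj ` half_locus p q" for w
    by (metis complex_cnj_cnj image_iff)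
  ultimately have "z \<in> real_locus (rational_map p q) \<longleftrightarrow> z \<in> extended_reals \<union> Some ` (half_locus p q \<union> cnj ` half_locus p q)" for z
    using inf by (cases z) (auto simp: ext, auto simp: extended_reals_def)
  then show ?thesis by blast
qed

section \<open>Edges as components of the locus, their number and their link pattern\<close>

context simple_critical_points
begin

text \<open>The chord is relatively open because \<open>D\<close> is open. It is relatively closed
  because its end points are real: adding them gives a compact path without adding points of the
  locus.\<close>

lemma chord_in_components:
  assumes "arc \<gamma>" "pathstart \<gamma> \<in> of_real ` X" "pathfinish \<gamma> \<in> of_real ` X" "open D" "D \<inter> half_locus p q = chord \<gamma>"
  shows "chord \<gamma> \<in> components (half_locus p q)"
proof (rule clopen_connected_in_components)
  show "connected (chord \<gamma>)" using assms(1) by (intro connected_chord arc_imp_path)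
  show "openin (top_of_set (half_locus p q)) (chord \<gamma>)"
    using assms(4,5) by (auto simp: openin_open)
  have "pathstart \<gamma> \<notin> half_locus p q" "pathfinish \<gamma> \<notin> half_locus p q"
    using assms(2,3) by (auto simp: half_locus_def)
  then have "chord \<gamma> = half_locus p q \<inter> path_image \<gamma>"
    unfolding path_image_chord using assms(5) by blast
  moreover have "closed (path_image \<gamma>)" using assms(1) arc_imp_path closed_path_image by blast
  ultimately show "closedin (top_of_set (half_locus p q)) (chord \<gamma>)"
    unfolding closedin_closed by blast
qed (rule chord_nonempty)

lemma component_chord:
  assumes "C \<in> components (half_locus p q)"
  shows "\<exists>\<gamma> D \<phi>. arc \<gamma> \<and> pathstart \<gamma> \<in> of_real ` X \<and> pathfinish \<gamma> \<in> of_real ` X \<and> chord \<gamma> = C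
    \<and> open D \<and> D \<subseteq> upper_half_plane \<and> D \<inter> half_locus p q = C \<and> closure D \<inter> upper_half_plane \<subseteq> D \<union> half_locus p q
    \<and> conformal_onto \<phi> D upper_half_plane \<and> (\<forall>t\<in>{0<..<1}. \<phi> (\<gamma> t) = \<i> * of_real (sqrt (t / (1 - t))))"
proof -
  obtain z where z: "z \<in> half_locus p q" "z \<in> C"
    using assms in_components_nonempty in_components_subset by blast
  show ?thesis
  proof (rule half_plane_chord[OF z(1)])
    fix \<gamma> D \<phi>
    assume *: "arc \<gamma>" "pathstart \<gamma> \<in> of_real ` X" "pathfinish \<gamma> \<in> of_real ` X" "z \<in> chord \<gamma>"
      "open D" "D \<subseteq> upper_half_plane" "D \<inter> half_locus p q = chord \<gamma>"
      "closure D \<inter> upper_half_plane \<subseteq> D \<union> half_locus p q"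
      "conformal_onto \<phi> D upper_half_plane"
      "\<And>t. t \<in> {0<..<1} \<Longrightarrow> \<phi> (\<gamma> t) = \<i> * of_real (sqrt (t / (1 - t)))"
    have "chord \<gamma> \<in> components (half_locus p q)"
      by (rule chord_in_components) fact+
    then have "chord \<gamma> = C"
      using assms z(2) *(4) components_nonoverlap by blast
    then show ?thesis using * by blast
  qed
qed

text \<open>The edges are the components of the locus in the half-plane. Each has two end points in
  \<open>X\<close>, and each point of \<open>X\<close> is an end point of exactly one of them, so
  there are \<open>n\<close> edges and their end points form a pairing. A crossing pair would force
  two edges to intersect.\<close>

theorem geodesic_multichord_half_locus: "geodesic_multichord_property n X (real_locus (rational_map p q))"
proof -
  let ?G = "half_locus p q" and ?CC = "components (half_locus p q)"
  define good where "good C \<gamma> D \<phi> \<longleftrightarrow> arc \<gamma> \<and> pathstart \<gamma> \<in> of_real ` X \<and> pathfinish \<gamma> \<in> of_real ` X \<and> chord \<gamma> = C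
    \<and> open D \<and> D \<subseteq> upper_half_plane \<and> D \<inter> ?G = C \<and> closure D \<inter> upper_half_plane \<subseteq> D \<union> ?G
    \<and> conformal_onto \<phi> D upper_half_plane \<and> (\<forall>t\<in>{0<..<1}. \<phi> (\<gamma> t) = \<i> * of_real (sqrt (t / (1 - t))))" for C \<gamma> D \<phi>
  have "\<forall>C\<in>?CC. \<exists>\<gamma> D \<phi>. good C \<gamma> D \<phi>"
    using component_chord unfolding good_def by blast
  then obtain \<gamma> D \<phi> where good: "\<And>C. C \<in> ?CC \<Longrightarrow> good C (\<gamma> C) (D C) (\<phi> C)"
    by metis
  have arc: "arc (\<gamma> C)" and ends_X: "pathstart (\<gamma> C) \<in> of_real ` X" "pathfinish (\<gamma> C) \<in> of_real ` X"
    and chord: "chord (\<gamma> C) = C"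
    and D: "open (D C) \<and> D C \<subseteq> upper_half_plane \<and> D C \<inter> ?G = C \<and> closure (D C) \<inter> upper_half_plane \<subseteq> D C \<union> ?G"
    and \<phi>: "conformal_onto (\<phi> C) (D C) upper_half_plane
      \<and> (\<forall>t\<in>{0<..<1}. \<phi> C (\<gamma> C t) = \<i> * of_real (sqrt (t / (1 - t))))"
    if "C \<in> ?CC" for C
    using good[OF that] unfolding good_def by (auto simp only:)
  define e where "e C = {Re (pathstart (\<gamma> C)), Re (pathfinish (\<gamma> C))}" for C
  have e_image: "of_real ` e C = {pathstart (\<gamma> C), pathfinish (\<gamma> C)}" if "C \<in> ?CC" for C
    using ends_X[OF that] by (auto simp: e_def)
  have e_X: "e C \<subseteq> X" if "C \<in> ?CC" for C
    using ends_X[OF that] by (auto simp: e_def)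
  have card_e: "card (e C) = 2" if "C \<in> ?CC" for C
    using arc_distinct_ends[OF arc[OF that]] ends_X[OF that] by (auto simp: e_def)
  have C_G: "C \<subseteq> ?G" if "C \<in> ?CC" for C using that in_components_subset by blast
  have C_upper: "C \<subseteq> upper_half_plane" if "C \<in> ?CC" for C
    using C_G[OF that] by (auto simp: half_locus_def upper_half_plane_def)
  have path_image: "path_image (\<gamma> C) = of_real ` e C \<union> C" if "C \<in> ?CC" for C
    unfolding path_image_chord chord[OF that] e_image[OF that] by blast
  \<comment> \<open>End points are recognized as the real points in the closure of the component,
    which does not refer to the parametrization.\<close>
  have closure: "x \<in> e C \<longleftrightarrow> of_real x \<in> closure C" if C: "C \<in> ?CC" for C x
  proof
    assume "x \<in> e C"
    then have "of_real x \<in> path_image (\<gamma> C)" using path_image[OF C] by blast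
    then show "of_real x \<in> closure C"
      using path_image_subset_closure_chord[OF arc_imp_path[OF arc[OF C]]] chord[OF C] by auto
  next
    assume x: "of_real x \<in> closure C"
    have "closed (path_image (\<gamma> C))" using arc[OF C] arc_imp_path closed_path_image by blast
    then have "closure C \<subseteq> path_image (\<gamma> C)" using path_image[OF C] by (intro closure_minimal) auto
    moreover have "of_real x \<notin> C" using C_upper[OF C] by (auto simp: upper_half_plane_def)
    ultimately have "complex_of_real x \<in> of_real ` e C" using x path_image[OF C] by blast
    then show "x \<in> e C" by auto
  qed
  have absorb: "K \<subseteq> C" if "connected K" "K \<subseteq> ?G" "K \<inter> C \<noteq> {}" "C \<in> ?CC" for K C
    using components_maximal that by (metis inf_commute)
  \<comment> \<open>Near \<open>x\<close> the locus is nonempty and connected, so it lies in a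
    single component. That component accumulates at \<open>x\<close>, and any component that ends at
    \<open>x\<close> must meet it.\<close>
  have ex1: "\<exists>!C. C \<in> ?CC \<and> x \<in> e C" if x: "x \<in> X" for x
  proof -
    obtain N where N: "open N" "of_real x \<in> N" "connected (N \<inter> ?G)" "N \<inter> ?G \<noteq> {}"
      using half_plane_branch[OF x, of 1] by auto
      obtain z where z: "z \<in> N \<inter> ?G" using N(4) by blast
      obtain C where C: "C \<in> ?CC" "z \<in> C" using z by (metis IntD2 UnionE Union_components)
      have sub: "N \<inter> ?G \<subseteq> C" using absorb[OF N(3) _ _ C(1)] z C(2) by blast
      obtain d where d: "d > 0" "ball (of_real x) d \<subseteq> N" using N(1,2) open_contains_ball by blast
      have "of_real x \<in> closure C"
        unfolding closure_approachable
      proof (intro allI impI)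
        fix r :: real assume "r > 0"
        then obtain N' where "N' \<subseteq> ball (of_real x) (min r d)" "N' \<inter> ?G \<noteq> {}"
          using half_plane_branch[OF x, of "min r d"] d(1) by auto
        then obtain y where y: "y \<in> ball (of_real x) (min r d)" "y \<in> ?G" by blast
        then have "y \<in> C" using d(2) sub by (auto simp: subset_iff)
        then show "\<exists>y\<in>C. dist y (of_real x) < r" using y(1) by (auto simp: dist_commute)
      qed
      then have ex: "C \<in> ?CC \<and> x \<in> e C" using C(1) closure by blast
      have "C' = C" if C': "C' \<in> ?CC" "x \<in> e C'" for C'
      proof -
        have "N \<inter> C' \<noteq> {}"
          using closure[OF C'(1)] C'(2) N(1,2) closure_iff_nhds_not_empty[of "of_real x" C'] by blast
        then have "(N \<inter> ?G) \<inter> C' \<noteq> {}" using C_G[OF C'(1)] by blast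
        then have "N \<inter> ?G \<subseteq> C'" using absorb[OF N(3) _ _ C'(1)] by blast
        then show ?thesis using z C C'(1) components_nonoverlap by blast
      qed
    with ex show ?thesis by (intro ex1I[of _ C]) auto
  qed
  have inj_e: "C = C'" if "C \<in> ?CC" "C' \<in> ?CC" "e C \<inter> e C' \<noteq> {}" for C C'
    using ex1 e_X that by blast
  define \<alpha> where "\<alpha> = e ` ?CC"
  have "partition_on X \<alpha>"
  proof (rule partition_onI)
    show "\<Union> \<alpha> = X"
    proof
      show "\<Union> \<alpha> \<subseteq> X" using e_X by (auto simp: \<alpha>_def)
      show "X \<subseteq> \<Union> \<alpha>"
      proof
        fix x assume "x \<in> X"
        then obtain C where "C \<in> ?CC" "x \<in> e C" by (blast dest: ex1_implies_ex[OF ex1])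
        then show "x \<in> \<Union> \<alpha>" unfolding \<alpha>_def by (rule UN_I)
      qed
    qed
    show "{} \<notin> \<alpha>" by (auto simp: \<alpha>_def e_def)
    show "disjnt P P'" if "P \<in> \<alpha>" "P' \<in> \<alpha>" "P \<noteq> P'" for P P'
      using that inj_e unfolding \<alpha>_def disjnt_def by blast
  qed
  have card_P: "card P = 2" if "P \<in> \<alpha>" for P using that card_e by (auto simp: \<alpha>_def)
  have inj_on_e: "inj_on e ?CC"
  proof (rule inj_onI)
    fix C C' assume "C \<in> ?CC" "C' \<in> ?CC" "e C = e C'"
    then show "C = C'" using inj_e[of C C'] by (auto simp: e_def)
  qed
  have "\<Union> \<alpha> = X" using \<open>partition_on X \<alpha>\<close> by (simp add: partition_on_def)
  then have "finite \<alpha>" using finite_X by (metis finite_UnionD)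
  then have fin: "finite ?CC" using inj_on_e by (simp add: \<alpha>_def finite_image_iff)
  have "2 * card \<alpha> = card (\<Union> \<alpha>)"
  proof (rule card_partition)
    show "P \<inter> P' = {}" if "P \<in> \<alpha>" "P' \<in> \<alpha>" "P \<noteq> P'" for P P'
      using that inj_e unfolding \<alpha>_def by blast
  qed (use \<open>finite \<alpha>\<close> \<open>\<Union> \<alpha> = X\<close> finite_X card_P in auto)
  then have "card ?CC = n"
    using card_X \<open>\<Union> \<alpha> = X\<close> card_image[OF inj_on_e] by (simp add: \<alpha>_def)
  then obtain b where b: "bij_betw b {1..n} ?CC"
    using ex_bij_betw_nat_finite_1[OF fin] by auto
  have b_in: "b j \<in> ?CC" if "j \<in> {1..n}" for j using b that by (auto simp: bij_betw_def)
  have b_disj: "b j \<inter> b k = {}" if "j \<in> {1..n}" "k \<in> {1..n}" "j \<noteq> k" for j k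
    using components_nonoverlap[of "b j" ?G "b k"] b_in that b by (metis bij_betw_def inj_on_contraD)
  define \<gamma>' where "\<gamma>' j = \<gamma> (b j)" for j
  have chord': "chord (\<gamma>' j) = b j" if "j \<in> {1..n}" for j
    using chord[OF b_in[OF that]] by (simp add: \<gamma>'_def)
  have union: "(\<Union>j\<in>{1..n}. b j) = ?G"
    using b Union_components[of ?G] by (simp add: bij_betw_def)
  have "noncrossing_link_pattern X \<alpha>"
    unfolding noncrossing_link_pattern_def
  proof (intro conjI notI)
    assume "\<exists>a b c d. {a, b} \<in> \<alpha> \<and> {c, d} \<in> \<alpha> \<and> a < c \<and> c < b \<and> b < d"
    then obtain a b' c d where abcd: "{a, b'} \<in> \<alpha>" "{c, d} \<in> \<alpha>" "a < c" "c < b'" "b' < d" by blast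
    then obtain C C' where C: "C \<in> ?CC" "e C = {a, b'}" and C': "C' \<in> ?CC" "e C' = {c, d}"
      unfolding \<alpha>_def by (metis imageE)
    have oriented: "\<exists>f. path f \<and> pathstart f = of_real s \<and> pathfinish f = of_real t \<and> path_image f = path_image (\<gamma> C)"
      if C: "C \<in> ?CC" "e C = {s, t}" for C s t
    proof -
      have path: "path (\<gamma> C)" using arc[OF C(1)] by (rule arc_imp_path)
      have "{pathstart (\<gamma> C), pathfinish (\<gamma> C)} = {of_real s, of_real t}"
        using e_image[OF C(1)] C(2) by simp
      then consider "pathstart (\<gamma> C) = of_real s" "pathfinish (\<gamma> C) = of_real t"
        | "pathstart (\<gamma> C) = of_real t" "pathfinish (\<gamma> C) = of_real s"
        by (auto simp: doubleton_eq_iff)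
      then show ?thesis
      proof cases
        case 1 then show ?thesis using path by blast
      next
        case 2
        then show ?thesis using path by (intro exI[of _ "reversepath (\<gamma> C)"]) auto
      qed
    qed
    obtain f where f: "path f" "pathstart f = of_real a" "pathfinish f = of_real b'" "path_image f = path_image (\<gamma> C)"
      using oriented[OF C] by blast
    obtain g where g: "path g" "pathstart g = of_real c" "pathfinish g = of_real d" "path_image g = path_image (\<gamma> C')"
      using oriented[OF C'] by blast
    have "path_image f \<inter> path_image g \<noteq> {}"
    proof (rule half_plane_paths_cross[of f g a b' c d])
      show "Im z \<ge> 0" if "z \<in> path_image f \<union> path_image g" for z
        using that f(4) g(4) path_image[OF C(1)] path_image[OF C'(1)] C_upper[OF C(1)] C_upper[OF C'(1)]
        by (auto simp: upper_half_plane_def less_imp_le)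
    qed (use f g abcd in auto)
    moreover have "C \<noteq> C'" using C(2) C'(2) abcd by auto
    then have "C \<inter> C' = {}" using components_nonoverlap[OF C(1) C'(1)] by blast
    moreover have "complex_of_real ` S \<inter> K = {}" if "K \<in> ?CC" for S K
      using C_upper[OF that] by (auto simp: upper_half_plane_def)
    moreover have "complex_of_real ` e C \<inter> of_real ` e C' = {}"
      using C(2) C'(2) abcd by auto
    ultimately show False
      unfolding f(4) g(4) path_image[OF C(1)] path_image[OF C'(1)] using C(1) C'(1) by blast
  qed (use \<open>partition_on X \<alpha>\<close> card_P in auto)
  moreover have "multichord n \<alpha> \<gamma>'"
    unfolding multichord_def
  proof (intro conjI ballI)
    fix j assume j: "j \<in> {1..n}"
    show "arc (\<gamma>' j)" using arc[OF b_in[OF j]] by (simp add: \<gamma>'_def)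
    show "chord (\<gamma>' j) \<subseteq> upper_half_plane" using chord'[OF j] C_upper[OF b_in[OF j]] by simp
  next
    show "disjoint_family_on (\<lambda>j. chord (\<gamma>' j)) {1..n}"
      using b_disj chord' by (auto simp: disjoint_family_on_def)
    have "bij_betw e ?CC \<alpha>" using inj_on_e by (simp add: bij_betw_def \<alpha>_def)
    moreover have "inj_on (\<lambda>P. complex_of_real ` P) \<alpha>"
      by (intro inj_onI) (simp add: inj_image_eq_iff inj_of_real)
    then have "bij_betw (\<lambda>P. complex_of_real ` P) \<alpha> ((\<lambda>P. of_real ` P) ` \<alpha>)"
      by (simp add: bij_betw_def)
    ultimately have "bij_betw ((\<lambda>P. complex_of_real ` P) \<circ> (e \<circ> b)) {1..n} ((\<lambda>P. of_real ` P) ` \<alpha>)"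
      using b by (meson bij_betw_trans)
    moreover have "((\<lambda>P. complex_of_real ` P) \<circ> (e \<circ> b)) j = {pathstart (\<gamma>' j), pathfinish (\<gamma>' j)}" if "j \<in> {1..n}" for j
      using e_image[OF b_in[OF that]] by (simp add: \<gamma>'_def)
    ultimately show "bij_betw (\<lambda>j. {pathstart (\<gamma>' j), pathfinish (\<gamma>' j)}) {1..n} ((\<lambda>P. of_real ` P) ` \<alpha>)"
      using bij_betw_cong[of "{1..n}" "(\<lambda>P. complex_of_real ` P) \<circ> (e \<circ> b)" "\<lambda>j. {pathstart (\<gamma>' j), pathfinish (\<gamma>' j)}"]
      by blast
  qed
  moreover have "real_locus (rational_map p q) = extended_reals \<union> Some ` (\<Union>j\<in>{1..n}. chord (\<gamma>' j) \<union> cnj ` chord (\<gamma>' j))"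
  proof -
    have "(\<Union>j\<in>{1..n}. chord (\<gamma>' j) \<union> cnj ` chord (\<gamma>' j)) = (\<Union>j\<in>{1..n}. b j) \<union> cnj ` (\<Union>j\<in>{1..n}. b j)"
      using chord' by auto
    then show ?thesis unfolding union by (simp add: real_locus_rational_map)
  qed
  moreover have "geodesic_multichord n \<gamma>'"
    unfolding geodesic_multichord_def
  proof
    fix j assume j: "j \<in> {1..n}"
    let ?D = "D (b j)" and ?S = "upper_half_plane - (\<Union>k\<in>{1..n} - {j}. chord (\<gamma>' k))"
    note C = b_in[OF j]
    have others: "(\<Union>k\<in>{1..n} - {j}. chord (\<gamma>' k)) = ?G - b j"
    proof -
      have "(\<Union>k\<in>{1..n} - {j}. chord (\<gamma>' k)) = (\<Union>k\<in>{1..n} - {j}. b k)" using chord' by simp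
      also have "\<dots> = ?G - b j" using union b_disj[OF j] j by blast
      finally show ?thesis .
    qed
    have "?D \<in> components ?S"
    proof (rule clopen_connected_in_components)
      have conf: "open ?D" "\<phi> (b j) holomorphic_on ?D" "bij_betw (\<phi> (b j)) ?D upper_half_plane"
        using \<phi>[OF C] by (auto simp: conformal_onto_def)
      obtain h where h: "h holomorphic_on (\<phi> (b j) ` ?D)" "\<And>z. z \<in> ?D \<Longrightarrow> h (\<phi> (b j) z) = z"
        using holomorphic_has_inverse[OF conf(2,1)] conf(3) by (metis bij_betw_def)
      have im: "\<phi> (b j) ` ?D = upper_half_plane" using conf(3) by (simp add: bij_betw_def)
      have "connected (h ` upper_half_plane)"
        using h(1) im holomorphic_on_imp_continuous_on
        by (intro connected_continuous_image convex_connected) (auto simp: upper_half_plane_def convex_halfspace_Im_gt)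
      moreover have "h ` upper_half_plane = ?D" unfolding im[symmetric] image_image using h(2) by simp
      ultimately show "connected ?D" by simp
      show "?D \<noteq> {}" using D[OF C] in_components_nonempty[OF C] by blast
      have sub: "?D \<subseteq> ?S" using D[OF C] others by blast
      then show "openin (top_of_set ?S) ?D" using conf(1) by (simp add: openin_open_eq openin_open) (metis Int_absorb1)
      \<comment> \<open>Inside the half-plane, the closure of the domain adds only points of the
        other edges, and these are removed from \<open>?S\<close>.\<close>
      have "?D = ?S \<inter> closure ?D" using sub D[OF C] closure_subset[of ?D] others by blast
      then show "closedin (top_of_set ?S) ?D" by (metis closed_closure closedin_closed_Int)
    qed
    moreover have cD: "chord (\<gamma>' j) \<subseteq> ?D" using D[OF C] chord'[OF j] by blast
    moreover have "hyperbolic_geodesic ?D (pathstart (\<gamma>' j)) (pathfinish (\<gamma>' j)) (chord (\<gamma>' j))"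
    proof (rule hyperbolic_geodesic_chordI)
      show "pathstart (\<gamma>' j) \<notin> ?D" "pathfinish (\<gamma>' j) \<notin> ?D"
        using D[OF C] ends_X[OF C] by (auto simp: \<gamma>'_def upper_half_plane_def)
    qed (use arc[OF C] D[OF C] \<phi>[OF C] cD in \<open>auto simp: \<gamma>'_def\<close>)
    ultimately show "\<exists>D\<in>components ?S. chord (\<gamma>' j) \<subseteq> D
        \<and> hyperbolic_geodesic D (pathstart (\<gamma>' j)) (pathfinish (\<gamma>' j)) (chord (\<gamma>' j))"
      by blast
  qed
  ultimately show ?thesis
    unfolding geodesic_multichord_property_def by blast
qed

end

theorem theorem2p6:
  fixes n :: nat and X :: "real set" and R :: "riemann_sphere \<Rightarrow> riemann_sphere"
  assumes "n \<ge> 1"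
    and "finite X" and "card X = 2 * n"
    and "R \<in> CRR (n + 1) X"
  shows "geodesic_multichord_property n X (real_locus R)"
proof -
  obtain p q where R: "coprime p q" "max (degree p) (degree q) = n + 1" "R = rational_map p q"
      "{a. critical_point R a} = (\<lambda>x. Some (of_real x)) ` X"
    using assms(4) by (auto simp: CRR_def)
  interpret simple_critical_points p q n X
  proof
    show "poly (wronskian p q) x = 0" if "x \<in> X" for x
      using critical_point_imp_wronskian_root[OF R(1)] R(3,4) that by blast
  qed (use assms R in auto)
  show ?thesis
    unfolding R(3) by (rule geodesic_multichord_half_locus)
qed

end
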